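(* Let $k\in\mathbb{Z}_{\ge0}^{S}$ have exactly one nonzero entry, $k_\sigma=k$, with $0\le k\le\min\left(p\cdot q-1,\frac{q^{2}}{2}\right)$, and write $k=dq+r$ with $d-1\le r<q$. Let $a\in\mathcal{O}_{C}$ with $v_{F}(a)\ge d$, and let $N\in\mathbb{Z}_{>0}$. Then there exists $\epsilon\in\mathbb{Z}_{\ge0}$ depending only on $N,k,a$ such that for all $n\in\mathbb{Z}_{\ge0}$ and all $f\in\mathrm{ind}_{KZ}^{G}V_{k}$: \[(T-a)(f)\in B_{N}+\varpi^{n}\,\mathrm{ind}_{KZ}^{G}V_{k}^{0}\ \Longrightarrow\ f\in B_{N-1}+\varpi^{n-\epsilon}\,\mathrm{ind}_{KZ}^{G}V_{k}^{0}.\]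
   Context: $p$ is a prime; $F$ is a finite extension of $\mathbb{Q}_{p}$ with ring of integers $\mathcal{O}_{F}$, fixed uniformizer $\varpi$, residue field $\kappa_F$ of cardinality $q$. $C$ is a finite extension of $\mathbb{Q}_{p}$ such that $S=\mathrm{Hom}_{\mathbb{Q}_p\text{-alg}}(F,C)$ has $[F:\mathbb{Q}_{p}]$ elements and $C$ contains a fixed square root of $\sigma(\varpi)$ for each $\sigma\in S$. $v_F$ is the valuation on $\overline{\mathbb{Q}}_p$ with $v_F(\varpi)=1$. In statements about $\mathcal{O}_C$-modules, $\varpi^{n}$ ($n\in\mathbb{Z}$) means $\sigma(\varpi)^{n}$ for a fixed $\sigma\in S$. $G=GL_{2}(F)$, $K=GL_{2}(\mathcal{O}_{F})$, $Z$ the center, $\alpha=\mathrm{diag}(1,\varpi)$, $\chi(g)=\varpi^{-v_{F}(\det g)}$. For $k\in\mathbb{Z}_{\ge0}^{S}$, $V_{k}=\bigotimes_{\sigma\in S}V^{\sigma}_{k_\sigma}$ with $V^{\sigma}_{k_\sigma}$ the homogeneous polynomials of degree $k_\sigma$ in $x_\sigma,y_\sigma$ over $C$, where $g=\begin{pmatrix}a&b\\c&d\end{pmatrix}$ acts by $x_\sigma^{k_\sigma-i}y_\sigma^{i}\mapsto \sigma(\chi(g))^{k_\sigma/2}(\sigma(a)x_\sigma+\sigma(c)y_\sigma)^{k_\sigma-i}(\sigma(b)x_\sigma+\sigma(d)y_\sigma)^{i}$, diagonally (representation $\rho_k$); $V_k^0$ is the $\mathcal{O}_C$-span of tensor products of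 monomials. $U_k$ multiplies $\bigotimes_\sigma x_\sigma^{k_\sigma-i_\sigma}y_\sigma^{i_\sigma}$ by $\prod_\sigma\sigma(\varpi)^{k_\sigma-i_\sigma}$; $\psi$ is the unique function $G\to\mathrm{End}_C(V_k)$ supported on $KZ\alpha^{-1}KZ$ with $\psi(\kappa_1\alpha^{-1}\kappa_2)=\rho_k(\kappa_1)U_k\rho_k(\kappa_2)$ ($\kappa_i\in KZ$). $\mathrm{ind}_{KZ}^{G}W$ ($W=V_k$ or $V_k^0$) consists of $f:G\to W$ with $f(\kappa g)=\rho_k(\kappa)f(g)$ ($\kappa\in KZ$), supported on finitely many cosets $KZg$; $[g,v]$ is supported on $KZg^{-1}$ with value $v$ at $g^{-1}$. $T([g,v])=\sum_{xKZ\in G/KZ}[gx,\psi(x^{-1})v]$. Supports: $I_0=\{0\}$, $I_{n}=\{\sum_{i=0}^{n-1}\varpi^{i}[\mu_{i}]:\mu_i\in\kappa_F\}$; $g_{n,\mu}^{0}=\begin{pmatrix}\varpi^{n}&\mu\\0&1\end{pmatrix}$, $g_{n,\mu}^{1}=\begin{pmatrix}1&0\\\varpi\mu&\varpi^{n+1}\end{pmatrix}$. Every $f$ is uniquely a finite sum $\sum_{n,\mu}([g^0_{n,\mu},v^0_{n,\mu}]+[g^1_{n,\mu},v^1_{n,\mu}])$; $f\in B_N$ means $v^0_{n,\mu}=0$ for $n>N$ and $v^1_{n,\mu}=0$ for $n>N-1$. $B_N+\varpi^n\mathrm{ind}_{KZ}^GV_k^0$ is the set of sums of such elements. *)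

theory Defs
  imports
    "HOL-Analysis.Analysis"
    "HOL-Library.Poly_Mapping"
    "HOL-Computational_Algebra.Primes"
begin

section \<open>Finite extensions of the p-adic numbers\<close>

definition padic_abs :: "nat \<Rightarrow> rat \<Rightarrow> real" where
  "padic_abs p x = (if x = 0 then 0 else
     real p powi (int (multiplicity (int p) (snd (quotient_of x)))
                   - int (multiplicity (int p) (fst (quotient_of x)))))"

definition nonarch_abs :: "('a::field \<Rightarrow> real) \<Rightarrow> bool" where
  "nonarch_abs \<nu> \<longleftrightarrow>
     (\<forall>x. 0 \<le> \<nu> x) \<and> (\<forall>x. \<nu> x = 0 \<longleftrightarrow> x = 0) \<and>
     (\<forall>x y. \<nu> (x * y) = \<nu> x * \<nu> y) \<and>
     (\<forall>x y. \<nu> (x + y) \<le> max (\<nu> x) (\<nu> y))"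

definition abs_complete :: "('a::field \<Rightarrow> real) \<Rightarrow> bool" where
  "abs_complete \<nu> \<longleftrightarrow>
     (\<forall>u :: nat \<Rightarrow> 'a.
        (\<forall>e>0. \<exists>M. \<forall>m\<ge>M. \<forall>n\<ge>M. \<nu> (u m - u n) < e) \<longrightarrow>
        (\<exists>l. (\<lambda>n. \<nu> (u n - l)) \<longlonglongrightarrow> 0))"

text \<open>
  The field of p-adic numbers, i.e. a completion of the rationals for the p-adic absolute value.
  Completions are unique up to a unique isometric isomorphism, so the field is taken
  to be any type carrying such a structure.
\<close>
definition is_Qp :: "nat \<Rightarrow> ('q::field_char_0 \<Rightarrow> real) \<Rightarrow> bool" where
  "is_Qp p \<nu> \<longleftrightarrow>
     nonarch_abs \<nu> \<and>
     (\<forall>x. \<nu> (of_rat x) = padic_abs p x) \<and>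
     (\<forall>x. \<forall>e>0. \<exists>r. \<nu> (x - of_rat r) < e) \<and>
     abs_complete \<nu>"

definition field_hom :: "('a::field \<Rightarrow> 'b::field) \<Rightarrow> bool" where
  "field_hom h \<longleftrightarrow>
     h 1 = 1 \<and> (\<forall>x y. h (x + y) = h x + h y) \<and> (\<forall>x y. h (x * y) = h x * h y)"

definition finite_extension :: "('a::field \<Rightarrow> 'b::field) \<Rightarrow> bool" where
  "finite_extension i \<longleftrightarrow>
     field_hom i \<and> (\<exists>B. finite B \<and> module.span (\<lambda>c x. i c * x) B = UNIV)"

definition extension_degree :: "('a::field \<Rightarrow> 'b::field) \<Rightarrow> nat" where
  "extension_degree i = vector_space.dim (\<lambda>c x. i c * x) UNIV"

definition ring_of_integers :: "('a::field \<Rightarrow> real) \<Rightarrow> 'a set" where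
  "ring_of_integers \<nu> = {x. \<nu> x \<le> 1}"

definition maximal_ideal :: "('a::field \<Rightarrow> real) \<Rightarrow> 'a set" where
  "maximal_ideal \<nu> = {x. \<nu> x < 1}"

definition uniformizer :: "('a::field \<Rightarrow> real) \<Rightarrow> 'a \<Rightarrow> bool" where
  "uniformizer \<nu> \<pi> \<longleftrightarrow> maximal_ideal \<nu> = (\<lambda>x. \<pi> * x) ` ring_of_integers \<nu>"

definition residue_field :: "('a::field \<Rightarrow> real) \<Rightarrow> 'a set set" where
  "residue_field \<nu> = (\<lambda>x. {y. y - x \<in> maximal_ideal \<nu>}) ` ring_of_integers \<nu>"

definition teichmueller :: "('a::field \<Rightarrow> real) \<Rightarrow> 'a set \<Rightarrow> 'a" where
  "teichmueller \<nu> \<mu> = (THE x. x \<in> \<mu> \<and> x ^ card (residue_field \<nu>) = x)"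

text \<open>
  The fields F and C are finite extensions, via \<open>embF\<close> and \<open>embC\<close>, of the field of p-adic
  numbers \<open>'q\<close>; \<open>absF\<close> and \<open>absC\<close> are the (unique) extensions of the p-adic absolute value.
  The value of \<open>sqrt_unif\<close> at an embedding \<open>\<sigma>\<close> of F into C is the chosen square root of
  \<open>\<sigma>\<close> applied to the uniformizer.
\<close>
record ('q, 'f, 'c) padic_data =
  prm :: nat
  absQ :: "'q \<Rightarrow> real"
  embF :: "'q \<Rightarrow> 'f"
  absF :: "'f \<Rightarrow> real"
  embC :: "'q \<Rightarrow> 'c"
  absC :: "'c \<Rightarrow> real"
  unif :: 'f
  sqrt_unif :: "('f \<Rightarrow> 'c) \<Rightarrow> 'c"

definition embeddings ::
    "('q::field_char_0, 'f::field_char_0, 'c::field_char_0) padic_data \<Rightarrow> ('f \<Rightarrow> 'c) set" where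
  "embeddings D = {\<sigma>. field_hom \<sigma> \<and> (\<forall>x. \<sigma> (embF D x) = embC D x)}"

locale padic_setup =
  fixes D :: "('q::field_char_0, 'f::field_char_0, 'c::field_char_0) padic_data"
  assumes prime: "prime (prm D)"
    and Qp: "is_Qp (prm D) (absQ D)"
    and F_finite: "finite_extension (embF D)"
    and F_abs: "nonarch_abs (absF D)" "\<forall>x. absF D (embF D x) = absQ D x"
    and C_finite: "finite_extension (embC D)"
    and C_abs: "nonarch_abs (absC D)" "\<forall>x. absC D (embC D x) = absQ D x"
    and card_embeddings: "card (embeddings D) = extension_degree (embF D)"
    and unif: "uniformizer (absF D) (unif D)"
    and sqrt_unif: "\<forall>\<sigma>\<in>embeddings D. (sqrt_unif D \<sigma>)\<^sup>2 = \<sigma> (unif D)"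

definition resq :: "('q, 'f::field, 'c) padic_data \<Rightarrow> nat" where
  "resq D = card (residue_field (absF D))"

definition OF :: "('q, 'f::field, 'c) padic_data \<Rightarrow> 'f set" where
  "OF D = ring_of_integers (absF D)"

definition OC :: "('q, 'f, 'c::field) padic_data \<Rightarrow> 'c set" where
  "OC D = ring_of_integers (absC D)"

text \<open>
  The valuation normalised to be 1 at the uniformizer of F, on F itself and on C.  Both absolute
  values extend the p-adic one, so the same normalising factor is right on C.
\<close>
definition valF :: "('q, 'f::field, 'c) padic_data \<Rightarrow> 'f \<Rightarrow> ereal" where
  "valF D x = (if x = 0 then \<infinity> else ereal (ln (absF D x) / ln (absF D (unif D))))"

definition valC :: "('q, 'f::field, 'c::field) padic_data \<Rightarrow> 'c \<Rightarrow> ereal" where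
  "valC D x = (if x = 0 then \<infinity> else ereal (ln (absC D x) / ln (absF D (unif D))))"

section \<open>The groups\<close>

definition mat2 :: "'a::zero \<Rightarrow> 'a \<Rightarrow> 'a \<Rightarrow> 'a \<Rightarrow> 'a^2^2" where
  "mat2 a b c d = vector [vector [a, b], vector [c, d]]"

definition GL2 :: "'a::field set \<Rightarrow> ('a^2^2) set" where
  "GL2 R = {g. (\<forall>i j. g $ i $ j \<in> R) \<and>
               (\<exists>h. (\<forall>i j. h $ i $ j \<in> R) \<and> g ** h = mat 1 \<and> h ** g = mat 1)}"

definition center_GL2 :: "('a::field^2^2) set" where
  "center_GL2 = {z \<in> GL2 UNIV. \<forall>g\<in>GL2 UNIV. z ** g = g ** z}"

definition KZ :: "('q, 'f::field, 'c) padic_data \<Rightarrow> ('f^2^2) set" where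
  "KZ D = {\<kappa> ** z | \<kappa> z. \<kappa> \<in> GL2 (OF D) \<and> z \<in> center_GL2}"

definition left_cosets :: "('q, 'f::field, 'c) padic_data \<Rightarrow> ('f^2^2) set set" where
  "left_cosets D = (\<lambda>g. (\<lambda>\<kappa>. g ** \<kappa>) ` KZ D) ` GL2 UNIV"

definition coset_rep :: "('f^2^2) set \<Rightarrow> 'f^2^2" where
  "coset_rep c = (SOME g. g \<in> c)"

definition alpha :: "('q, 'f::field, 'c) padic_data \<Rightarrow> 'f^2^2" where
  "alpha D = mat2 1 0 0 (unif D)"

section \<open>The representation\<close>

text \<open>
  The tensor product over all embeddings of the spaces of homogeneous polynomials in two variables
  is realised as a space of multihomogeneous polynomials in the variables
  \<open>VX \<sigma>\<close>, \<open>VY \<sigma>\<close>, a tensor product of monomials being their product.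
\<close>
datatype 's var = VX 's | VY 's

type_synonym ('f, 'c) tpoly = "(('f \<Rightarrow> 'c) var \<Rightarrow>\<^sub>0 nat) \<Rightarrow>\<^sub>0 'c"

definition const_poly :: "'c::zero \<Rightarrow> ('f, 'c) tpoly" where
  "const_poly c = Poly_Mapping.single 0 c"

definition var_poly :: "('f \<Rightarrow> 'c) var \<Rightarrow> ('f, 'c::zero_neq_one) tpoly" where
  "var_poly v = Poly_Mapping.single (Poly_Mapping.single v 1) 1"

definition subst_poly ::
    "(('f \<Rightarrow> 'c) var \<Rightarrow> ('f, 'c) tpoly) \<Rightarrow> ('f, 'c::comm_ring_1) tpoly \<Rightarrow> ('f, 'c) tpoly" where
  "subst_poly \<theta> P =
     (\<Sum>m\<in>Poly_Mapping.keys P. const_poly (Poly_Mapping.lookup P m) *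
        (\<Prod>v\<in>Poly_Mapping.keys m. \<theta> v ^ Poly_Mapping.lookup m v))"

definition monomials ::
    "('q::field_char_0, 'f::field_char_0, 'c::field_char_0) padic_data \<Rightarrow> (('f \<Rightarrow> 'c) \<Rightarrow> nat) \<Rightarrow>
     (('f \<Rightarrow> 'c) var \<Rightarrow>\<^sub>0 nat) set" where
  "monomials D k =
     {(\<Sum>\<sigma>\<in>embeddings D. Poly_Mapping.single (VX \<sigma>) (k \<sigma> - i \<sigma>) + Poly_Mapping.single (VY \<sigma>) (i \<sigma>))
       | i. \<forall>\<sigma>\<in>embeddings D. i \<sigma> \<le> k \<sigma>}"

definition Vk ::
    "('q::field_char_0, 'f::field_char_0, 'c::field_char_0) padic_data \<Rightarrow> (('f \<Rightarrow> 'c) \<Rightarrow> nat) \<Rightarrow>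
     ('f, 'c) tpoly set" where
  "Vk D k = {P. Poly_Mapping.keys P \<subseteq> monomials D k}"

definition Vk0 ::
    "('q::field_char_0, 'f::field_char_0, 'c::field_char_0) padic_data \<Rightarrow> (('f \<Rightarrow> 'c) \<Rightarrow> nat) \<Rightarrow>
     ('f, 'c) tpoly set" where
  "Vk0 D k = {P \<in> Vk D k. \<forall>m. Poly_Mapping.lookup P m \<in> OC D}"

text \<open>
  The half-integral power of \<open>\<sigma> (\<chi> g)\<close>, with \<open>\<chi> g\<close> the uniformizer to the power
  minus the valuation of \<open>det g\<close>, is taken by means of the chosen square root.
  The valuation is an integer on nonzero elements of F, so that the floor is only a type conversion.
\<close>
definition rho ::
    "('q::field_char_0, 'f::field_char_0, 'c::field_char_0) padic_data \<Rightarrow> (('f \<Rightarrow> 'c) \<Rightarrow> nat) \<Rightarrow>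
     'f^2^2 \<Rightarrow> ('f, 'c) tpoly \<Rightarrow> ('f, 'c) tpoly" where
  "rho D k g P =
     const_poly (\<Prod>\<sigma>\<in>embeddings D.
        sqrt_unif D \<sigma> powi (- \<lfloor>real_of_ereal (valF D (det g))\<rfloor> * int (k \<sigma>))) *
     subst_poly (\<lambda>v. case v of
         VX \<sigma> \<Rightarrow> const_poly (\<sigma> (g$1$1)) * var_poly (VX \<sigma>) + const_poly (\<sigma> (g$2$1)) * var_poly (VY \<sigma>)
       | VY \<sigma> \<Rightarrow> const_poly (\<sigma> (g$1$2)) * var_poly (VX \<sigma>) + const_poly (\<sigma> (g$2$2)) * var_poly (VY \<sigma>)) P"

definition Uk ::
    "('q::field_char_0, 'f::field_char_0, 'c::field_char_0) padic_data \<Rightarrow>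
     ('f, 'c) tpoly \<Rightarrow> ('f, 'c) tpoly" where
  "Uk D P =
     (\<Sum>m\<in>Poly_Mapping.keys P. Poly_Mapping.single m
        (Poly_Mapping.lookup P m *
         (\<Prod>\<sigma>\<in>embeddings D. \<sigma> (unif D) ^ Poly_Mapping.lookup m (VX \<sigma>))))"

text \<open>
  For \<open>v\<close> in \<open>Vk D k\<close> the value does not depend on the decomposition of \<open>x\<close>.
\<close>
definition psi ::
    "('q::field_char_0, 'f::field_char_0, 'c::field_char_0) padic_data \<Rightarrow> (('f \<Rightarrow> 'c) \<Rightarrow> nat) \<Rightarrow>
     'f^2^2 \<Rightarrow> ('f, 'c) tpoly \<Rightarrow> ('f, 'c) tpoly" where
  "psi D k x v =
     (if \<exists>\<kappa>1\<in>KZ D. \<exists>\<kappa>2\<in>KZ D. x = \<kappa>1 ** matrix_inv (alpha D) ** \<kappa>2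
      then THE w. \<forall>\<kappa>1\<in>KZ D. \<forall>\<kappa>2\<in>KZ D.
             x = \<kappa>1 ** matrix_inv (alpha D) ** \<kappa>2 \<longrightarrow> w = rho D k \<kappa>1 (Uk D (rho D k \<kappa>2 v))
      else 0)"

section \<open>Compact induction and the Hecke operator\<close>

text \<open>
  Functions on the group are functions on all matrices which vanish on the singular ones.
\<close>
definition cind ::
    "('q::field_char_0, 'f::field_char_0, 'c::field_char_0) padic_data \<Rightarrow> (('f \<Rightarrow> 'c) \<Rightarrow> nat) \<Rightarrow>
     ('f, 'c) tpoly set \<Rightarrow> ('f^2^2 \<Rightarrow> ('f, 'c) tpoly) set" where
  "cind D k W =
     {f. (\<forall>g\<in>GL2 UNIV. f g \<in> W) \<and> (\<forall>g. g \<notin> GL2 UNIV \<longrightarrow> f g = 0) \<and>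
         (\<forall>\<kappa>\<in>KZ D. \<forall>g\<in>GL2 UNIV. f (\<kappa> ** g) = rho D k \<kappa> (f g)) \<and>
         finite ((\<lambda>g. (\<lambda>\<kappa>. \<kappa> ** g) ` KZ D) ` {g \<in> GL2 UNIV. f g \<noteq> 0})}"

text \<open>
  For invertible \<open>g\<close> the condition \<open>h ** g \<in> KZ D\<close> says that \<open>h\<close> lies in the coset of
  the inverse of \<open>g\<close>.
\<close>
definition bracket ::
    "('q::field_char_0, 'f::field_char_0, 'c::field_char_0) padic_data \<Rightarrow> (('f \<Rightarrow> 'c) \<Rightarrow> nat) \<Rightarrow>
     'f^2^2 \<Rightarrow> ('f, 'c) tpoly \<Rightarrow> 'f^2^2 \<Rightarrow> ('f, 'c) tpoly" where
  "bracket D k g v h = (if h ** g \<in> KZ D then rho D k (h ** g) v else 0)"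

definition hecke_bracket ::
    "('q::field_char_0, 'f::field_char_0, 'c::field_char_0) padic_data \<Rightarrow> (('f \<Rightarrow> 'c) \<Rightarrow> nat) \<Rightarrow>
     'f^2^2 \<Rightarrow> ('f, 'c) tpoly \<Rightarrow> 'f^2^2 \<Rightarrow> ('f, 'c) tpoly" where
  "hecke_bracket D k g v h =
     (\<Sum>c | c \<in> left_cosets D \<and> psi D k (matrix_inv (coset_rep c)) v \<noteq> 0.
        bracket D k (g ** coset_rep c) (psi D k (matrix_inv (coset_rep c)) v) h)"

text \<open>
  The linear extension of \<open>hecke_bracket\<close>: each \<open>f\<close> is the sum over the left cosets
  \<open>g KZ\<close> of \<open>bracket g (f (matrix_inv g))\<close>.
\<close>
definition hecke ::
    "('q::field_char_0, 'f::field_char_0, 'c::field_char_0) padic_data \<Rightarrow> (('f \<Rightarrow> 'c) \<Rightarrow> nat) \<Rightarrow>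
     ('f^2^2 \<Rightarrow> ('f, 'c) tpoly) \<Rightarrow> 'f^2^2 \<Rightarrow> ('f, 'c) tpoly" where
  "hecke D k f h =
     (\<Sum>c | c \<in> left_cosets D \<and> f (matrix_inv (coset_rep c)) \<noteq> 0.
        hecke_bracket D k (coset_rep c) (f (matrix_inv (coset_rep c))) h)"

section \<open>Supports\<close>

definition In :: "('q, 'f::field, 'c) padic_data \<Rightarrow> nat \<Rightarrow> 'f set" where
  "In D n = {(\<Sum>i<n. unif D ^ i * teichmueller (absF D) (\<mu> i))
             | \<mu>. \<forall>i<n. \<mu> i \<in> residue_field (absF D)}"

definition g0 :: "('q, 'f::field, 'c) padic_data \<Rightarrow> nat \<Rightarrow> 'f \<Rightarrow> 'f^2^2" where
  "g0 D n \<mu> = mat2 (unif D ^ n) \<mu> 0 1"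

definition g1 :: "('q, 'f::field, 'c) padic_data \<Rightarrow> nat \<Rightarrow> 'f \<Rightarrow> 'f^2^2" where
  "g1 D n \<mu> = mat2 1 0 (unif D * \<mu>) (unif D ^ (n + 1))"

definition BN ::
    "('q::field_char_0, 'f::field_char_0, 'c::field_char_0) padic_data \<Rightarrow> (('f \<Rightarrow> 'c) \<Rightarrow> nat) \<Rightarrow>
     nat \<Rightarrow> ('f^2^2 \<Rightarrow> ('f, 'c) tpoly) set" where
  "BN D k N =
     {(\<lambda>h. (\<Sum>n\<le>N. \<Sum>\<mu>\<in>In D n. bracket D k (g0 D n \<mu>) (v0 n \<mu>) h) +
           (\<Sum>n<N. \<Sum>\<mu>\<in>In D n. bracket D k (g1 D n \<mu>) (v1 n \<mu>) h))
       | v0 v1. \<forall>n. \<forall>\<mu>\<in>In D n. v0 n \<mu> \<in> Vk D k \<and> v1 n \<mu> \<in> Vk D k}"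

text \<open>
  The set of sums of an element of \<open>BN\<close> and an element of the lattice of integral functions
  scaled by the \<open>n\<close>-th power of the image of the uniformizer under \<open>\<tau>\<close>.
\<close>
definition BN_plus ::
    "('q::field_char_0, 'f::field_char_0, 'c::field_char_0) padic_data \<Rightarrow> (('f \<Rightarrow> 'c) \<Rightarrow> nat) \<Rightarrow>
     ('f \<Rightarrow> 'c) \<Rightarrow> nat \<Rightarrow> int \<Rightarrow> ('f^2^2 \<Rightarrow> ('f, 'c) tpoly) set" where
  "BN_plus D k \<tau> N n =
     {(\<lambda>h. b h + const_poly (\<tau> (unif D) powi n) * w h)
       | b w. b \<in> BN D k N \<and> w \<in> cind D k (Vk0 D k)}"

end

theory Submission
  imports Defs "HOL-Computational_Algebra.Polynomial"
begin

text \<open>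
  Write \<open>\<delta>\<close> for the absolute value of the uniformizer; the theorem holds with \<open>\<epsilon> = d\<close>. The value
  of \<open>f\<close> at a vertex of the tree is a polynomial \<open>P\<close> of degree at most \<open>k\<close> in one variable \<open>z\<close>. At a
  child \<open>l\<close> of that vertex, \<open>T f\<close> is \<open>P(\<pi> z - l)\<close> plus the sum over the grandchildren \<open>u\<close> of
  \<open>\<pi> ^ k Q((z + u) / \<pi>)\<close>, with \<open>Q\<close> the polynomial of \<open>f\<close> at the grandchild. Since the support of \<open>f\<close>
  is finite, it suffices to show by descending induction on the distance to the root that every
  \<open>P\<close> has coefficients of size at most \<open>B = \<delta> ^ (n - d)\<close>. The terms \<open>a f\<close> are then harmless, and the
  contribution of the \<open>Q\<close>'s modulo \<open>B \<delta> ^ d\<close> only involves their \<open>d\<close> highest coefficients.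

  Hermite interpolation at the \<open>q\<close> residue classes bounds \<open>P\<close> by \<open>B \<delta> ^ (- d)\<close>, hence the coefficients
  of \<open>P(\<pi> z - l)\<close> of index at least \<open>2 d\<close> are at most \<open>B \<delta> ^ d\<close>, and so are those of the contribution
  of the \<open>Q\<close>'s. The coefficients of this contribution are combinations of power sums over the
  Teichmueller representatives, which have period \<open>q - 1\<close>. By Lucas' congruence those of index
  \<open>t q + (e - t)\<close>, \<open>1 \<le> t \<le> e\<close>, form an invertible system that forces the coefficient of index
  \<open>e \<le> d\<close> to be at most \<open>B \<delta> ^ e\<close>. A second interpolation then gives the bound \<open>B\<close> for \<open>P\<close>.
\<close>
section \<open>Non-archimedean absolute values\<close>

text \<open>The constant is independent of n and of the support of \<open>f\<close> because nothing
  is lost from one level to the next. The Taylor coefficient of index e of P at - l is that of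
  P(\<pi> z - l) divided by \<pi> ^ e, so a crude descent would lose at every level. The bound
  \<open>B * \<delta> ^ e\<close> for the contribution of the grandchildren cancels this factor
  exactly, and \<delta> ^ d is spent only once, in comparing \<open>B\<close> with the hypothesis on
  (T - a)(f). The numerical hypotheses enter as follows. Since k < (d + 1) q, the d + 1 lowest
  Taylor coefficients at q nodes determine P. From k \<le> q^2 / 2 follows 2 d \<le> q, so every
  index t q + (e - t) with t \<ge> 1 lies in the range already controlled. From k < p q follows d <
  p, so the factors \<open>d choose t\<close> in Lucas' congruence are units. Finally d - 1 \<le> r
  allows any i < d to be subtracted from k = d q + r without borrowing from the digit d.\<close>

locale nonarch_field =
  fixes \<nu> :: "'a::field \<Rightarrow> real"
  assumes nonarch: "nonarch_abs \<nu>"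
begin

lemma abs_nonneg [simp]: "0 \<le> \<nu> x"
  and abs_eq_0 [simp]: "\<nu> x = 0 \<longleftrightarrow> x = 0"
  and abs_mult: "\<nu> (x * y) = \<nu> x * \<nu> y"
  and abs_add: "\<nu> (x + y) \<le> max (\<nu> x) (\<nu> y)"
  using nonarch unfolding nonarch_abs_def by blast+

lemma abs_0 [simp]: "\<nu> 0 = 0"
  by simp

lemma abs_pos [simp]: "0 < \<nu> x \<longleftrightarrow> x \<noteq> 0"
  using abs_nonneg[of x] abs_eq_0[of x] by linarith

lemma abs_1 [simp]: "\<nu> 1 = 1"
  using abs_mult[of 1 1] abs_eq_0[of 1] by auto

lemma abs_minus [simp]: "\<nu> (- x) = \<nu> x"
proof -
  have "\<nu> (- 1) * \<nu> (- 1) = 1" using abs_mult[of "-1" "-1"] by simp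
  then have "\<nu> (- 1) = 1" using abs_nonneg[of "-1"] by (simp add: square_eq_1_iff)
  then show ?thesis using abs_mult[of "-1" x] by simp
qed

lemma abs_diff: "\<nu> (x - y) \<le> max (\<nu> x) (\<nu> y)"
  using abs_add[of x "- y"] by simp

lemma abs_diff_commute: "\<nu> (x - y) = \<nu> (y - x)"
  using abs_minus[of "x - y"] by simp

lemma abs_power: "\<nu> (x ^ n) = \<nu> x ^ n"
  by (induction n) (simp_all add: abs_mult)

lemma abs_inverse: "\<nu> (inverse x) = inverse (\<nu> x)"
proof (cases "x = 0")
  case False
  then have "\<nu> x * \<nu> (inverse x) = 1" using abs_mult[of x "inverse x"] by simp
  then show ?thesis by (simp add: inverse_unique)
qed simp

lemma abs_divide: "\<nu> (x / y) = \<nu> x / \<nu> y"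
  by (simp add: divide_inverse abs_mult abs_inverse)

lemma abs_powi: "\<nu> (x powi n) = \<nu> x powi n"
  by (simp add: power_int_def abs_power abs_inverse)

lemma abs_add_le: "\<nu> x \<le> B \<Longrightarrow> \<nu> y \<le> B \<Longrightarrow> \<nu> (x + y) \<le> B"
  using abs_add[of x y] by linarith

lemma abs_diff_le: "\<nu> x \<le> B \<Longrightarrow> \<nu> y \<le> B \<Longrightarrow> \<nu> (x - y) \<le> B"
  using abs_diff[of x y] by linarith

lemma abs_add_less: "\<nu> x < B \<Longrightarrow> \<nu> y < B \<Longrightarrow> \<nu> (x + y) < B"
  using abs_add[of x y] by linarith

lemma abs_diff_less: "\<nu> x < B \<Longrightarrow> \<nu> y < B \<Longrightarrow> \<nu> (x - y) < B"
  using abs_diff[of x y] by linarith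

lemma abs_sum_le: "(\<And>i. i \<in> A \<Longrightarrow> \<nu> (g i) \<le> B) \<Longrightarrow> 0 \<le> B \<Longrightarrow> \<nu> (sum g A) \<le> B"
  by (induction A rule: infinite_finite_induct) (auto intro: abs_add_le)

lemma abs_prod: "\<nu> (prod g A) = (\<Prod>i\<in>A. \<nu> (g i))"
  by (induction A rule: infinite_finite_induct) (auto simp: abs_mult)

lemma abs_mult_le: "\<nu> x \<le> B \<Longrightarrow> \<nu> y \<le> C \<Longrightarrow> \<nu> (x * y) \<le> B * C"
  unfolding abs_mult by (intro mult_mono) (auto intro: order_trans[OF abs_nonneg])

lemma abs_mult_le1: "\<nu> x \<le> B \<Longrightarrow> \<nu> y \<le> 1 \<Longrightarrow> \<nu> (x * y) \<le> B"
  using abs_mult_le[of x B y 1] by simp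

lemma abs_mult_le1': "\<nu> x \<le> 1 \<Longrightarrow> \<nu> y \<le> B \<Longrightarrow> \<nu> (x * y) \<le> B"
  using abs_mult_le[of x 1 y B] by simp

lemma abs_power_le1: "\<nu> x \<le> 1 \<Longrightarrow> \<nu> (x ^ n) \<le> 1"
  by (simp add: abs_power power_le_one)

lemma abs_of_nat_le1 [simp]: "\<nu> (of_nat n) \<le> 1"
  by (induction n) (auto intro: abs_add_le)

lemma abs_of_int_le1 [simp]: "\<nu> (of_int n) \<le> 1"
  by (cases n rule: int_cases2) auto

text \<open>By Bezout, 1 is an integral combination of p and n, so they cannot both have absolute
  value below 1.\<close>

lemma abs_of_nat_coprime:
  assumes "\<nu> (of_nat p) < 1" "coprime p n"
  shows "\<nu> (of_nat n) = 1"
proof (rule ccontr)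
  assume "\<nu> (of_nat n) \<noteq> 1"
  then have n: "\<nu> (of_nat n) < 1" using abs_of_nat_le1[of n] by linarith
  obtain u v where "u * int p + v * int n = 1"
    using bezout_int[of "int p" "int n"] assms(2) by auto
  then have "(1::'a) = of_int (u * int p + v * int n)" by simp
  also have "\<dots> = of_int u * of_nat p + of_int v * of_nat n" by simp
  finally have "1 = \<nu> (of_int u * of_nat p + of_int v * of_nat n)" by (metis abs_1)
  also have "\<dots> \<le> max (\<nu> (of_int u * of_nat p)) (\<nu> (of_int v * of_nat n))" by (rule abs_add)
  also have "\<dots> \<le> max (\<nu> (of_nat p)) (\<nu> (of_nat n))"
    by (intro max.mono abs_mult_le1') auto
  finally show False using assms(1) n by simp
qed

text \<open>
  Hermite interpolation at residually distinct nodes is integral: dividing by a monic linear factor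
  at a node reduces the multiplicity there and keeps the bounds at the other nodes.
\<close>
lemma hermite_bound:
  fixes P :: "'a poly" and m :: "'a \<Rightarrow> nat"
  assumes "finite T" "\<And>t. t \<in> T \<Longrightarrow> \<nu> t \<le> 1"
    and sep: "\<And>t t'. t \<in> T \<Longrightarrow> t' \<in> T \<Longrightarrow> t \<noteq> t' \<Longrightarrow> \<nu> (t - t') = 1"
    and "0 \<le> B" "degree P < sum m T"
    and "\<And>t j. t \<in> T \<Longrightarrow> j < m t \<Longrightarrow> \<nu> (coeff (pcompose P [:t, 1:]) j) \<le> B"
  shows "\<nu> (coeff P i) \<le> B"
  using assms(5,6)
proof (induction "sum m T" arbitrary: m P i)
  case 0
  then show ?case by simp
next
  case (Suc n)
  have "\<exists>t\<in>T. m t > 0"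
  proof (rule ccontr)
    assume "\<not> ?thesis"
    then have "sum m T = 0" by simp
    with Suc(2) show False by simp
  qed
  then obtain t where t: "t \<in> T" "m t > 0" by blast
  define R where "R = synthetic_div P t"
  have P: "P = [:-t, 1:] * R + [:poly P t:]"
    unfolding R_def by (rule synthetic_div_correct'[symmetric])
  have Pt: "\<nu> (poly P t) \<le> B"
    using Suc.prems(2)[OF t] by simp
  define m' where "m' = m(t := m t - 1)"
  have sm: "sum m' T = n"
  proof -
    have "sum m T = m t + sum m (T - {t})" using t assms(1) by (simp add: sum.remove)
    moreover have "sum m' T = m' t + sum m' (T - {t})" using t assms(1) by (simp add: sum.remove)
    moreover have "sum m' (T - {t}) = sum m (T - {t})" by (intro sum.cong) (auto simp: m'_def)
    ultimately show ?thesis using Suc(2) t by (simp add: m'_def)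
  qed
  \<comment> \<open>Around t' the factor X - t becomes z + (t' - t), so a Taylor coefficient of P
    mixes those of R of index j and j - 1.\<close>
  have coeffs: "coeff (pcompose P [:t', 1:]) j =
      (t' - t) * coeff (pcompose R [:t', 1:]) j +
      (case j of 0 \<Rightarrow> poly P t | Suc j' \<Rightarrow> coeff (pcompose R [:t', 1:]) j')" for t' j
  proof -
    have "pcompose P [:t', 1:] = [:t' - t, 1:] * pcompose R [:t', 1:] + [:poly P t:]"
      by (subst P) (simp only: pcompose_add pcompose_mult, simp add: pcompose_pCons)
    then show ?thesis by (simp add: coeff_pCons split: nat.split)
  qed
  have R: "\<nu> (coeff R i) \<le> B" for i
  \<comment> \<open>For constant P the remaining total multiplicity may be 0, where the induction
    hypothesis has no admissible degree; but then the quotient is 0.\<close>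
  proof (cases "degree P = 0")
    case True
    then have "R = 0" unfolding R_def by (simp add: synthetic_div_eq_0_iff)
    then show ?thesis using assms(4) by simp
  next
    case False
    show ?thesis
    proof (rule Suc.hyps(1)[of m'])
      show "n = sum m' T" using sm by simp
      show "degree R < sum m' T"
        using False Suc.prems(1) Suc(2) by (simp add: R_def degree_synthetic_div sm)
      fix t' j assume t': "t' \<in> T" "j < m' t'"
      show "\<nu> (coeff (pcompose R [:t', 1:]) j) \<le> B"
      proof (cases "t' = t")
        case True
        with t' have "Suc j < m t'" by (simp add: m'_def)
        then show ?thesis using Suc.prems(2)[OF t'(1)] coeffs[of t' "Suc j"] True by fastforce
      next
        case False
        then have c: "\<nu> (t' - t) = 1" using sep t t' by simp
        have "j < m t'" using t' False by (simp add: m'_def)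
        \<comment> \<open>As t' - t is a unit, \<open>coeffs\<close> can be solved for the
          coefficients of R one index after the other. At t itself the multiplier is 0 and the index
          shifts by one, which is the lost multiplicity.\<close>
        then show ?thesis
        proof (induction j)
          case 0
          then have "\<nu> (coeff (pcompose P [:t', 1:]) 0 - poly P t) \<le> B"
            using Suc.prems(2)[OF t'(1) 0] Pt by (intro abs_diff_le)
          also have "coeff (pcompose P [:t', 1:]) 0 - poly P t = (t' - t) * coeff (pcompose R [:t', 1:]) 0"
            unfolding coeffs[of t' 0] by (simp del: coeff_pcompose_0)
          finally show ?case using c by (simp add: abs_mult)
        next
          case (Suc j)
          have "\<nu> (coeff (pcompose P [:t', 1:]) (Suc j) - coeff (pcompose R [:t', 1:]) j) \<le> B"
            using Suc Suc.prems(1) \<open>\<And>t j. t \<in> T \<Longrightarrow> j < m t \<Longrightarrow> \<nu> (coeff (pcompose P [:t, 1:]) j) \<le> B\<close> t'(1)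
            by (intro abs_diff_le) auto
          then show ?case using c unfolding coeffs[of t' "Suc j"] by (simp add: abs_mult)
        qed
      qed
    qed
  qed
  have "\<nu> (- t * coeff R i + (case i of 0 \<Rightarrow> poly P t | Suc i' \<Rightarrow> coeff R i')) \<le> B"
    using R Pt assms(2)[OF t(1)] by (intro abs_add_le abs_mult_le1') (auto split: nat.split)
  also have "- t * coeff R i + (case i of 0 \<Rightarrow> poly P t | Suc i' \<Rightarrow> coeff R i') = coeff P i"
    by (subst P) (auto simp: coeff_pCons split: nat.split)
  finally show ?case .
qed

end

section \<open>Binomial coefficients modulo p\<close>

text \<open>Modulo p, (1 + x) ^ q is 1 + x ^ q, so only j = 0 and j = q survive in the Vandermonde
  convolution. The divisibility is a hypothesis because it is later read off from the residue field
  (\<open>prime_dvd_choose_resq\<close>), not from a factorisation of q.\<close>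

lemma choose_add_prime_power:
  assumes dvd: "\<And>j. 0 < j \<Longrightarrow> j < q \<Longrightarrow> p dvd (q choose j)" and "0 < q"
  shows "int p dvd int ((q + n) choose m) -
           (int (n choose m) + (if q \<le> m then int (n choose (m - q)) else 0))"
proof -
  let ?f = "\<lambda>j. int ((q choose j) * (n choose (m - j)))"
  have "int ((q + n) choose m) = sum ?f {..m}"
    by (simp only: vandermonde[symmetric, of q n m] of_nat_sum)
  also have "\<dots> = sum ?f ({..m} \<inter> {0, q}) + sum ?f ({..m} - {0, q})"
    by (rule sum.Int_Diff) simp
  also have "sum ?f ({..m} \<inter> {0, q}) = int (n choose m) + (if q \<le> m then int (n choose (m - q)) else 0)"
  proof -
    have "{..m} \<inter> {0, q} = (if q \<le> m then {0, q} else {0})" by auto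
    then show ?thesis using \<open>0 < q\<close> by simp
  qed
  finally have "int ((q + n) choose m) - (int (n choose m) + (if q \<le> m then int (n choose (m - q)) else 0))
     = sum ?f ({..m} - {0, q})" by simp
  moreover have "int p dvd sum ?f ({..m} - {0, q})"
  proof (rule dvd_sum)
    fix j assume "j \<in> {..m} - {0, q}"
    then have "p dvd (q choose j)"
      using dvd[of j] by (cases "j < q") (auto simp: binomial_eq_0)
    then show "int p dvd ?f j" by (simp add: int_dvd_int_iff dvd_mult2)
  qed
  ultimately show ?thesis by simp
qed

text \<open>Adding q to the upper argument reproduces, modulo p, Pascal's rule for
  \<open>d choose t\<close>. Only the last base-q digit is split off; d and t may be
  arbitrary.\<close>

lemma choose_lucas:
  assumes dvd: "\<And>j. 0 < j \<Longrightarrow> j < q \<Longrightarrow> p dvd (q choose j)" and "r < q" "s < q"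
  shows "int p dvd int ((d * q + r) choose (t * q + s)) - int (d choose t) * int (r choose s)"
proof (induction d arbitrary: t)
  case 0
  show ?case
  proof (cases t)
    case (Suc t')
    then have "r < t * q + s" using assms(2) by simp
    then show ?thesis using Suc by (simp add: binomial_eq_0)
  qed simp
next
  case (Suc d)
  have eq: "Suc d * q + r = q + (d * q + r)" by simp
  note step = choose_add_prime_power[OF dvd, of "d * q + r" "t * q + s"]
  show ?case
  proof (cases t)
    case 0
    have "int p dvd (int ((q + (d * q + r)) choose s) - int ((d * q + r) choose s))
        + (int ((d * q + r) choose s) - int (r choose s))"
      using step Suc.IH[of 0] 0 assms(2,3) by (intro dvd_add) auto
    then show ?thesis using 0 by (simp add: add.assoc)
  next
    case (Suc t')
    have "int p dvd (int ((q + (d * q + r)) choose (t * q + s))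
          - (int ((d * q + r) choose (t * q + s)) + int ((d * q + r) choose (t' * q + s))))
        + ((int ((d * q + r) choose (t * q + s)) - int (d choose t) * int (r choose s))
         + (int ((d * q + r) choose (t' * q + s)) - int (d choose t') * int (r choose s)))"
      using step Suc.IH[of t] Suc.IH[of t'] Suc assms(2,3) by (intro dvd_add) auto
    also have "\<dots> = int ((Suc d * q + r) choose (t * q + s)) - int (Suc d choose t) * int (r choose s)"
      unfolding eq Suc by (simp add: algebra_simps)
    finally show ?thesis .
  qed
qed

lemma prime_not_dvd_choose:
  assumes "prime (p::nat)" "d < p" "t \<le> d"
  shows "\<not> p dvd (d choose t)"
proof
  assume "p dvd (d choose t)"
  then have "p dvd fact d"
    using binomial_fact_lemma[OF assms(3)] by (metis dvd_mult)
  then show False using assms by (simp add: prime_dvd_fact_iff)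
qed

context nonarch_field
begin

text \<open>
  The matrix of the binomial coefficients \<open>(r - i) choose s\<close> is unimodular: a Vandermonde
  convolution shifts \<open>r\<close> to \<open>e - 1\<close>, where the matrix is triangular.
\<close>
lemma binomial_system:
  fixes X :: "nat \<Rightarrow> 'a"
  assumes "e \<le> Suc r" "0 \<le> B"
    and small: "\<And>s. s < e \<Longrightarrow> \<nu> (\<Sum>i<e. of_nat ((r - i) choose s) * X i) \<le> B"
    and "i < e"
  shows "\<nu> (X i) \<le> B"
proof -
  define c where "c = Suc r - e"
  define \<phi> where "\<phi> u = (\<Sum>i<e. of_nat ((e - 1 - i) choose u) * X i)" for u
  have \<phi>: "\<nu> (\<phi> u) \<le> B" if "u < e" for u
    using that
  proof (induction u rule: less_induct)
    case (less u)
    have "of_nat ((r - i) choose u) = (\<Sum>v\<le>u. of_nat (c choose (u - v)) * of_nat ((e - 1 - i) choose v) :: 'a)"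
      if "i < e" for i
    proof -
      have "r - i = (e - 1 - i) + c" using that assms(1) by (simp add: c_def)
      then have "(r - i) choose u = (\<Sum>v\<le>u. (c choose (u - v)) * ((e - 1 - i) choose v))"
        by (simp only: vandermonde[symmetric] mult.commute)
      then show ?thesis by (simp only: of_nat_sum of_nat_mult)
    qed
    then have "(\<Sum>i<e. of_nat ((r - i) choose u) * X i) =
        (\<Sum>i<e. \<Sum>v\<le>u. of_nat (c choose (u - v)) * (of_nat ((e - 1 - i) choose v) * X i))"
      by (simp add: sum_distrib_right mult.assoc)
    also have "\<dots> = (\<Sum>v\<le>u. of_nat (c choose (u - v)) * \<phi> v)"
      unfolding \<phi>_def sum_distrib_left by (rule sum.swap)
    also have "\<dots> = (\<Sum>v<u. of_nat (c choose (u - v)) * \<phi> v) + \<phi> u"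
      by (simp add: lessThan_Suc_atMost[symmetric])
    finally have "\<phi> u = (\<Sum>i<e. of_nat ((r - i) choose u) * X i) - (\<Sum>v<u. of_nat (c choose (u - v)) * \<phi> v)"
      by simp
    moreover have "\<nu> \<dots> \<le> B"
      using less assms(2) by (intro abs_diff_le[OF small] abs_sum_le abs_mult_le1') auto
    ultimately show ?case by simp
  qed
  show ?thesis
    using \<open>i < e\<close>
  proof (induction i rule: less_induct)
    case (less i)
    let ?u = "e - 1 - i"
    let ?g = "\<lambda>j. of_nat ((e - 1 - j) choose ?u) * X j"
    have "\<phi> ?u = sum ?g {..<e}" by (simp add: \<phi>_def)
    \<comment> \<open>For j > i the binomial vanishes and for j = i it is 1, so X i is determined by
      the earlier unknowns.\<close>
    also have "\<dots> = sum ?g {..<Suc i}"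
      using less.prems by (intro sum.mono_neutral_right) (auto simp: not_less binomial_eq_0)
    also have "\<dots> = sum ?g {..<i} + X i" by simp
    finally have "X i = \<phi> ?u - sum ?g {..<i}" by simp
    moreover have "\<nu> \<dots> \<le> B"
      using less assms(2) by (intro abs_diff_le[OF \<phi>] abs_sum_le abs_mult_le1') auto
    ultimately show ?case by simp
  qed
qed

end

section \<open>The integrality criterion\<close>

text \<open>The data needed at a single vertex, without group or tree: \<open>w\<close> stands for
  the uniformizer and \<open>T\<close> for the Teichmueller representatives, both transported to the
  coefficient field C.\<close>

locale weight_setup = nonarch_field \<nu> for \<nu> :: "'a::field \<Rightarrow> real" +
  fixes w :: 'a and T :: "'a set" and p q k d r :: nat
  assumes w: "w \<noteq> 0" "\<nu> w < 1"
    and T: "finite T" "card T = q" "\<And>t. t \<in> T \<Longrightarrow> \<nu> t \<le> 1" "\<And>t. t \<in> T \<Longrightarrow> t ^ q = t"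
    and T_sep: "\<And>t t'. t \<in> T \<Longrightarrow> t' \<in> T \<Longrightarrow> t \<noteq> t' \<Longrightarrow> \<nu> (t - t') = 1"
    and p: "prime p" "\<nu> (of_nat p) \<le> \<nu> w" "\<And>j. 0 < j \<Longrightarrow> j < q \<Longrightarrow> p dvd (q choose j)"
    and k: "k = d * q + r" "r < q" "d \<le> Suc r" "2 * d \<le> q" "d < p"
begin

lemma q_pos: "0 < q"
  using k(2) by simp

lemma w_power_mono: "m \<le> n \<Longrightarrow> \<nu> w ^ n \<le> \<nu> w ^ m"
  using w by (simp add: power_decreasing)

text \<open>The exponent m has to be positive because 0 may lie in \<open>T\<close> and 0 ^ 0 = 1;
  this exception resurfaces in \<open>low_coeff_bound\<close>.\<close>

lemma T_power:
  assumes "t \<in> T" "0 < m"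
  shows "t ^ (a * (q - 1) + m) = t ^ m"
proof (induction a)
  case (Suc a)
  have "Suc a * (q - 1) + m = q + (a * (q - 1) + (m - 1))"
    using assms(2) q_pos by (cases q; cases m) auto
  then have "t ^ (Suc a * (q - 1) + m) = t ^ q * t ^ (a * (q - 1) + (m - 1))"
    by (simp only: power_add)
  also have "\<dots> = t ^ (a * (q - 1) + m)"
    using T(4)[OF assms(1)] assms(2) by (metis add_Suc_right Suc_diff_1 power_Suc)
  finally show ?case using Suc by simp
qed simp

lemma lucas_abs:
  assumes "r' < q" "s < q"
  shows "\<nu> (of_nat ((d' * q + r') choose (t * q + s)) - of_nat ((d' choose t) * (r' choose s))) \<le> \<nu> w"
proof -
  obtain z where "int ((d' * q + r') choose (t * q + s)) - int (d' choose t) * int (r' choose s) = int p * z"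
    using choose_lucas[OF p(3) assms, of d' t] by (rule dvdE)
  then have "of_int (int ((d' * q + r') choose (t * q + s)) - int (d' choose t) * int (r' choose s)) = (of_int (int p * z) :: 'a)"
    by simp
  then have "(of_nat ((d' * q + r') choose (t * q + s)) - of_nat ((d' choose t) * (r' choose s)) :: 'a) = of_nat p * of_int z"
    by simp
  then show ?thesis using p(2) by (simp only:) (intro abs_mult_le1, auto)
qed

text \<open>
  For fixed \<open>e\<close> the coefficients of index \<open>t * q + (e - t)\<close>, \<open>1 \<le> t \<le> e\<close>, and the one of index
  \<open>e\<close> involve the same \<open>e\<close> unknowns \<open>X i\<close> modulo the \<open>e\<close>-th power of \<open>w\<close>, because the power sums
  over \<open>T\<close> are periodic with period \<open>q - 1\<close>; by Lucas the resulting square system is invertible.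
\<close>
lemma low_coeff_bound:
  fixes c :: "nat \<Rightarrow> 'a \<Rightarrow> 'a"
  defines "s \<equiv> \<lambda>i m. \<Sum>\<mu>\<in>T. c i \<mu> * \<mu> ^ m"
  defines "E \<equiv> \<lambda>j. \<Sum>i\<le>k. w ^ i * of_nat ((k - i) choose j) * s i (k - i - j)"
  assumes "0 \<le> B" and c: "\<And>i \<mu>. \<mu> \<in> T \<Longrightarrow> \<nu> (c i \<mu>) \<le> B"
    and high: "\<And>j. 2 * d \<le> j \<Longrightarrow> \<nu> (E j) \<le> B * \<nu> w ^ d"
    and "e \<le> d"
  shows "\<nu> (E e) \<le> B * \<nu> w ^ e"
proof -
  have s: "\<nu> (s i m) \<le> B" for i m
    unfolding s_def using c T(3) \<open>0 \<le> B\<close> by (intro abs_sum_le abs_mult_le1 abs_power_le1) auto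
  \<comment> \<open>For j = t * q + (e - t) one has k - i - j = (d - t) * (q - 1) + (r + d - i - e);
    the exponent used here is the part that does not depend on t.\<close>
  define X where "X i = w ^ i * s i (r + d - i - e)" for i
  have X: "\<nu> (X i) \<le> B * \<nu> w ^ i" for i
    unfolding X_def abs_mult abs_power mult.commute[of B]
    using s[of i] by (intro mult_left_mono) auto
  have nn: "0 \<le> B * \<nu> w ^ e" using \<open>0 \<le> B\<close> by simp
  have approx: "\<nu> (E (t * q + (e - t)) - (\<Sum>i<e. of_nat ((k - i) choose (t * q + (e - t))) * X i))
      \<le> B * \<nu> w ^ e" if "t \<le> e" for t
  proof -
    define j where "j = t * q + (e - t)"
    let ?g = "\<lambda>i. w ^ i * of_nat ((k - i) choose j) * s i (k - i - j)"
    have "e \<le> k" using \<open>e \<le> d\<close> k by (cases d) auto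
    then have "{..k} = {..<e} \<union> {e..k}" by auto
    then have "E j = sum ?g {..<e} + sum ?g {e..k}"
      unfolding E_def by (simp add: sum.union_disjoint ivl_disj_int)
    then have "E j - (\<Sum>i<e. of_nat ((k - i) choose j) * X i) =
        (\<Sum>i<e. ?g i - of_nat ((k - i) choose j) * X i) + sum ?g {e..k}"
      by (simp add: sum_subtractf)
    also have "\<nu> \<dots> \<le> B * \<nu> w ^ e"
    proof (intro abs_add_le abs_sum_le nn)
      \<comment> \<open>These terms are small through the factor w ^ i alone.\<close>
      fix i assume i: "i \<in> {e..k}"
      have "\<nu> (?g i) \<le> \<nu> w ^ i * 1 * B"
        using s by (intro abs_mult_le) (auto simp: abs_power)
      also have "\<dots> \<le> B * \<nu> w ^ e"
        using w_power_mono[of e i] i \<open>0 \<le> B\<close> by (simp add: mult.commute mult_left_mono)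
      finally show "\<nu> (?g i) \<le> B * \<nu> w ^ e" .
    next
      fix i assume "i \<in> {..<e}"
      then have i: "i < e" by simp
      have eq: "?g i - of_nat ((k - i) choose j) * X i
          = w ^ i * of_nat ((k - i) choose j) * (s i (k - i - j) - s i (r + d - i - e))"
        by (simp add: X_def algebra_simps)
      have "t \<le> d" using that \<open>e \<le> d\<close> by simp
      then obtain u where u: "d = t + u" using le_Suc_ex by blast
      have kj: "k - i - j = (d - t) * (q - 1) + (r + d - i - e)"
      proof -
        have "int (k - i - j) = int k - int i - int j"
        proof -
          have "j + i \<le> k"
          proof -
            have "e - t \<le> u * q" "i \<le> r"
              using q_pos u \<open>e \<le> d\<close> i k(3) by (auto intro: order_trans[of _ u])
            then show ?thesis unfolding j_def k(1) u by (simp add: distrib_right)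
          qed
          then show ?thesis by simp
        qed
        also have "\<dots> = int u * (int q - 1) + (int r + int d - int i - int e)"
          using that by (simp add: j_def k(1) u algebra_simps)
        also have "\<dots> = int ((d - t) * (q - 1) + (r + d - i - e))"
        proof -
          have "i + e \<le> r + d" using i \<open>e \<le> d\<close> k(3) by simp
          then show ?thesis using q_pos u by (simp add: of_nat_diff)
        qed
        finally show ?thesis by (simp only: of_nat_eq_iff)
      qed
      show "\<nu> (?g i - of_nat ((k - i) choose j) * X i) \<le> B * \<nu> w ^ e"
      \<comment> \<open>The exponent vanishes only for i = r and e = d = r + 1, where periodicity
        fails at \<mu> = 0. Unless t = d, the number k - i = d * q then has last digit 0 and j has
        last digit d - t > 0, so by Lucas the binomial is divisible by p; the factor w gained turns
        w ^ r into w ^ e.\<close>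
      proof (cases "0 < r + d - i - e")
        case True
        then have "s i (k - i - j) = s i (r + d - i - e)"
          unfolding kj s_def by (intro sum.cong refl) (simp only: T_power[OF _ True])
        then show ?thesis unfolding eq using nn by simp
      next
        case False
        then have ir: "i = r" "e = d" "d = Suc r" using i \<open>e \<le> d\<close> k(3) by auto
        show ?thesis
        proof (cases "t = d")
          case True
          then have "k - i - j = r + d - i - e" using kj by simp
          then show ?thesis unfolding eq using nn by simp
        next
          case False
          then have td: "t < d" using \<open>t \<le> d\<close> by simp
          have "k - i = d * q + 0" "j = t * q + (d - t)" using ir k(1) by (auto simp: j_def)
          then have "\<nu> (of_nat ((k - i) choose j)) \<le> \<nu> w"
            using lucas_abs[of 0 "d - t" d t] td q_pos k(4) by (simp add: binomial_eq_0)
          then have "\<nu> (w ^ i * of_nat ((k - i) choose j) * (s i (k - i - j) - s i (r + d - i - e)))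
              \<le> \<nu> w ^ i * \<nu> w * B"
            using s by (intro abs_mult_le abs_diff_le) (auto simp: abs_power)
          also have "\<dots> = B * \<nu> w ^ e" using ir by simp
          finally show ?thesis unfolding eq .
        qed
      qed
    qed
    finally show ?thesis unfolding j_def .
  qed
  show ?thesis
  proof (cases "e = 0")
    case True
    then show ?thesis using approx[of 0] by simp
  next
    case False
    \<comment> \<open>A bootstrap: replacing the binomials by their Lucas products costs at most |w|
      M. The system yields M \<le> max (B |w| ^ e) (|w| M), and as |w| < 1 the second alternative is
      possible only for M = 0.\<close>
    define M where "M = Max ((\<lambda>i. \<nu> (X i)) ` {..<e})"
    have MX: "\<nu> (X i) \<le> M" if "i < e" for i
      unfolding M_def using that by (intro Max_ge) auto
    have "M \<in> (\<lambda>i. \<nu> (X i)) ` {..<e}"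
      unfolding M_def using False by (intro Max_in) auto
    then obtain i0 where i0: "i0 < e" "M = \<nu> (X i0)" by auto
    define C where "C = max (B * \<nu> w ^ e) (\<nu> w * M)"
    have "0 \<le> C" unfolding C_def using nn by simp
    have "\<nu> (X i0) \<le> C"
    proof (rule binomial_system[of e r])
      show "e \<le> Suc r" using \<open>e \<le> d\<close> k(3) by simp
      fix s' assume s': "s' < e"
      \<comment> \<open>Row s' of the system is the coefficient of index t * q + (e - t), which is
        at least q \<ge> 2 * d because t \<ge> 1.\<close>
      define t where "t = e - s'"
      have t: "1 \<le> t" "t \<le> e" "e - t = s'" using s' by (auto simp: t_def)
      have sq: "s' < q" using s' \<open>e \<le> d\<close> k(4) q_pos by linarith
      let ?j = "t * q + s'"
      have jq: "2 * d \<le> ?j"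
      proof -
        have "q \<le> t * q" using t(1) by simp
        then show ?thesis using k(4) by linarith
      qed
      have "\<nu> (E ?j) \<le> B * \<nu> w ^ e"
        using high[OF jq] mult_left_mono[OF w_power_mono[OF \<open>e \<le> d\<close>] \<open>0 \<le> B\<close>] by linarith
      from abs_diff_le[OF this approx[OF t(2), unfolded t(3)]] have 1: "\<nu> (\<Sum>i<e. of_nat ((k - i) choose ?j) * X i) \<le> C"
        by (simp add: C_def)
      have 2: "\<nu> (\<Sum>i<e. (of_nat ((k - i) choose ?j) - of_nat ((d choose t) * ((r - i) choose s'))) * X i) \<le> C"
      proof (intro abs_sum_le \<open>0 \<le> C\<close>)
        fix i assume "i \<in> {..<e}"
        then have i: "i < e" by simp
        then have "k - i = d * q + (r - i)" using k(1,3) \<open>e \<le> d\<close> by simp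
        then have "\<nu> ((of_nat ((k - i) choose ?j) - of_nat ((d choose t) * ((r - i) choose s'))) * X i) \<le> \<nu> w * M"
          using lucas_abs[of "r - i" s' d t] sq k(2) MX[OF i] by (intro abs_mult_le) auto
        then show "\<nu> ((of_nat ((k - i) choose ?j) - of_nat ((d choose t) * ((r - i) choose s'))) * X i) \<le> C"
          by (simp add: C_def)
      qed
      have "\<nu> (of_nat (d choose t) * (\<Sum>i<e. of_nat ((r - i) choose s') * X i)) \<le> C"
        using abs_diff_le[OF 1 2]
        by (simp add: sum_subtractf[symmetric] sum_distrib_left algebra_simps)
      moreover have "\<nu> (of_nat (d choose t)) = 1"
      proof (rule abs_of_nat_coprime)
        show "\<nu> (of_nat p) < 1" using p(2) w by simp
        show "coprime p (d choose t)"
          using prime_not_dvd_choose[OF p(1) k(5), of t] t \<open>e \<le> d\<close> p(1)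
          by (simp add: prime_imp_coprime)
      qed
      ultimately show "\<nu> (\<Sum>i<e. of_nat ((r - i) choose s') * X i) \<le> C"
        by (simp add: abs_mult)
    qed (use i0 \<open>0 \<le> C\<close> in auto)
    then have "M \<le> B * \<nu> w ^ e"
    proof -
      have "M \<le> C" using i0 \<open>\<nu> (X i0) \<le> C\<close> by simp
      moreover have "0 \<le> M" using i0 by simp
      moreover have "\<nu> w * M < M \<or> M = 0" using w \<open>0 \<le> M\<close> by auto
      ultimately show ?thesis unfolding C_def using nn by linarith
    qed
    then have "\<nu> (\<Sum>i<e. of_nat ((k - i) choose e) * X i) \<le> B * \<nu> w ^ e"
      using MX nn by (intro abs_sum_le abs_mult_le1') (auto intro: order_trans)
    then have "\<nu> ((E e - (\<Sum>i<e. of_nat ((k - i) choose e) * X i)) + (\<Sum>i<e. of_nat ((k - i) choose e) * X i)) \<le> B * \<nu> w ^ e"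
      using approx[of 0] by (intro abs_add_le) auto
    then show ?thesis by simp
  qed
qed

text \<open>The polynomial \<open>w ^ k * Q ((z + \<mu>) / w)\<close> in \<open>z\<close>.\<close>
definition contraction :: "'a poly \<Rightarrow> 'a \<Rightarrow> 'a poly" where
  "contraction Q \<mu> = (\<Sum>i\<le>k. smult (coeff Q i * w ^ (k - i)) ([:\<mu>, 1:] ^ i))"

text \<open>Counting the degrees of Q from the top makes the power of w equal to the summation
  index, the shape of \<open>E\<close> in \<open>low_coeff_bound\<close>.\<close>

lemma coeff_contraction:
  "coeff (contraction Q \<mu>) j =
     (\<Sum>i\<le>k. w ^ i * of_nat ((k - i) choose j) * (coeff Q (k - i) * \<mu> ^ (k - i - j)))"
proof -
  have lin: "coeff ([:\<mu>, 1:] ^ i) j = of_nat (i choose j) * \<mu> ^ (i - j)" for i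
    by (cases "j \<le> i")
      (auto simp: coeff_linear_poly_power binomial_eq_0 not_le degree_linear_power intro!: coeff_eq_0)
  have "coeff (contraction Q \<mu>) j = (\<Sum>i\<le>k. coeff Q i * w ^ (k - i) * (of_nat (i choose j) * \<mu> ^ (i - j)))"
    by (simp add: contraction_def coeff_sum lin)
  also have "\<dots> = (\<Sum>i\<le>k. coeff Q (k - i) * w ^ (k - (k - i)) * (of_nat ((k - i) choose j) * \<mu> ^ (k - i - j)))"
    by (rule sum.reindex_bij_witness[of _ "\<lambda>i. k - i" "\<lambda>i. k - i"]) auto
  also have "\<dots> = (\<Sum>i\<le>k. w ^ i * of_nat ((k - i) choose j) * (coeff Q (k - i) * \<mu> ^ (k - i - j)))"
    by (intro sum.cong) (auto simp: mult_ac)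
  finally show ?thesis .
qed

lemma coeff_pcompose_scaled:
  "coeff (pcompose P [:c, w:]) j = w ^ j * coeff (pcompose P [:c, 1:]) j"
proof -
  have "pcompose P [:c, w:] = pcompose (pcompose P [:c, 1:]) [:0, w:]"
    by (simp add: pcompose_assoc[symmetric] pcompose_pCons)
  then show ?thesis by (simp add: coeff_pcompose_linear)
qed

lemma taylor_bound:
  assumes "\<And>i. \<nu> (coeff P i) \<le> B" "0 \<le> B" "\<nu> c \<le> 1"
  shows "\<nu> (coeff (pcompose P [:c, 1:]) j) \<le> B"
  using assms(1)
proof (induction P arbitrary: j)
  case (pCons a P)
  have a: "\<nu> a \<le> B" using pCons.prems[of 0] by simp
  have IH: "\<nu> (coeff (pcompose P [:c, 1:]) j) \<le> B" for j
    using pCons.prems[of "Suc _"] by (intro pCons.IH) simp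
  have "\<nu> ((case j of 0 \<Rightarrow> a | Suc j' \<Rightarrow> coeff (pcompose P [:c, 1:]) j') + c * coeff (pcompose P [:c, 1:]) j) \<le> B"
    using a IH assms(3) by (intro abs_add_le abs_mult_le1') (auto split: nat.split)
  also have "(case j of 0 \<Rightarrow> a | Suc j' \<Rightarrow> coeff (pcompose P [:c, 1:]) j') + c * coeff (pcompose P [:c, 1:]) j
      = coeff (pcompose (pCons a P) [:c, 1:]) j"
    by (auto simp: pcompose_pCons coeff_pCons split: nat.split)
  finally show ?case .
qed (use assms in simp)

text \<open>There are q nodes with d + 1 conditions each, and k < (d + 1) * q. The nodes are negated
  because the relation at the child \<eta> contains P(w z - \<eta>).\<close>

lemma hermite_nodes:
  assumes "degree P \<le> k" "0 \<le> B"
    and "\<And>\<eta> j. \<eta> \<in> T \<Longrightarrow> j \<le> d \<Longrightarrow> \<nu> (coeff (pcompose P [:- \<eta>, 1:]) j) \<le> B"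
  shows "\<nu> (coeff P i) \<le> B"
proof (rule hermite_bound[of "uminus ` T" _ _ "\<lambda>_. Suc d"])
  show "degree P < (\<Sum>t\<in>uminus ` T. Suc d)"
    using assms(1) k(1,2) by (simp add: card_image T(2) mult.commute)
  fix t t' assume "t \<in> uminus ` T" "t' \<in> uminus ` T" "t \<noteq> t'"
  then show "\<nu> (t - t') = 1" using T_sep abs_diff_commute by fastforce
qed (use assms T in auto)

text \<open>The bound for the Q's is returned unchanged for P, so the criterion can be iterated over
  any number of levels; only the error term has to be smaller, by |w| ^ d.\<close>

lemma integrality_criterion:
  assumes "degree P \<le> k" "0 \<le> B"
    and Q: "\<And>\<eta> \<mu> i. \<eta> \<in> T \<Longrightarrow> \<mu> \<in> T \<Longrightarrow> \<nu> (coeff (Q \<eta> \<mu>) i) \<le> B"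
    and small: "\<And>\<eta> j. \<eta> \<in> T \<Longrightarrow>
      \<nu> (coeff (pcompose P [:- \<eta>, w:] + (\<Sum>\<mu>\<in>T. contraction (Q \<eta> \<mu>) \<mu>)) j) \<le> B * \<nu> w ^ d"
  shows "\<nu> (coeff P i) \<le> B"
proof -
  define \<delta> where "\<delta> = \<nu> w"
  have \<delta>: "0 < \<delta>" "\<delta> < 1" "\<delta> \<noteq> 0" using w by (auto simp: \<delta>_def)
  define E where "E \<eta> j = coeff (\<Sum>\<mu>\<in>T. contraction (Q \<eta> \<mu>) \<mu>) j" for \<eta> j
  define H where "H \<eta> j = coeff (pcompose P [:- \<eta>, 1:]) j" for \<eta> j
  have small': "\<nu> (w ^ j * H \<eta> j + E \<eta> j) \<le> B * \<delta> ^ d" if "\<eta> \<in> T" for \<eta> j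
    using small[OF that, of j] by (simp add: coeff_pcompose_scaled H_def E_def \<delta>_def)
  have E_eq: "E \<eta> j = (\<Sum>i\<le>k. w ^ i * of_nat ((k - i) choose j) *
      (\<Sum>\<mu>\<in>T. coeff (Q \<eta> \<mu>) (k - i) * \<mu> ^ (k - i - j)))" for \<eta> j
    unfolding E_def coeff_sum coeff_contraction sum_distrib_left by (rule sum.swap)
  have \<delta>_le: "B * \<delta> ^ n \<le> B * \<delta> ^ m" if "m \<le> n" for m n
    using that \<delta> assms(2) by (intro mult_left_mono power_decreasing) auto
  have E_le: "\<nu> (E \<eta> j) \<le> B" if "\<eta> \<in> T" for \<eta> j
    unfolding E_eq using Q[OF that] T(3) assms(2) w
    by (intro abs_sum_le abs_mult_le1' abs_mult_le1 abs_power_le1) auto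
  have H_shift: "\<nu> (H \<eta> j) * \<delta> ^ j \<le> C"
    if "\<eta> \<in> T" "\<nu> (E \<eta> j) \<le> C" "B * \<delta> ^ d \<le> C" for \<eta> j C
  proof -
    have "\<nu> ((w ^ j * H \<eta> j + E \<eta> j) - E \<eta> j) \<le> C"
      using small'[OF that(1), of j] that(2,3) by (intro abs_diff_le) auto
    then show ?thesis by (simp add: abs_mult abs_power \<delta>_def mult.commute)
  qed
  \<comment> \<open>The trivial bound for \<open>E\<close> suffices here: passing from P(w z -
    \<eta>) back to P divides the coefficient of index j \<le> d by at most \<delta> ^ d.\<close>
  have coarse: "\<nu> (coeff P i) \<le> B / \<delta> ^ d" for i
  proof (rule hermite_nodes[OF assms(1)])
    show "0 \<le> B / \<delta> ^ d" using assms(2) \<delta> by simp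
    fix \<eta> j assume \<eta>: "\<eta> \<in> T" "j \<le> d"
    have "\<nu> (H \<eta> j) * \<delta> ^ d \<le> \<nu> (H \<eta> j) * \<delta> ^ j"
      using \<eta> \<delta> by (intro mult_left_mono power_decreasing) auto
    also have "\<dots> \<le> B"
      using \<delta>_le[of 0 d] by (intro H_shift \<eta> E_le) auto
    finally show "\<nu> (coeff (pcompose P [:- \<eta>, 1:]) j) \<le> B / \<delta> ^ d"
      using \<delta> by (simp add: H_def field_simps)
  qed
  have high: "\<nu> (E \<eta> j) \<le> B * \<delta> ^ d" if "\<eta> \<in> T" "2 * d \<le> j" for \<eta> j
  proof -
    have "\<nu> (H \<eta> j) \<le> B / \<delta> ^ d"
      unfolding H_def using coarse T(3)[OF that(1)] assms(2) \<delta> by (intro taylor_bound) auto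
    then have "\<nu> (w ^ j * H \<eta> j) \<le> \<delta> ^ j * (B / \<delta> ^ d)"
      by (intro abs_mult_le) (auto simp: abs_power \<delta>_def)
    \<comment> \<open>For j \<ge> 2 * d the scaling absorbs the loss in the coarse bound and still
      leaves \<delta> ^ d.\<close>
    also have "\<dots> = B * \<delta> ^ (j - d)"
      using that \<delta> by (simp add: power_diff field_simps)
    also have "\<dots> \<le> B * \<delta> ^ d" using that by (intro \<delta>_le) auto
    finally have "\<nu> ((w ^ j * H \<eta> j + E \<eta> j) - w ^ j * H \<eta> j) \<le> B * \<delta> ^ d"
      using small'[OF that(1)] by (intro abs_diff_le) auto
    then show ?thesis by simp
  qed
  show ?thesis
  proof (rule hermite_nodes[OF assms(1,2)])
    fix \<eta> e assume \<eta>: "\<eta> \<in> T" "e \<le> d"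
    have "\<nu> (E \<eta> e) \<le> B * \<delta> ^ e"
      using low_coeff_bound[of B "\<lambda>i \<mu>. coeff (Q \<eta> \<mu>) (k - i)" e] assms(2) \<eta> Q high[OF \<eta>(1)]
      unfolding E_eq \<delta>_def by blast
    then have "\<nu> (H \<eta> e) * \<delta> ^ e \<le> B * \<delta> ^ e"
      using \<eta> by (intro H_shift \<delta>_le) auto
    then show "\<nu> (coeff (pcompose P [:- \<eta>, 1:]) e) \<le> B"
      using \<delta> by (simp add: H_def)
  qed
qed

text \<open>\<open>I m\<close> is to be read as the set of vertices of level m, and
  \<open>ch m x l\<close> as the child of x with label l. The labels will be elements of F while the
  coefficients lie in C, hence the bijection \<open>\<theta>\<close>.\<close>

lemma tree_descent:
  fixes P :: "nat \<Rightarrow> 'b \<Rightarrow> 'a poly" and I :: "nat \<Rightarrow> 'b set" and ch :: "nat \<Rightarrow> 'b \<Rightarrow> 'l \<Rightarrow> 'b"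
    and \<theta> :: "'l \<Rightarrow> 'a"
  assumes "0 \<le> B" and \<theta>: "bij_betw \<theta> L T"
    and deg: "\<And>m x. x \<in> I m \<Longrightarrow> degree (P m x) \<le> k"
    and ch: "\<And>m x l. x \<in> I m \<Longrightarrow> l \<in> L \<Longrightarrow> ch m x l \<in> I (Suc m)"
    and fin: "\<And>m x. M \<le> m \<Longrightarrow> x \<in> I m \<Longrightarrow> P m x = 0"
    and a: "\<nu> a \<le> \<nu> w ^ d"
    and rel: "\<And>m x l j. M0 \<le> m \<Longrightarrow> x \<in> I m \<Longrightarrow> l \<in> L \<Longrightarrow>
      \<nu> (coeff (pcompose (P m x) [:- \<theta> l, w:]
             + (\<Sum>u\<in>L. contraction (P (Suc (Suc m)) (ch (Suc m) (ch m x l) u)) (\<theta> u))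
             - smult a (P (Suc m) (ch m x l))) j) \<le> B * \<nu> w ^ d"
    and "M0 \<le> m" "x \<in> I m"
  shows "\<nu> (coeff (P m x) i) \<le> B"
proof -
  \<comment> \<open>With the inequality M \<le> m + n instead of an equality, the hypothesis for n
    covers the children and the grandchildren of a vertex at once.\<close>
  have "\<nu> (coeff (P m x) i) \<le> B" if "M \<le> m + n" "M0 \<le> m" "x \<in> I m" for n m x i
    using that
  proof (induction n arbitrary: m x i)
    case 0
    then show ?case using fin[of m x] \<open>0 \<le> B\<close> by simp
  next
    case (Suc n)
    define \<theta>' where "\<theta>' = inv_into L \<theta>"
    have \<theta>': "\<theta>' t \<in> L" "\<theta> (\<theta>' t) = t" if "t \<in> T" for t
      using that \<theta> by (auto simp: \<theta>'_def bij_betw_def inv_into_into f_inv_into_f)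
    have \<theta>'': "\<theta>' (\<theta> l) = l" if "l \<in> L" for l
      using that \<theta> by (auto simp: \<theta>'_def bij_betw_def)
    show ?case
    proof (rule integrality_criterion[of _ _ "\<lambda>\<eta> \<mu>. P (Suc (Suc m)) (ch (Suc m) (ch m x (\<theta>' \<eta>)) (\<theta>' \<mu>))"])
      fix \<eta> j assume \<eta>: "\<eta> \<in> T"
      let ?S = "\<Sum>u\<in>L. contraction (P (Suc (Suc m)) (ch (Suc m) (ch m x (\<theta>' \<eta>)) u)) (\<theta> u)"
      have "\<nu> (coeff (smult a (P (Suc m) (ch m x (\<theta>' \<eta>)))) j) \<le> \<nu> w ^ d * B"
        unfolding coeff_smult using Suc.prems \<theta>'[OF \<eta>] a by (intro abs_mult_le Suc.IH ch) auto
      then have "\<nu> (coeff (pcompose (P m x) [:- \<theta> (\<theta>' \<eta>), w:] + ?S - smult a (P (Suc m) (ch m x (\<theta>' \<eta>)))) j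
          + coeff (smult a (P (Suc m) (ch m x (\<theta>' \<eta>)))) j) \<le> B * \<nu> w ^ d"
        using rel[OF Suc.prems(2,3) \<theta>'(1)[OF \<eta>], of j] by (intro abs_add_le) (auto simp: mult.commute)
      moreover have "?S = (\<Sum>\<mu>\<in>T. contraction (P (Suc (Suc m)) (ch (Suc m) (ch m x (\<theta>' \<eta>)) (\<theta>' \<mu>))) \<mu>)"
        by (subst sum.reindex_bij_betw[OF \<theta>, symmetric]) (simp add: \<theta>'')
      ultimately show "\<nu> (coeff (pcompose (P m x) [:- \<eta>, w:] + (\<Sum>\<mu>\<in>T.
           contraction (P (Suc (Suc m)) (ch (Suc m) (ch m x (\<theta>' \<eta>)) (\<theta>' \<mu>))) \<mu>)) j) \<le> B * \<nu> w ^ d"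
        using \<theta>'[OF \<eta>] by simp
    next
      fix \<eta> \<mu> i assume "\<eta> \<in> T" "\<mu> \<in> T"
      then show "\<nu> (coeff (P (Suc (Suc m)) (ch (Suc m) (ch m x (\<theta>' \<eta>)) (\<theta>' \<mu>))) i) \<le> B"
        using Suc.prems by (intro Suc.IH ch \<theta>') auto
    qed (use deg[OF Suc.prems(3)] \<open>0 \<le> B\<close> in auto)
  qed
  from this[of m M x i] assms(8-) show ?thesis by simp
qed

end

section \<open>Finite extensions of complete fields\<close>

lemma field_homD:
  assumes "field_hom h"
  shows "h 1 = 1" "h (x + y) = h x + h y" "h (x * y) = h x * h y" "h 0 = 0" "h (- x) = - h x"
    "h (x - y) = h x - h y" "h (x ^ n) = h x ^ n" "h (inverse x) = inverse (h x)" "h (x / y) = h x / h y"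
    "h x = 0 \<longleftrightarrow> x = 0"
proof -
  note hom = assms[unfolded field_hom_def]
  show 1: "h 1 = 1" and add: "h (x + y) = h x + h y" and mult: "h (x * y) = h x * h y" for x y
    using hom by auto
  show 0: "h 0 = 0" using add[of 0 0] by (metis add_cancel_right_right add.right_neutral)
  show minus: "h (- x) = - h x" for x using add[of x "- x"] 0 by (simp add: eq_neg_iff_add_eq_0 add.commute)
  show "h (x - y) = h x - h y" using add[of x "- y"] minus[of y] by simp
  show "h (x ^ n) = h x ^ n" by (induction n) (simp_all add: 1 mult)
  show inv: "h (inverse x) = inverse (h x)" for x
  proof (cases "x = 0")
    case False
    then have "h x * h (inverse x) = 1" using mult[of x "inverse x"] 1 by simp
    then show ?thesis by (metis inverse_unique)
  qed (simp add: 0)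
  then show "h (x / y) = h x / h y" by (simp add: divide_inverse mult)
  show "h x = 0 \<longleftrightarrow> x = 0"
    using 0 1 mult[of x "inverse x"] by (metis mult_zero_left right_inverse zero_neq_one)
qed

definition abs_cauchy :: "('a::field \<Rightarrow> real) \<Rightarrow> (nat \<Rightarrow> 'a) \<Rightarrow> bool" where
  "abs_cauchy \<nu> u \<longleftrightarrow> (\<forall>e>0. \<exists>M. \<forall>m\<ge>M. \<forall>n\<ge>M. \<nu> (u m - u n) < e)"

lemma abs_completeD:
  "abs_complete \<nu> \<Longrightarrow> abs_cauchy \<nu> u \<Longrightarrow> \<exists>l. (\<lambda>n. \<nu> (u n - l)) \<longlonglongrightarrow> 0"
  unfolding abs_complete_def abs_cauchy_def by blast

context nonarch_field
begin

lemma limit_add: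
  assumes "(\<lambda>n. \<nu> (u n - l)) \<longlonglongrightarrow> 0" "(\<lambda>n. \<nu> (v n - m)) \<longlonglongrightarrow> 0"
  shows "(\<lambda>n. \<nu> (u n + v n - (l + m))) \<longlonglongrightarrow> 0"
proof (rule tendsto_sandwich[of "\<lambda>_. 0" _ _ "\<lambda>n. \<nu> (u n - l) + \<nu> (v n - m)"])
  show "\<forall>\<^sub>F n in sequentially. \<nu> (u n + v n - (l + m)) \<le> \<nu> (u n - l) + \<nu> (v n - m)"
  proof (rule always_eventually, rule allI)
    fix n
    have "u n + v n - (l + m) = (u n - l) + (v n - m)" by simp
    then show "\<nu> (u n + v n - (l + m)) \<le> \<nu> (u n - l) + \<nu> (v n - m)"
      using abs_add[of "u n - l" "v n - m"] abs_nonneg[of "u n - l"] abs_nonneg[of "v n - m"]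
      by (smt (verit))
  qed
  show "(\<lambda>n. \<nu> (u n - l) + \<nu> (v n - m)) \<longlonglongrightarrow> 0"
    using tendsto_add[OF assms] by simp
qed auto

lemma limit_unique:
  assumes "(\<lambda>n. \<nu> (u n - l)) \<longlonglongrightarrow> 0" "(\<lambda>n. \<nu> (u n - m)) \<longlonglongrightarrow> 0"
  shows "l = m"
proof -
  have "(\<lambda>n. \<nu> (- u n - (- m))) \<longlonglongrightarrow> 0"
    using assms(2) by (simp add: abs_diff_commute)
  from limit_add[OF assms(1) this] have "(\<lambda>n::nat. \<nu> (m - l)) \<longlonglongrightarrow> 0" by simp
  then show ?thesis using LIMSEQ_unique[OF tendsto_const] by fastforce
qed

lemma cauchy_diff:
  assumes "abs_cauchy \<nu> u" "abs_cauchy \<nu> v"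
  shows "abs_cauchy \<nu> (\<lambda>n. u n - v n)"
  unfolding abs_cauchy_def
proof (intro allI impI)
  fix e :: real assume "e > 0"
  then obtain M M' where "\<forall>m\<ge>M. \<forall>n\<ge>M. \<nu> (u m - u n) < e" "\<forall>m\<ge>M'. \<forall>n\<ge>M'. \<nu> (v m - v n) < e"
    using assms unfolding abs_cauchy_def by meson
  then have "\<nu> ((u m - u n) - (v m - v n)) < e" if "m \<ge> max M M'" "n \<ge> max M M'" for m n
    using that by (intro abs_diff_less[of "_ - _" _ "_ - _"]) auto
  then show "\<exists>M. \<forall>m\<ge>M. \<forall>n\<ge>M. \<nu> (u m - v m - (u n - v n)) < e"
    by (intro exI[of _ "max M M'"]) (simp add: algebra_simps)
qed

end

locale valued_extension =
  base: nonarch_field \<beta> + nonarch_field \<nu>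
  for \<beta> :: "'b::field \<Rightarrow> real" and \<nu> :: "'a::field \<Rightarrow> real" +
  fixes i :: "'b \<Rightarrow> 'a"
  assumes hom: "field_hom i" and complete: "abs_complete \<beta>" and ext: "\<nu> (i x) = \<beta> x"
begin

sublocale vector_space "\<lambda>c x. i c * x"
  by unfold_locales (simp_all add: algebra_simps field_homD[OF hom])

text \<open>A complete subspace is closed, so b has positive distance from it, and scaling makes the
  estimate uniform in c. It says that the coordinate along b is continuous. Completeness is a
  hypothesis because the lemma is used inside the induction that proves it.\<close>

lemma gap:
  assumes "\<And>u. (\<And>n. u n \<in> span B) \<Longrightarrow> abs_cauchy \<nu> u \<Longrightarrow> \<exists>l\<in>span B. (\<lambda>n. \<nu> (u n - l)) \<longlonglongrightarrow> 0"
    and "b \<notin> span B"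
  shows "\<exists>e>0. \<forall>c. \<forall>x\<in>span B. \<beta> c * e \<le> \<nu> (i c * b + x)"
proof -
  have "\<exists>e>0. \<forall>x\<in>span B. e \<le> \<nu> (b - x)"
  proof (rule ccontr)
    assume "\<not> ?thesis"
    then have "\<exists>x\<in>span B. \<nu> (b - x) < e" if "e > 0" for e using that by (meson not_less)
    then have "\<forall>n. \<exists>x\<in>span B. \<nu> (b - x) < inverse (real (Suc n))" by simp
    then obtain u where u: "\<And>n. u n \<in> span B" "\<And>n. \<nu> (b - u n) < inverse (real (Suc n))" by metis
    have lim: "(\<lambda>n. \<nu> (u n - b)) \<longlonglongrightarrow> 0"
    proof (rule tendsto_sandwich[of "\<lambda>_. 0" _ _ "\<lambda>n. inverse (real (Suc n))"])
      show "\<forall>\<^sub>F n in sequentially. \<nu> (u n - b) \<le> inverse (real (Suc n))"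
        using u(2) by (intro always_eventually allI) (metis abs_diff_commute less_imp_le)
    qed (use LIMSEQ_inverse_real_of_nat in auto)
    have "abs_cauchy \<nu> u"
      unfolding abs_cauchy_def
    proof (intro allI impI)
      fix e :: real assume "e > 0"
      then obtain M where M: "\<forall>n\<ge>M. \<nu> (u n - b) < e"
        using lim unfolding LIMSEQ_iff by fastforce
      have "\<nu> ((u m - b) - (u n - b)) < e" if "m \<ge> M" "n \<ge> M" for m n
        using that M by (intro abs_diff_less[of "u m - b" _ "u n - b"]) auto
      then show "\<exists>M. \<forall>m\<ge>M. \<forall>n\<ge>M. \<nu> (u m - u n) < e" by auto
    qed
    from assms(1)[OF u(1) this] obtain l where "l \<in> span B" "(\<lambda>n. \<nu> (u n - l)) \<longlonglongrightarrow> 0" by blast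
    with limit_unique[OF lim] assms(2) show False by blast
  qed
  then obtain e where e: "e > 0" "\<And>x. x \<in> span B \<Longrightarrow> e \<le> \<nu> (b - x)" by blast
  have "\<beta> c * e \<le> \<nu> (i c * b + x)" if "x \<in> span B" for c x
  proof (cases "c = 0")
    case False
    then have ic: "i c \<noteq> 0" by (simp add: field_homD[OF hom])
    have "i (- inverse c) * x \<in> span B" using that by (rule span_scale)
    then have "e \<le> \<nu> (b - i (- inverse c) * x)" by (rule e)
    then have "\<beta> c * e \<le> \<nu> (i c) * \<nu> (b - i (- inverse c) * x)"
      by (simp add: ext mult_left_mono)
    also have "\<dots> = \<nu> (i c * b + x)"
      unfolding abs_mult[symmetric] using ic by (simp add: field_homD[OF hom] algebra_simps)
    finally show ?thesis .
  qed simp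
  with e(1) show ?thesis by blast
qed

text \<open>By \<open>gap\<close> the coordinates along b form a Cauchy sequence in the complete
  base field; what remains after splitting them off lies in the smaller span.\<close>

lemma span_complete:
  assumes "finite B" "\<And>n. u n \<in> span B" "abs_cauchy \<nu> u"
  shows "\<exists>l\<in>span B. (\<lambda>n. \<nu> (u n - l)) \<longlonglongrightarrow> 0"
  using assms
proof (induction B arbitrary: u rule: finite_induct)
  case empty
  then show ?case by simp
next
  case (insert b B)
  show ?case
  proof (cases "b \<in> span B")
    case True
    then show ?thesis using insert by (simp add: span_redundant)
  next
    case False
    obtain e where e: "e > 0" "\<And>c x. x \<in> span B \<Longrightarrow> \<beta> c * e \<le> \<nu> (i c * b + x)"
      using gap[OF insert.IH False] by blast
    have "\<forall>n. \<exists>c. u n - i c * b \<in> span B"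
      using insert.prems(1) by (simp add: span_breakdown_eq)
    then obtain c where c: "\<And>n. u n - i (c n) * b \<in> span B" by metis
    have cc: "abs_cauchy \<beta> c"
      unfolding abs_cauchy_def
    proof (intro allI impI)
      fix \<epsilon> :: real assume "\<epsilon> > 0"
      then obtain M where M: "\<And>m n. m \<ge> M \<Longrightarrow> n \<ge> M \<Longrightarrow> \<nu> (u m - u n) < \<epsilon> * e"
        using insert.prems(2) e(1) unfolding abs_cauchy_def by (meson mult_pos_pos)
      have "\<beta> (c m - c n) < \<epsilon>" if "m \<ge> M" "n \<ge> M" for m n
      proof -
        have "(u m - i (c m) * b) - (u n - i (c n) * b) \<in> span B" by (rule span_diff[OF c c])
        then have "\<beta> (c m - c n) * e \<le> \<nu> (i (c m - c n) * b + ((u m - i (c m) * b) - (u n - i (c n) * b)))"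
          by (rule e(2))
        also have "\<dots> = \<nu> (u m - u n)" by (simp add: field_homD[OF hom] algebra_simps)
        finally show ?thesis using M[OF that] e(1) by (metis le_less_trans mult_less_cancel_right_pos)
      qed
      then show "\<exists>M. \<forall>m\<ge>M. \<forall>n\<ge>M. \<beta> (c m - c n) < \<epsilon>" by blast
    qed
    then obtain a where a: "(\<lambda>n. \<beta> (c n - a)) \<longlonglongrightarrow> 0" using abs_completeD[OF complete] by blast
    have lim1: "(\<lambda>n. \<nu> (i (c n) * b - i a * b)) \<longlonglongrightarrow> 0"
    proof -
      have "\<nu> (i (c n) * b - i a * b) = \<beta> (c n - a) * \<nu> b" for n
        unfolding ext[symmetric] abs_mult[symmetric] by (simp add: field_homD[OF hom] algebra_simps)
      then show ?thesis using tendsto_mult[OF a tendsto_const, of "\<nu> b"] by simp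
    qed
    have "abs_cauchy \<nu> (\<lambda>n. i (c n) * b)"
      unfolding abs_cauchy_def
    proof (intro allI impI)
      fix \<epsilon> :: real assume "\<epsilon> > 0"
      moreover have pos: "0 < 1 + \<nu> b" using abs_nonneg[of b] by linarith
      ultimately obtain M where M: "\<And>m n. m \<ge> M \<Longrightarrow> n \<ge> M \<Longrightarrow> \<beta> (c m - c n) < \<epsilon> / (1 + \<nu> b)"
        using cc unfolding abs_cauchy_def by (meson divide_pos_pos)
      have "\<nu> (i (c m) * b - i (c n) * b) < \<epsilon>" if "m \<ge> M" "n \<ge> M" for m n
      proof -
        have "\<nu> (i (c m) * b - i (c n) * b) = \<beta> (c m - c n) * \<nu> b"
          unfolding ext[symmetric] abs_mult[symmetric] by (simp add: field_homD[OF hom] algebra_simps)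
        also have "\<dots> \<le> \<beta> (c m - c n) * (1 + \<nu> b)" by (intro mult_left_mono) auto
        also have "\<dots> < \<epsilon>" using M[OF that] pos by (simp add: pos_less_divide_eq)
        finally show ?thesis .
      qed
      then show "\<exists>M. \<forall>m\<ge>M. \<forall>n\<ge>M. \<nu> (i (c m) * b - i (c n) * b) < \<epsilon>" by blast
    qed
    then have "abs_cauchy \<nu> (\<lambda>n. u n - i (c n) * b)" by (rule cauchy_diff[OF insert.prems(2)])
    then obtain l where l: "l \<in> span B" "(\<lambda>n. \<nu> (u n - i (c n) * b - l)) \<longlonglongrightarrow> 0"
      using insert.IH[of "\<lambda>n. u n - i (c n) * b"] c by blast
    have "(\<lambda>n. \<nu> (u n - (i a * b + l))) \<longlonglongrightarrow> 0"
      using limit_add[OF lim1 l(2)] by simp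
    moreover have "i a * b + l \<in> span (insert b B)"
      unfolding span_breakdown_eq using l(1) by (intro exI[of _ a]) simp
    ultimately show ?thesis by blast
  qed
qed

lemma extension_complete:
  assumes "finite B" "span B = UNIV"
  shows "abs_complete \<nu>"
  using span_complete[OF assms(1)] assms(2) unfolding abs_complete_def abs_cauchy_def by auto

text \<open>By \<open>gap\<close> the coordinate along b is controlled by \<nu>, while \<nu>' is
  controlled by the coordinates.\<close>

lemma norm_comparison:
  assumes "nonarch_abs \<nu>'" "\<And>x. \<nu>' (i x) = \<beta> x" "finite B"
  shows "\<exists>C\<ge>0. \<forall>x\<in>span B. \<nu>' x \<le> C * \<nu> x"
  using assms(3)
proof (induction B rule: finite_induct)
  case empty
  interpret n: nonarch_field \<nu>' by unfold_locales (rule assms)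
  show ?case by (auto intro: exI[of _ 0])
next
  case (insert b B)
  interpret n: nonarch_field \<nu>' by unfold_locales (rule assms)
  show ?case
  proof (cases "b \<in> span B")
    case True
    then show ?thesis using insert by (simp add: span_redundant)
  next
    case False
    obtain e where e: "e > 0" "\<And>c x. x \<in> span B \<Longrightarrow> \<beta> c * e \<le> \<nu> (i c * b + x)"
      using gap[OF span_complete[OF \<open>finite B\<close>] False] by blast
    obtain C where C: "C \<ge> 0" "\<And>x. x \<in> span B \<Longrightarrow> \<nu>' x \<le> C * \<nu> x" using insert.IH by blast
    define K where "K = \<nu>' b / e + C * (1 + \<nu> b / e)"
    have "\<nu>' x \<le> K * \<nu> x" if x: "x \<in> span (insert b B)" for x
    proof -
      obtain c where c: "x - i c * b \<in> span B" using x by (auto simp: span_breakdown_eq)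
      have bc: "\<beta> c \<le> \<nu> x / e" using e(2)[OF c, of c] e(1) by (simp add: field_simps)
      have "\<nu> (x - i c * b) \<le> \<nu> x + \<beta> c * \<nu> b"
        using abs_diff[of x "i c * b"] abs_nonneg[of x] by (simp add: abs_mult ext max_def split: if_splits)
          (meson abs_nonneg base.abs_nonneg add_increasing add_increasing2 mult_nonneg_nonneg order_trans)+
      also have "\<dots> \<le> \<nu> x + \<nu> x / e * \<nu> b" using bc by (intro add_left_mono mult_right_mono) auto
      finally have 1: "\<nu>' (x - i c * b) \<le> C * (\<nu> x + \<nu> x / e * \<nu> b)"
        using C(2)[OF c] C(1) by (meson mult_left_mono order_trans)
      have 2: "\<nu>' (i c * b) \<le> \<nu> x / e * \<nu>' b"
        unfolding n.abs_mult assms(2) using bc by (intro mult_right_mono) auto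
      have "\<nu>' x = \<nu>' ((x - i c * b) + i c * b)" by simp
      also have "\<dots> \<le> \<nu>' (x - i c * b) + \<nu>' (i c * b)"
        using n.abs_add[of "x - i c * b" "i c * b"] n.abs_nonneg[of "x - i c * b"] n.abs_nonneg[of "i c * b"]
        by linarith
      also have "\<dots> \<le> K * \<nu> x" using 1 2 by (simp add: K_def algebra_simps)
      finally show ?thesis .
    qed
    moreover have "K \<ge> 0" using C(1) e(1) by (simp add: K_def)
    ultimately show ?thesis by blast
  qed
qed

lemma abs_unique:
  assumes "nonarch_abs \<nu>'" "\<And>x. \<nu>' (i x) = \<beta> x" "finite B" "span B = UNIV"
  shows "\<nu>' x = \<nu> x"
proof -
  interpret n: nonarch_field \<nu>' by unfold_locales (rule assms)
  obtain C where C: "C \<ge> 0" "\<And>x. \<nu>' x \<le> C * \<nu> x"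
    using norm_comparison[OF assms(1-3)] assms(4) by blast
  have le: "\<nu>' x \<le> \<nu> x" for x
  proof (rule ccontr)
    assume "\<not> ?thesis"
    then have gt: "\<nu> x < \<nu>' x" by simp
    then have pos: "0 < \<nu> x" by (metis abs_pos n.abs_0 abs_0 less_irrefl)
    then have "1 < \<nu>' x / \<nu> x" using gt by simp
    \<comment> \<open>Comparing n-th powers forces the constant down to 1 by multiplicativity;
      inverses give the reverse inequality.\<close>
    then obtain n where n: "C < (\<nu>' x / \<nu> x) ^ n" using real_arch_pow by blast
    have "\<nu>' x ^ n \<le> C * \<nu> x ^ n" using C(2)[of "x ^ n"] by (simp add: abs_power n.abs_power)
    then have "(\<nu>' x / \<nu> x) ^ n \<le> C" using pos by (simp add: power_divide divide_le_eq)
    with n show False by simp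
  qed
  show ?thesis
  proof (cases "x = 0")
    case False
    have "inverse (\<nu>' x) \<le> inverse (\<nu> x)" using le[of "inverse x"] by (simp add: abs_inverse n.abs_inverse)
    then have "\<nu> x \<le> \<nu>' x" using False by (simp add: le_imp_inverse_le inverse_le_iff_le)
    then show ?thesis using le[of x] by simp
  qed simp
qed

end

section \<open>The residue field and Teichmueller representatives\<close>

context nonarch_field
begin

lemma abs_prod_diff_less:
  assumes "\<And>x. x \<in> A \<Longrightarrow> \<nu> (g x) \<le> 1" "\<And>x. x \<in> A \<Longrightarrow> \<nu> (h x) \<le> 1"
    "\<And>x. x \<in> A \<Longrightarrow> \<nu> (g x - h x) < 1"
  shows "\<nu> (prod g A - prod h A) < 1"
  using assms
proof (induction A rule: infinite_finite_induct)
  case (insert a A)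
  have "prod g (insert a A) - prod h (insert a A) = (g a - h a) * prod g A + h a * (prod g A - prod h A)"
    using insert by (simp add: algebra_simps)
  also have "\<nu> \<dots> < 1"
  proof (rule abs_add_less)
    have "\<nu> (prod g A) \<le> 1" unfolding abs_prod using insert by (intro prod_le_1) auto
    then have "\<nu> (g a - h a) * \<nu> (prod g A) \<le> \<nu> (g a - h a)" by (intro mult_left_le) auto
    also have "\<dots> < 1" using insert.prems by simp
    finally show "\<nu> ((g a - h a) * prod g A) < 1" by (simp add: abs_mult)
    have "\<nu> (h a) * \<nu> (prod g A - prod h A) \<le> \<nu> (prod g A - prod h A)"
      using insert.prems by (intro mult_left_le_one_le) auto
    also have "\<dots> < 1" using insert by auto
    finally show "\<nu> (h a * (prod g A - prod h A)) < 1" by (simp add: abs_mult)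
  qed
  finally show ?case .
qed auto

lemma abs_power_diff_le:
  assumes "\<nu> a \<le> 1" "\<nu> b \<le> 1"
  shows "\<nu> (a ^ n - b ^ n) \<le> \<nu> (a - b)"
proof (cases n)
  case (Suc m)
  have "\<nu> (\<Sum>j<Suc m. a ^ j * b ^ (m - j)) \<le> 1"
    using assms by (intro abs_sum_le abs_mult_le1 abs_power_le1) auto
  then show ?thesis unfolding Suc diff_power_eq_sum by (intro abs_mult_le1) auto
qed simp

text \<open>The cofactor of a - b in a ^ n - b ^ n is n b ^ (n - 1) modulo a - b. For n = q, of
  absolute value below 1, the q-th power map is thus contracting inside a residue class.\<close>

lemma abs_power_diff_contraction:
  assumes "\<nu> a \<le> 1" "\<nu> b \<le> 1"
  shows "\<nu> (a ^ n - b ^ n) \<le> \<nu> (a - b) * max (\<nu> (of_nat n)) (\<nu> (a - b))"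
proof (cases n)
  case (Suc m)
  have "(\<Sum>j<Suc m. a ^ j * b ^ (m - j)) = (\<Sum>j<Suc m. (a ^ j - b ^ j) * b ^ (m - j) + b ^ m)"
    by (intro sum.cong) (auto simp: algebra_simps power_add[symmetric])
  also have "\<dots> = (\<Sum>j<Suc m. (a ^ j - b ^ j) * b ^ (m - j)) + of_nat n * b ^ m"
    by (simp only: sum.distrib) (simp add: Suc)
  finally have eq: "(\<Sum>j<Suc m. a ^ j * b ^ (m - j)) = \<dots>" .
  have "\<nu> (\<Sum>j<Suc m. (a ^ j - b ^ j) * b ^ (m - j)) \<le> \<nu> (a - b)"
    using assms by (intro abs_sum_le abs_mult_le1 abs_power_diff_le abs_power_le1) auto
  moreover have "\<nu> (of_nat n * b ^ m) \<le> \<nu> (of_nat n)"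
    using assms by (intro abs_mult_le1 abs_power_le1) auto
  ultimately have "\<nu> (\<Sum>j<Suc m. a ^ j * b ^ (m - j)) \<le> max (\<nu> (of_nat n)) (\<nu> (a - b))"
    unfolding eq by (intro abs_add_le) auto
  then show ?thesis unfolding Suc diff_power_eq_sum by (intro abs_mult_le) auto
qed simp

lemma cauchy_of_contraction:
  assumes "0 \<le> c" "c < 1" "\<And>n. \<nu> (u (Suc n) - u n) \<le> c ^ n"
  shows "abs_cauchy \<nu> u"
  unfolding abs_cauchy_def
proof (intro allI impI)
  fix e :: real assume "e > 0"
  then obtain M where M: "c ^ M < e" using real_arch_pow_inv[of e c] assms by blast
  have step: "\<nu> (u (M + j) - u M) \<le> c ^ M" for j
  proof (induction j)
    case (Suc j)
    have "c ^ (M + j) \<le> c ^ M" using assms by (intro power_decreasing) auto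
    then have "\<nu> ((u (Suc (M + j)) - u (M + j)) + (u (M + j) - u M)) \<le> c ^ M"
      using assms(3)[of "M + j"] Suc by (intro abs_add_le[of "_ - _" _ "_ - _"]) auto
    then show ?case by simp
  qed (use assms in simp)
  have "\<nu> ((u m - u M) - (u n - u M)) \<le> c ^ M" if "m \<ge> M" "n \<ge> M" for m n
    using step[of "m - M"] step[of "n - M"] that by (intro abs_diff_le[of "_ - _" _ "_ - _"]) auto
  then show "\<exists>M. \<forall>m\<ge>M. \<forall>n\<ge>M. \<nu> (u m - u n) < e"
    using M by (intro exI[of _ M]) (simp, meson le_less_trans)
qed

end

text \<open>A \<open>card\<close> is 0 for infinite sets, so the extra assumption says that the
  residue field is finite; the theorem supplies it through r < q.\<close>

locale padic_residue = padic_setup D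
  for D :: "('q::field_char_0, 'f::field_char_0, 'c::field_char_0) padic_data" +
  assumes resq_pos: "0 < resq D"
begin

sublocale Q: nonarch_field "absQ D"
  using Qp by unfold_locales (simp add: is_Qp_def)
sublocale F: nonarch_field "absF D"
  by unfold_locales (rule F_abs)
sublocale C: nonarch_field "absC D"
  by unfold_locales (rule C_abs)

lemma F_extension: "valued_extension (absQ D) (absF D) (embF D)"
  using Qp F_finite F_abs by unfold_locales (auto simp: is_Qp_def finite_extension_def)

lemma F_complete: "abs_complete (absF D)"
proof -
  interpret valued_extension "absQ D" "absF D" "embF D" by (rule F_extension)
  show ?thesis using F_finite extension_complete unfolding finite_extension_def by auto
qed

lemma embedding_hom: "\<sigma> \<in> embeddings D \<Longrightarrow> field_hom \<sigma>"
  by (simp add: embeddings_def)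

text \<open>The pullback of \<open>absC\<close> is an extension of the p-adic absolute value to F,
  and there is only one. In particular the image of the uniformizer has the same size under all
  embeddings, including the one that scales the lattices.\<close>

lemma abs_embedding:
  assumes "\<sigma> \<in> embeddings D"
  shows "absC D (\<sigma> x) = absF D x"
proof -
  interpret valued_extension "absQ D" "absF D" "embF D" by (rule F_extension)
  note hom = field_homD[OF embedding_hom[OF assms]]
  have "nonarch_abs (\<lambda>x. absC D (\<sigma> x))"
    unfolding nonarch_abs_def by (auto simp: hom C.abs_mult C.abs_add)
  moreover have "absC D (\<sigma> (embF D x)) = absQ D x" for x
    using assms C_abs(2) by (simp add: embeddings_def)
  moreover obtain B where "finite B" "span B = UNIV" using F_finite by (auto simp: finite_extension_def)
  ultimately show ?thesis by (rule abs_unique)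
qed

lemma abs_prime_less: "absF D (of_nat (prm D)) < 1"
proof -
  have "embF D (of_nat n) = of_nat n" for n
    using F_finite by (induction n) (simp_all add: finite_extension_def field_homD)
  then have "absF D (of_nat (prm D)) = absQ D (of_nat (prm D))" using F_abs(2) by metis
  also have "\<dots> = padic_abs (prm D) (of_nat (prm D))"
    using Qp unfolding is_Qp_def by (metis of_rat_of_nat_eq)
  also have "\<dots> < 1"
  proof -
    have "quotient_of (of_nat (prm D)) = (int (prm D), 1)"
      using quotient_of_int[of "int (prm D)"] by simp
    moreover have "prm D > 1" using prime prime_gt_1_nat by blast
    moreover have "multiplicity (int (prm D)) (int (prm D)) = 1"
      using prime by (intro multiplicity_self) (auto simp: prime_gt_0_nat)
    ultimately show ?thesis by (simp add: padic_abs_def power_int_minus inverse_less_1_iff)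
  qed
  finally show ?thesis .
qed

section \<open>The discrete valuation of F\<close>

abbreviation "ab \<equiv> absF D"
abbreviation "\<pi> \<equiv> unif D"

text \<open>Discreteness is used in the form of the last claim: because the maximal ideal is
  principal, a strict bound by 1 improves to one by |\<pi>|.\<close>

lemma unif_nonzero: "\<pi> \<noteq> 0" and unif_less: "ab \<pi> < 1"
  and less_1_le_unif: "ab x < 1 \<Longrightarrow> ab x \<le> ab \<pi>"
proof -
  note u = unif[unfolded uniformizer_def maximal_ideal_def ring_of_integers_def]
  have ex: "\<exists>y. x = \<pi> * y \<and> ab y \<le> 1" if "ab x < 1" for x
    using that u by blast
  show "\<pi> \<noteq> 0" using ex[OF abs_prime_less] prime by (auto simp: prime_gt_0_nat)
  have "\<pi> * 1 \<in> (\<lambda>x. \<pi> * x) ` {x. ab x \<le> 1}" by (rule imageI) simp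
  then show "ab \<pi> < 1" unfolding u[symmetric] by simp
  show "ab x \<le> ab \<pi>" if "ab x < 1" using ex[OF that] by (auto intro: F.abs_mult_le1)
qed

lemma unif_pos: "0 < ab \<pi>"
  using unif_nonzero by simp

lemma unif_power_mono: "m \<le> n \<Longrightarrow> ab \<pi> ^ n \<le> ab \<pi> ^ m"
  using unif_less by (intro power_decreasing) auto

lemma unif_power_inject: "ab \<pi> ^ m = ab \<pi> ^ n \<longleftrightarrow> m = n"
  using unif_pos unif_less by (metis linorder_neqE_nat less_irrefl power_strict_decreasing)

lemma abs_eq_unif_power:
  assumes "x \<noteq> 0" "ab x \<le> 1"
  shows "\<exists>n. ab x = ab \<pi> ^ n"
proof -
  have "\<exists>m. ab \<pi> ^ m < ab x" using real_arch_pow_inv[of "ab x" "ab \<pi>"] unif_less assms by simp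
  \<comment> \<open>With m = n + 1 minimal, |x| lies above |\<pi>| ^ (n + 1) and is at most |\<pi>|
    ^ n; discreteness leaves only the upper end.\<close>
  define m where "m = (LEAST m. ab \<pi> ^ m < ab x)"
  have m: "ab \<pi> ^ m < ab x" unfolding m_def using \<open>\<exists>m. _\<close> by (rule LeastI_ex)
  then obtain n where n: "m = Suc n" using assms by (cases m) auto
  then have "\<not> ab \<pi> ^ n < ab x" using not_less_Least[of n "\<lambda>m. ab \<pi> ^ m < ab x"] by (simp add: m_def)
  moreover have "\<not> ab x < ab \<pi> ^ n"
  proof
    assume "ab x < ab \<pi> ^ n"
    then have "ab (x / \<pi> ^ n) < 1" using unif_pos by (simp add: F.abs_divide F.abs_power)
    then have "ab (x / \<pi> ^ n) \<le> ab \<pi>" by (rule less_1_le_unif)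
    then show False using m n unif_pos by (simp add: F.abs_divide F.abs_power divide_le_eq)
  qed
  ultimately show ?thesis by (intro exI[of _ n]) simp
qed

lemma abs_eq_unif_powi:
  assumes "x \<noteq> 0"
  shows "\<exists>n. ab x = ab \<pi> powi n"
proof (cases "ab x \<le> 1")
  case True
  then show ?thesis using abs_eq_unif_power[OF assms] by (metis power_int_of_nat)
next
  case False
  then have "ab (inverse x) \<le> 1" by (simp add: F.abs_inverse inverse_le_1_iff)
  then obtain n where "ab (inverse x) = ab \<pi> ^ n" using abs_eq_unif_power[of "inverse x"] assms by auto
  then have "ab x = inverse (ab \<pi> ^ n)" by (metis F.abs_inverse inverse_inverse_eq)
  then show ?thesis by (intro exI[of _ "- int n"]) (simp add: power_int_minus)
qed

section \<open>Residue classes and Fermat's little theorem\<close>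

definition cls :: "'f \<Rightarrow> 'f set" where
  "cls x = {y. ab (y - x) < 1}"

lemma residue_field_eq: "residue_field ab = cls ` {x. ab x \<le> 1}"
  by (simp add: residue_field_def cls_def maximal_ideal_def ring_of_integers_def)

lemma finite_residue_field: "finite (residue_field ab)"
  using resq_pos by (metis resq_def card.infinite less_irrefl)

lemma self_in_cls: "x \<in> cls x"
  by (simp add: cls_def)

lemma cls_eq_iff: "cls x = cls y \<longleftrightarrow> ab (x - y) < 1"
proof
  assume "ab (x - y) < 1"
  have "ab (z - x) < 1 \<longleftrightarrow> ab (z - y) < 1" for z
    using F.abs_add_less[OF _ \<open>ab (x - y) < 1\<close>, of "z - x"] F.abs_diff_less[OF _ \<open>ab (x - y) < 1\<close>, of "z - y"]
    by auto
  then show "cls x = cls y" by (simp add: cls_def)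
qed (use self_in_cls[of x] in \<open>simp add: cls_def\<close>)

lemma cls_memI: "ab x \<le> 1 \<Longrightarrow> cls x \<in> residue_field ab"
  by (auto simp: residue_field_eq)

lemma residue_field_memD:
  assumes "c \<in> residue_field ab" "x \<in> c"
  shows "ab x \<le> 1" "cls x = c"
proof -
  obtain y where y: "c = cls y" "ab y \<le> 1" using assms by (auto simp: residue_field_eq)
  then have xy: "ab (x - y) < 1" using assms by (simp add: cls_def)
  then show "cls x = c" using y by (simp add: cls_eq_iff)
  show "ab x \<le> 1" using F.abs_add_le[of "x - y" 1 y] xy y by simp
qed

definition rep :: "'f set \<Rightarrow> 'f" where
  "rep c = (SOME x. x \<in> c)"

lemma rep_in: "c \<in> residue_field ab \<Longrightarrow> rep c \<in> c"
  unfolding rep_def residue_field_eq using self_in_cls by (metis imageE someI)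

lemma rep_abs: "c \<in> residue_field ab \<Longrightarrow> ab (rep c) \<le> 1"
  and cls_rep: "c \<in> residue_field ab \<Longrightarrow> cls (rep c) = c"
  using residue_field_memD rep_in by blast+

lemma rep_cls: "ab x \<le> 1 \<Longrightarrow> ab (rep (cls x) - x) < 1"
  using cls_rep[OF cls_memI] by (simp add: cls_eq_iff)

text \<open>Translation by 1 permutes the residue classes, so the sum of all representatives shows \<open>q = 0\<close>.\<close>
lemma abs_resq_less: "ab (of_nat (resq D)) < 1"
proof -
  let ?R = "residue_field ab"
  let ?\<phi> = "\<lambda>c. cls (rep c + 1)"
  have maps: "?\<phi> ` ?R \<subseteq> ?R" using rep_abs by (auto intro!: cls_memI F.abs_add_le)
  have inj: "inj_on ?\<phi> ?R"
  proof (rule inj_onI)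
    fix c c' assume "c \<in> ?R" "c' \<in> ?R" "?\<phi> c = ?\<phi> c'"
    then show "c = c'" using cls_rep by (metis cls_eq_iff add_diff_cancel_right)
  qed
  have "bij_betw ?\<phi> ?R ?R"
    using inj maps finite_residue_field by (simp add: bij_betw_def endo_inj_surj)
  then have "sum rep ?R = (\<Sum>c\<in>?R. rep (?\<phi> c))"
    by (rule sum.reindex_bij_betw[symmetric])
  then have "of_nat (resq D) = - (\<Sum>c\<in>?R. rep (?\<phi> c) - (rep c + 1))"
    by (simp add: sum_subtractf sum.distrib resq_def)
  moreover have "ab (\<Sum>c\<in>?R. rep (?\<phi> c) - (rep c + 1)) \<le> ab \<pi>"
    using rep_abs unif_pos by (intro F.abs_sum_le less_1_le_unif rep_cls F.abs_add_le) auto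
  ultimately show ?thesis using unif_less by simp
qed

text \<open>Multiplication by a unit y permutes the nonzero classes, so the product of their
  representatives changes by y ^ (q - 1) on one side and not at all on the other; being a unit, it
  cancels. Representatives take the place of a ring structure on the set of classes.\<close>

lemma fermat:
  assumes "ab y \<le> 1"
  shows "ab (y ^ resq D - y) < 1"
proof (cases "ab y = 1")
  case False
  then have y: "ab y < 1" using assms by simp
  then have "ab (y ^ resq D) < 1" using resq_pos by (simp add: F.abs_power power_less_one_iff)
  then show ?thesis using y by (rule F.abs_diff_less)
next
  case True
  let ?R = "residue_field ab - {cls 0}"
  let ?\<phi> = "\<lambda>c. cls (y * rep c)"
  have unit: "ab (rep c) = 1" if "c \<in> ?R" for c
  proof -
    have "\<not> ab (rep c - 0) < 1" using that cls_rep by (metis DiffE cls_eq_iff insertI1)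
    then show ?thesis using rep_abs[of c] that by simp
  qed
  have maps: "?\<phi> ` ?R \<subseteq> ?R"
  proof
    fix c' assume "c' \<in> ?\<phi> ` ?R"
    then obtain c where c: "c \<in> ?R" "c' = ?\<phi> c" by blast
    have "ab (y * rep c) = 1" using unit[OF c(1)] True by (simp add: F.abs_mult)
    then show "c' \<in> ?R" unfolding c(2) by (simp add: cls_memI cls_eq_iff)
  qed
  have inj: "inj_on ?\<phi> ?R"
  proof (rule inj_onI)
    fix c c' assume c: "c \<in> ?R" "c' \<in> ?R" "?\<phi> c = ?\<phi> c'"
    then have "ab (y * rep c - y * rep c') < 1" by (simp add: cls_eq_iff)
    then have "ab (y * (rep c - rep c')) < 1" by (simp add: algebra_simps)
    then have "cls (rep c) = cls (rep c')" using True by (simp add: cls_eq_iff F.abs_mult)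
    then show "c = c'" using c cls_rep by auto
  qed
  have bij: "bij_betw ?\<phi> ?R ?R"
    using inj maps finite_residue_field by (simp add: bij_betw_def endo_inj_surj)
  have "ab ((\<Prod>c\<in>?R. rep (?\<phi> c)) - (\<Prod>c\<in>?R. y * rep c)) < 1"
    using unit True maps by (intro F.abs_prod_diff_less rep_cls) (auto simp: F.abs_mult intro!: rep_abs cls_memI)
  also have "(\<Prod>c\<in>?R. rep (?\<phi> c)) = (\<Prod>c\<in>?R. rep c)" by (rule prod.reindex_bij_betw[OF bij])
  also have "(\<Prod>c\<in>?R. y * rep c) = y ^ (resq D - 1) * (\<Prod>c\<in>?R. rep c)"
    using finite_residue_field cls_memI[of 0] by (simp add: prod.distrib resq_def card_Diff_singleton)
  finally have "ab ((1 - y ^ (resq D - 1)) * (\<Prod>c\<in>?R. rep c)) < 1" by (simp add: algebra_simps)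
  moreover have "ab (\<Prod>c\<in>?R. rep c) = 1" unfolding F.abs_prod using unit by (intro prod.neutral) auto
  ultimately have "ab (1 - y ^ (resq D - 1)) < 1" by (simp add: F.abs_mult)
  then have "ab (y * (y ^ (resq D - 1) - 1)) < 1" using True F.abs_diff_commute by (simp add: F.abs_mult)
  also have "y * (y ^ (resq D - 1) - 1) = y ^ resq D - y"
    using resq_pos by (cases "resq D") (auto simp: algebra_simps)
  finally show ?thesis .
qed

section \<open>Teichmueller representatives\<close>

lemma teichmueller_unique:
  assumes "ab x \<le> 1" "x ^ resq D = x" "y ^ resq D = y" "ab (x - y) < 1"
  shows "x = y"
proof (rule ccontr)
  assume "x \<noteq> y"
  have "ab y \<le> 1" using F.abs_diff_le[of x 1 "x - y"] assms by simp
  \<comment> \<open>The q-th power map fixes both points, yet it would contract a nonzero difference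
    strictly.\<close>
  then have "ab (x - y) \<le> ab (x - y) * max (ab (of_nat (resq D))) (ab (x - y))"
    using F.abs_power_diff_contraction[of x y "resq D"] assms by simp
  then have "1 \<le> max (ab (of_nat (resq D))) (ab (x - y))" using \<open>x \<noteq> y\<close> by simp
  then show False using assms abs_resq_less by simp
qed

text \<open>The representative is the limit of y ^ (q ^ n), which is fixed by the q-th power map by
  continuity.\<close>

lemma teichmueller_exists:
  assumes "ab y \<le> 1"
  shows "\<exists>x. ab (x - y) < 1 \<and> x ^ resq D = x"
proof -
  define q where "q = resq D"
  define u where "u n = y ^ (q ^ n)" for n
  have u1: "ab (u n) \<le> 1" for n unfolding u_def using assms by (rule F.abs_power_le1)
  have uS: "u (Suc n) = u n ^ q" for n by (simp add: u_def power_mult[symmetric] mult.commute)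
  \<comment> \<open>Since no difference exceeds the first one, c bounds the contraction factor at
    every step.\<close>
  define c where "c = max (ab (of_nat q)) (ab (u 1 - u 0))"
  have c: "0 \<le> c" "c < 1" using fermat[OF assms] abs_resq_less by (auto simp: c_def u_def q_def le_max_iff_disj)
  have step: "ab (u (Suc n) - u n) \<le> c ^ n * ab (u 1 - u 0)" for n
  proof (induction n)
    case (Suc n)
    have "c ^ n * ab (u 1 - u 0) \<le> 1 * ab (u 1 - u 0)" using c by (intro mult_right_mono power_le_one) auto
    then have le: "ab (u (Suc n) - u n) \<le> c" using Suc by (simp add: c_def)
    have "ab (u (Suc (Suc n)) - u (Suc n)) = ab (u (Suc n) ^ q - u n ^ q)" by (simp only: uS)
    also have "\<dots> \<le> ab (u (Suc n) - u n) * max (ab (of_nat q)) (ab (u (Suc n) - u n))"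
      by (intro F.abs_power_diff_contraction u1)
    also have "\<dots> \<le> (c ^ n * ab (u 1 - u 0)) * c"
      using Suc le c by (intro mult_mono) (auto simp: c_def le_max_iff_disj)
    finally show ?case by (simp add: mult_ac)
  qed simp
  have "ab (u 1 - u 0) \<le> 1" by (intro F.abs_diff_le u1)
  then have "ab (u (Suc n) - u n) \<le> c ^ n" for n
    using step[of n] c mult_left_le[of "ab (u 1 - u 0)" "c ^ n"] by (meson order_trans zero_le_power)
  then have "abs_cauchy ab u" by (rule F.cauchy_of_contraction[OF c])
  then obtain x where x: "(\<lambda>n. ab (u n - x)) \<longlonglongrightarrow> 0" using abs_completeD[OF F_complete] by blast
  have near: "ab (u n - y) \<le> ab \<pi>" for n
  proof (induction n)
    case (Suc n)
    have "ab ((u n ^ q - u n) + (u n - y)) \<le> ab \<pi>"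
      using Suc fermat[OF u1[of n]] by (intro F.abs_add_le[OF less_1_le_unif]) (auto simp: q_def)
    then show ?case by (simp add: uS)
  qed (simp add: u_def)
  obtain n where "ab (u n - x) < 1" using x unfolding LIMSEQ_iff by (metis real_norm_def abs_of_nonneg diff_zero F.abs_nonneg order_refl zero_less_one)
  then have xu: "ab (u n - x) < 1" .
  have xy: "ab (x - y) < 1"
  proof -
    have "ab ((u n - y) - (u n - x)) < 1"
      using near[of n] xu unif_less by (intro F.abs_diff_less[of "_ - _" _ "_ - _"]) auto
    then show ?thesis by simp
  qed
  have x1: "ab x \<le> 1" using F.abs_add_le[of "x - y" 1 y] xy assms by simp
  have "(\<lambda>n. ab (u (Suc n) - x ^ q)) \<longlonglongrightarrow> 0"
  proof (rule tendsto_sandwich[OF _ _ tendsto_const x])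
    show "\<forall>\<^sub>F n in sequentially. ab (u (Suc n) - x ^ q) \<le> ab (u n - x)"
      unfolding uS using u1 x1 by (intro always_eventually allI F.abs_power_diff_le)
  qed auto
  moreover have "(\<lambda>n. ab (u (Suc n) - x)) \<longlonglongrightarrow> 0" using x by (rule LIMSEQ_Suc)
  ultimately have "x ^ q = x" by (rule F.limit_unique)
  then show ?thesis using xy by (auto simp: q_def)
qed

definition teich :: "'f set" where
  "teich = teichmueller ab ` residue_field ab"

lemma teichmueller_props:
  assumes "c \<in> residue_field ab"
  shows "teichmueller ab c \<in> c" "teichmueller ab c ^ resq D = teichmueller ab c"
proof -
  obtain y where y: "c = cls y" "ab y \<le> 1" using assms by (auto simp: residue_field_eq)
  obtain x where x: "ab (x - y) < 1" "x ^ resq D = x" using teichmueller_exists[OF y(2)] by blast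
  have "\<exists>!x. x \<in> c \<and> x ^ card (residue_field ab) = x"
  proof (rule ex1I[of _ x])
    fix z assume z: "z \<in> c \<and> z ^ card (residue_field ab) = z"
    have "ab (z - x) < 1"
      using F.abs_diff_less[of "z - y" 1 "x - y"] x z y by (simp add: cls_def)
    then show "z = x" using teichmueller_unique[of z x] residue_field_memD[OF assms] z x
      by (simp add: resq_def)
  qed (use x y in \<open>simp add: cls_def resq_def\<close>)
  from theI'[OF this] show "teichmueller ab c \<in> c" "teichmueller ab c ^ resq D = teichmueller ab c"
    by (simp_all add: teichmueller_def resq_def)
qed

lemma teich_finite: "finite teich"
  using finite_residue_field by (simp add: teich_def)

lemma teich_card: "card teich = resq D"
proof -
  have "inj_on (teichmueller ab) (residue_field ab)"
    using teichmueller_props(1) residue_field_memD(2) by (metis inj_onI)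
  then show ?thesis by (simp add: teich_def resq_def card_image)
qed

lemma teich_abs: "t \<in> teich \<Longrightarrow> ab t \<le> 1"
  unfolding teich_def using teichmueller_props(1) residue_field_memD(1) by blast

lemma teich_power: "t \<in> teich \<Longrightarrow> t ^ resq D = t"
  unfolding teich_def using teichmueller_props(2) by blast

lemma teich_eqI: "t \<in> teich \<Longrightarrow> t' \<in> teich \<Longrightarrow> ab (t - t') < 1 \<Longrightarrow> t = t'"
  by (rule teichmueller_unique[OF teich_abs teich_power teich_power])

lemma teich_sep: "t \<in> teich \<Longrightarrow> t' \<in> teich \<Longrightarrow> t \<noteq> t' \<Longrightarrow> ab (t - t') = 1"
  using teich_eqI[of t t'] F.abs_diff_le[of t 1 t'] teich_abs by fastforce

lemma teich_approx:
  assumes "ab x \<le> 1"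
  shows "\<exists>t\<in>teich. ab (x - t) < 1"
proof
  show "ab (x - teichmueller ab (cls x)) < 1"
    using teichmueller_props(1)[OF cls_memI[OF assms]] by (simp add: cls_def F.abs_diff_commute)
qed (use assms in \<open>simp add: teich_def cls_memI\<close>)

text \<open>
  The polynomial \<open>(1 + X) ^ q - 1 - X ^ q\<close> of degree less than \<open>q\<close> vanishes on the residue field.
\<close>
lemma prime_dvd_choose_resq:
  assumes "0 < j" "j < resq D"
  shows "prm D dvd (resq D choose j)"
proof -
  define q where "q = resq D"
  define P :: "'f poly" where "P = (\<Sum>i\<in>{0<..<q}. monom (of_nat (q choose i)) i)"
  have val: "poly P t = (1 + t) ^ q - 1 - t ^ q" for t
  proof -
    have "(1 + t) ^ q = (\<Sum>i\<le>q. of_nat (q choose i) * t ^ i)"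
      using binomial_ring[of t 1 q] by (simp add: add.commute)
    also have "{..q} = insert 0 (insert q {0<..<q})" using assms by (auto simp: q_def)
    finally show ?thesis using assms by (simp add: P_def poly_sum poly_monom q_def)
  qed
  have "ab (coeff P j) \<le> ab \<pi>"
  proof (rule F.hermite_bound[of teich _ _ "\<lambda>_. 1"])
    have "degree P < q"
      unfolding P_def using assms
      by (intro degree_sum_less) (auto simp: q_def intro: le_less_trans[OF degree_monom_le])
    then show "degree P < (\<Sum>t\<in>teich. 1)" by (simp add: teich_card q_def)
    fix t and i :: nat assume t: "t \<in> teich" "i < 1"
    have "ab ((1 + t) ^ q - (1 + t)) < 1"
      unfolding q_def using t by (intro fermat F.abs_add_le) (auto simp: teich_abs)
    then have "ab (poly P t) < 1" unfolding val using t by (simp add: teich_power q_def algebra_simps)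
    then show "ab (coeff (pcompose P [:t, 1:]) i) \<le> ab \<pi>" using t less_1_le_unif by simp
  qed (use teich_finite teich_abs teich_sep in auto)
  moreover have "coeff P j = of_nat (q choose j)"
    using assms by (simp add: P_def coeff_sum q_def)
  ultimately have "ab (of_nat (q choose j)) < 1" using unif_less by simp
  then show ?thesis
    using F.abs_of_nat_coprime[OF abs_prime_less] prime_imp_coprime[OF prime] by (fastforce simp: q_def)
qed

section \<open>Truncated Teichmueller expansions\<close>

lemma In_0: "In D 0 = {0}"
  by (simp add: In_def)

lemma In_Suc: "In D (Suc n) = (\<lambda>(x, t). x + \<pi> ^ n * t) ` (In D n \<times> teich)"
proof (intro equalityI subsetI)
  fix y assume "y \<in> In D (Suc n)"
  then obtain \<mu> where \<mu>: "y = (\<Sum>i<Suc n. \<pi> ^ i * teichmueller ab (\<mu> i))"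
      "\<forall>i<Suc n. \<mu> i \<in> residue_field ab" by (auto simp: In_def)
  then have "(\<Sum>i<n. \<pi> ^ i * teichmueller ab (\<mu> i)) \<in> In D n" "teichmueller ab (\<mu> n) \<in> teich"
    by (auto simp: In_def teich_def)
  then show "y \<in> (\<lambda>(x, t). x + \<pi> ^ n * t) ` (In D n \<times> teich)" using \<mu>(1) by force
next
  fix y assume "y \<in> (\<lambda>(x, t). x + \<pi> ^ n * t) ` (In D n \<times> teich)"
  then obtain \<mu> c where y: "y = (\<Sum>i<n. \<pi> ^ i * teichmueller ab (\<mu> i)) + \<pi> ^ n * teichmueller ab c"
    "\<forall>i<n. \<mu> i \<in> residue_field ab" "c \<in> residue_field ab"
    by (auto simp: In_def teich_def)
  then show "y \<in> In D (Suc n)"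
    unfolding In_def by (intro CollectI exI[of _ "\<mu>(n := c)"]) (auto simp: less_Suc_eq)
qed

lemma In_1: "In D 1 = teich"
  using In_Suc[of 0] by (force simp: In_0)

lemma finite_In: "finite (In D n)"
  by (induction n) (simp_all add: In_0 In_Suc teich_finite)

lemma In_abs: "x \<in> In D n \<Longrightarrow> ab x \<le> 1"
proof (induction n arbitrary: x)
  case (Suc n)
  then show ?case using unif_less teich_abs
    by (auto simp: In_Suc intro!: F.abs_add_le F.abs_mult_le1' F.abs_power_le1)
qed (simp add: In_0)

text \<open>The next digit is the representative of (y - x) / \<pi> ^ n. Together with
  \<open>In_eqI\<close> this makes \<open>In D n\<close> a full set of representatives modulo \<pi>
  ^ n.\<close>

lemma In_approx: "ab y \<le> 1 \<Longrightarrow> \<exists>x\<in>In D n. ab (y - x) \<le> ab \<pi> ^ n"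
proof (induction n)
  case (Suc n)
  then obtain x where x: "x \<in> In D n" "ab (y - x) \<le> ab \<pi> ^ n" by blast
  then have "ab ((y - x) / \<pi> ^ n) \<le> 1" using unif_pos by (simp add: F.abs_divide F.abs_power)
  then obtain t where t: "t \<in> teich" "ab ((y - x) / \<pi> ^ n - t) < 1" using teich_approx by blast
  have "ab (\<pi> ^ n * ((y - x) / \<pi> ^ n - t)) \<le> ab \<pi> ^ n * ab \<pi>"
    using less_1_le_unif[OF t(2)] by (intro F.abs_mult_le) (auto simp: F.abs_power)
  moreover have "\<pi> ^ n * ((y - x) / \<pi> ^ n - t) = y - (x + \<pi> ^ n * t)"
    using unif_nonzero by (simp add: field_simps)
  moreover have "x + \<pi> ^ n * t \<in> In D (Suc n)" unfolding In_Suc using x t by force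
  ultimately show ?case by (metis power_Suc2)
qed (simp add: In_0)

lemma In_eqI: "x \<in> In D n \<Longrightarrow> y \<in> In D n \<Longrightarrow> ab (x - y) \<le> ab \<pi> ^ n \<Longrightarrow> x = y"
proof (induction n arbitrary: x y)
  case (Suc n)
  obtain x' t y' s where x: "x = x' + \<pi> ^ n * t" "x' \<in> In D n" "t \<in> teich"
    and y: "y = y' + \<pi> ^ n * s" "y' \<in> In D n" "s \<in> teich"
    using Suc.prems by (auto simp: In_Suc)
  have ts: "ab (\<pi> ^ n * (t - s)) \<le> ab \<pi> ^ n"
    using teich_abs x y by (intro F.abs_mult_le1 F.abs_diff_le) (auto simp: F.abs_power)
  have "ab (x - y) \<le> ab \<pi> ^ n" using Suc.prems(3) unif_power_mono[of n "Suc n"] by linarith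
  then have "ab ((x - y) - \<pi> ^ n * (t - s)) \<le> ab \<pi> ^ n" using ts by (rule F.abs_diff_le)
  then have xy: "x' = y'" using x y by (intro Suc.IH) (auto simp: algebra_simps)
  then have "x - y = \<pi> ^ n * (t - s)" using x y by (simp add: algebra_simps)
  then have "ab \<pi> ^ n * ab (t - s) \<le> ab \<pi> ^ n * ab \<pi>"
    using Suc.prems(3) by (simp add: F.abs_mult F.abs_power mult.commute)
  then have "ab (t - s) < 1" using unif_pos unif_less by simp
  then show ?case using teich_eqI x y xy by simp
qed (simp add: In_0)

end

section \<open>Two by two matrices\<close>

lemma mat2_nth [simp]:
  "mat2 a b c d $ 1 $ 1 = a" "mat2 a b c d $ 1 $ 2 = b" "mat2 a b c d $ 2 $ 1 = c" "mat2 a b c d $ 2 $ 2 = d"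
  by (simp_all add: mat2_def)

lemma mat2_eqI:
  "A $ 1 $ 1 = B $ 1 $ 1 \<Longrightarrow> A $ 1 $ 2 = B $ 1 $ 2 \<Longrightarrow> A $ 2 $ 1 = B $ 2 $ 1 \<Longrightarrow> A $ 2 $ 2 = B $ 2 $ 2 \<Longrightarrow> A = B"
  for A B :: "'a^2^2"
  by (simp add: vec_eq_iff forall_2)

lemma mat2_mult_nth: "(A ** B) $ i $ j = A $ i $ 1 * B $ 1 $ j + A $ i $ 2 * B $ 2 $ j"
  for A B :: "'a::semiring_1^2^2"
  by (simp add: matrix_matrix_mult_def sum_2)

lemma mat_scalar_nth:
  "(mat c :: 'a::zero^2^2) $ 1 $ 1 = c" "(mat c :: 'a^2^2) $ 1 $ 2 = 0"
  "(mat c :: 'a^2^2) $ 2 $ 1 = 0" "(mat c :: 'a^2^2) $ 2 $ 2 = c"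
  by (simp_all add: mat_def)

lemmas mat2_simps = mat2_mult_nth mat_scalar_nth det_2

lemma det_mult2: "det (A ** B) = det A * det B" for A B :: "'a::comm_ring_1^2^2"
  by (simp add: mat2_simps algebra_simps)

lemma GL2_UNIV_iff: "g \<in> GL2 UNIV \<longleftrightarrow> det g \<noteq> 0" for g :: "'a::field^2^2"
  by (simp add: GL2_def invertible_det_nz[symmetric] invertible_def)

lemma matrix_inv_mult:
  fixes g :: "'a::field^2^2"
  assumes "det g \<noteq> 0"
  shows "g ** matrix_inv g = mat 1" "matrix_inv g ** g = mat 1"
    "A ** g ** matrix_inv g = A" "A ** matrix_inv g ** g = A"
proof -
  have ex: "\<exists>A. g ** A = mat 1 \<and> A ** g = mat 1"
    using assms by (simp add: invertible_det_nz[symmetric] invertible_def)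
  show 1: "g ** matrix_inv g = mat 1" and 2: "matrix_inv g ** g = mat 1"
    unfolding matrix_inv_def using someI_ex[OF ex] by auto
  show "A ** g ** matrix_inv g = A" "A ** matrix_inv g ** g = A"
    by (simp_all add: matrix_mul_assoc[symmetric] 1 2)
qed

lemma matrix_inv_eqI:
  fixes g :: "'a::field^2^2"
  assumes "g ** h = mat 1"
  shows "matrix_inv g = h"
proof -
  have "det g * det h = 1" using arg_cong[OF assms, of det] by (simp add: det_mult2)
  then have g: "det g \<noteq> 0" by auto
  have "matrix_inv g = matrix_inv g ** (g ** h)" by (simp add: assms)
  also have "\<dots> = h" by (simp add: matrix_mul_assoc matrix_inv_mult[OF g])
  finally show ?thesis .
qed

lemma matrix_inv_eq:
  fixes g :: "'a::field^2^2"
  assumes "det g \<noteq> 0"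
  shows "matrix_inv g = mat2 (g $ 2 $ 2 / det g) (- (g $ 1 $ 2) / det g) (- (g $ 2 $ 1) / det g) (g $ 1 $ 1 / det g)"
proof (rule matrix_inv_eqI, rule mat2_eqI)
qed (use assms in \<open>simp_all add: mat2_mult_nth mat_scalar_nth diff_divide_distrib[symmetric] det_2 mult.commute\<close>)

lemma det_matrix_inv:
  fixes g :: "'a::field^2^2"
  assumes "det g \<noteq> 0"
  shows "det (matrix_inv g) = inverse (det g)"
proof -
  have "det g * det (matrix_inv g) = 1"
    using arg_cong[OF matrix_inv_mult(1)[OF assms], of det] by (simp add: det_mult2)
  then show ?thesis by (simp add: inverse_unique)
qed

lemma matrix_inv_matrix_inv: "det g \<noteq> 0 \<Longrightarrow> matrix_inv (matrix_inv g) = g" for g :: "'a::field^2^2"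
  by (rule matrix_inv_eqI) (rule matrix_inv_mult)

lemma matrix_inv_prod:
  fixes g h :: "'a::field^2^2"
  assumes "det g \<noteq> 0" "det h \<noteq> 0"
  shows "matrix_inv (g ** h) = matrix_inv h ** matrix_inv g"
  using assms by (intro matrix_inv_eqI) (simp add: matrix_mul_assoc matrix_inv_mult)

lemma center_GL2_iff: "z \<in> center_GL2 \<longleftrightarrow> (\<exists>c. c \<noteq> 0 \<and> z = mat c)" for z :: "'a::field^2^2"
proof
  assume "z \<in> center_GL2"
  then have z: "det z \<noteq> 0" and comm: "\<And>g. det g \<noteq> 0 \<Longrightarrow> z ** g = g ** z"
    by (auto simp: center_GL2_def GL2_UNIV_iff)
  have "z ** mat2 1 1 0 1 = mat2 1 1 0 1 ** z" by (rule comm) (simp add: det_2)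
  then have 1: "z $ 2 $ 1 = 0" "z $ 1 $ 1 = z $ 2 $ 2"
    by (simp_all add: vec_eq_iff forall_2 mat2_mult_nth)
  have "z ** mat2 1 0 1 1 = mat2 1 0 1 1 ** z" by (rule comm) (simp add: det_2)
  then have 2: "z $ 1 $ 2 = 0"
    by (simp add: vec_eq_iff forall_2 mat2_mult_nth)
  have "z = mat (z $ 1 $ 1)" by (rule mat2_eqI) (simp_all add: mat_scalar_nth 1 2)
  moreover have "z $ 1 $ 1 \<noteq> 0" using z 1 2 by (simp add: det_2)
  ultimately show "\<exists>c. c \<noteq> 0 \<and> z = mat c" by blast
next
  assume "\<exists>c. c \<noteq> 0 \<and> z = mat c"
  then show "z \<in> center_GL2"
    by (auto simp: center_GL2_def GL2_UNIV_iff det_2 mat_scalar_nth intro!: mat2_eqI simp: mat2_mult_nth)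
qed

context nonarch_field
begin

definition mnorm :: "'a^2^2 \<Rightarrow> real" where
  "mnorm g = max (max (\<nu> (g $ 1 $ 1)) (\<nu> (g $ 1 $ 2))) (max (\<nu> (g $ 2 $ 1)) (\<nu> (g $ 2 $ 2)))"

lemma mnorm_le_iff: "mnorm g \<le> B \<longleftrightarrow>
    \<nu> (g $ 1 $ 1) \<le> B \<and> \<nu> (g $ 1 $ 2) \<le> B \<and> \<nu> (g $ 2 $ 1) \<le> B \<and> \<nu> (g $ 2 $ 2) \<le> B"
  by (auto simp: mnorm_def)

lemma mnorm_nth: "\<nu> (g $ i $ j) \<le> mnorm g"
  using exhaust_2[of i] exhaust_2[of j] by (auto simp: mnorm_def)

lemma mnorm_nonneg: "0 \<le> mnorm g"
  using mnorm_nth[of g 1 1] abs_nonneg order_trans by blast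

lemma mnorm_attained: "\<exists>i j. mnorm g = \<nu> (g $ i $ j)"
  unfolding mnorm_def max_def by auto

lemma mnorm_mult: "mnorm (A ** B) \<le> mnorm A * mnorm B"
  unfolding mnorm_le_iff[of "A ** B"] mat2_mult_nth
  by (intro conjI abs_add_le abs_mult_le mnorm_nth)

lemma abs_det_le: "\<nu> (det g) \<le> (mnorm g)\<^sup>2"
  unfolding det_2 power2_eq_square by (intro abs_diff_le abs_mult_le mnorm_nth)

lemma mnorm_pos: "det g \<noteq> 0 \<Longrightarrow> 0 < mnorm g"
  using abs_det_le[of g] abs_pos[of "det g"] mnorm_nonneg[of g]
  by (cases "mnorm g = 0") (auto simp del: abs_pos)

lemma mnorm_matrix_inv:
  assumes "det g \<noteq> 0"
  shows "mnorm (matrix_inv g) = mnorm g / \<nu> (det g)"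
proof -
  have *: "max (a / c) (b / c) = max a b / c" if "0 < c" for a b c :: real
    using that by (simp add: max_def divide_right_mono divide_le_cancel)
  show ?thesis
    unfolding mnorm_def matrix_inv_eq[OF assms] using assms
    by (simp add: abs_divide * max.commute max.left_commute max.assoc)
qed

text \<open>
  For the \<open>p\<close>-adic data this is the absolute value of the uniformizer to the power the distance,
  in the tree, of the vertex of \<open>g\<close> from the root.
\<close>
definition Delta :: "'a^2^2 \<Rightarrow> real" where
  "Delta g = \<nu> (det g) / (mnorm g)\<^sup>2"

lemma Delta_matrix_inv:
  assumes "det g \<noteq> 0"
  shows "Delta (matrix_inv g) = Delta g"
  using assms mnorm_pos[OF assms] unfolding Delta_def det_matrix_inv[OF assms] abs_inverse
  by (simp add: mnorm_matrix_inv power2_eq_square)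

text \<open>When \<open>Delta \<kappa> = 1\<close>, the norm of the inverse is the inverse of the
  norm, so submultiplicativity becomes equality.\<close>

lemma Delta_unimodular_mult:
  assumes "det \<kappa> \<noteq> 0" "Delta \<kappa> = 1" "det g \<noteq> 0"
  shows "Delta (\<kappa> ** g) = Delta g" "Delta (g ** \<kappa>) = Delta g"
proof -
  have pos: "0 < mnorm \<kappa>" using assms(1) by (rule mnorm_pos)
  have k: "\<nu> (det \<kappa>) = (mnorm \<kappa>)\<^sup>2" using assms(2) pos by (simp add: Delta_def)
  have inv: "mnorm (matrix_inv \<kappa>) = inverse (mnorm \<kappa>)"
    using pos by (simp add: mnorm_matrix_inv[OF assms(1)] k power2_eq_square field_simps)
  have 1: "mnorm (\<kappa> ** g) = mnorm \<kappa> * mnorm g"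
  proof (rule antisym[OF mnorm_mult])
    have "mnorm g = mnorm (matrix_inv \<kappa> ** (\<kappa> ** g))"
      using assms by (simp add: matrix_mul_assoc matrix_inv_mult)
    also have "\<dots> \<le> inverse (mnorm \<kappa>) * mnorm (\<kappa> ** g)" unfolding inv[symmetric] by (rule mnorm_mult)
    finally show "mnorm \<kappa> * mnorm g \<le> mnorm (\<kappa> ** g)" using pos by (simp add: field_simps)
  qed
  have 2: "mnorm (g ** \<kappa>) = mnorm \<kappa> * mnorm g"
  proof (rule antisym)
    have "mnorm g = mnorm ((g ** \<kappa>) ** matrix_inv \<kappa>)"
      using assms by (simp add: matrix_inv_mult)
    also have "\<dots> \<le> mnorm (g ** \<kappa>) * inverse (mnorm \<kappa>)" unfolding inv[symmetric] by (rule mnorm_mult)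
    finally show "mnorm \<kappa> * mnorm g \<le> mnorm (g ** \<kappa>)" using pos by (simp add: field_simps)
  qed (use mnorm_mult[of g \<kappa>] in \<open>simp add: mult.commute\<close>)
  show "Delta (\<kappa> ** g) = Delta g" "Delta (g ** \<kappa>) = Delta g"
    using pos by (simp_all add: Delta_def 1 2 det_mult2 abs_mult k power_mult_distrib)
qed

end

section \<open>The tree\<close>

context padic_residue
begin

lemma GL2_OF_iff: "g \<in> GL2 (OF D) \<longleftrightarrow> F.mnorm g \<le> 1 \<and> ab (det g) = 1"
proof
  assume "g \<in> GL2 (OF D)"
  then obtain h where g: "\<And>i j. ab (g $ i $ j) \<le> 1" and h: "\<And>i j. ab (h $ i $ j) \<le> 1" and gh: "g ** h = mat 1"
    by (auto simp: GL2_def OF_def ring_of_integers_def)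
  have le: "F.mnorm g \<le> 1" "F.mnorm h \<le> 1" using g h by (auto simp: F.mnorm_le_iff)
  have "(F.mnorm A)\<^sup>2 \<le> 1" if "F.mnorm A \<le> 1" for A using that F.mnorm_nonneg[of A] by (simp add: power_le_one)
  then have "ab (det g) \<le> 1" "ab (det h) \<le> 1" using F.abs_det_le le order_trans by blast+
  moreover have "ab (det g) * ab (det h) = 1"
    using arg_cong[OF gh, of det] by (simp add: det_mult2 F.abs_mult[symmetric])
  ultimately have "ab (det g) = 1"
    by (metis F.abs_nonneg mult.right_neutral mult_left_le nle_le order_antisym)
  with le show "F.mnorm g \<le> 1 \<and> ab (det g) = 1" by simp
next
  assume g: "F.mnorm g \<le> 1 \<and> ab (det g) = 1"
  then have nz: "det g \<noteq> 0" by auto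
  have "F.mnorm (matrix_inv g) \<le> 1" using g by (simp add: F.mnorm_matrix_inv[OF nz])
  then show "g \<in> GL2 (OF D)"
    using g matrix_inv_mult(1,2)[OF nz] order_trans[OF F.mnorm_nth]
    unfolding GL2_def OF_def ring_of_integers_def by (intro CollectI conjI exI[of _ "matrix_inv g"]) auto
qed

text \<open>Dividing by an entry of largest absolute value brings a matrix with \<open>Delta\<close>
  equal to 1 into \<open>GL2 (OF D)\<close>. From here on membership in KZ is a matter of norms and
  determinants.\<close>

lemma KZ_iff: "g \<in> KZ D \<longleftrightarrow> det g \<noteq> 0 \<and> F.Delta g = 1"
proof
  assume "g \<in> KZ D"
  then obtain \<kappa> c where g: "g = \<kappa> ** mat c" "c \<noteq> 0" "F.mnorm \<kappa> \<le> 1" "ab (det \<kappa>) = 1"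
    by (auto simp: KZ_def center_GL2_iff GL2_OF_iff)
  have "1 \<le> (F.mnorm \<kappa>)\<^sup>2" using F.abs_det_le[of \<kappa>] g by simp
  then have "F.mnorm \<kappa> = 1"
    using g(3) F.mnorm_nonneg[of \<kappa>] mult_left_le[of "F.mnorm \<kappa>" "F.mnorm \<kappa>"]
    by (simp add: power2_eq_square)
  moreover have "F.mnorm (mat c) = ab c" "det (mat c :: 'f^2^2) = c * c"
    by (simp_all add: F.mnorm_def mat_scalar_nth det_2)
  then have "F.Delta (mat c) = 1" using g by (simp add: F.Delta_def power2_eq_square F.abs_mult)
  moreover have "det \<kappa> \<noteq> 0" using g(4) by auto
  ultimately show "det g \<noteq> 0 \<and> F.Delta g = 1"
    using g F.Delta_unimodular_mult[of "mat c" \<kappa>] \<open>det (mat c) = c * c\<close>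
    by (auto simp: det_mult2 F.Delta_def[of \<kappa>])
next
  assume g: "det g \<noteq> 0 \<and> F.Delta g = 1"
  obtain i j where "F.mnorm g = ab (g $ i $ j)" using F.mnorm_attained by blast
  then obtain z where z: "F.mnorm g = ab z" by blast
  have pos: "0 < F.mnorm g" using g F.mnorm_pos by blast
  then have "z \<noteq> 0" using z by auto
  define \<kappa> where "\<kappa> = mat2 (g $ 1 $ 1 / z) (g $ 1 $ 2 / z) (g $ 2 $ 1 / z) (g $ 2 $ 2 / z)"
  have "g = \<kappa> ** mat z"
    using \<open>z \<noteq> 0\<close> by (intro mat2_eqI) (simp_all add: mat2_mult_nth mat_scalar_nth \<kappa>_def)
  moreover have "\<kappa> \<in> GL2 (OF D)"
  proof -
    have "F.mnorm \<kappa> \<le> 1"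
      using F.mnorm_nth[of g] pos z by (simp add: F.mnorm_le_iff \<kappa>_def F.abs_divide)
    moreover have "det \<kappa> = det g / z\<^sup>2" using \<open>z \<noteq> 0\<close> by (simp add: \<kappa>_def det_2 power2_eq_square field_simps)
    then have "ab (det \<kappa>) = 1"
      using g pos by (simp add: F.abs_divide F.Delta_def z F.abs_power)
    ultimately show ?thesis by (simp add: GL2_OF_iff)
  qed
  ultimately show "g \<in> KZ D" using \<open>z \<noteq> 0\<close> by (auto simp: KZ_def center_GL2_iff)
qed

lemma KZ_det: "\<kappa> \<in> KZ D \<Longrightarrow> det \<kappa> \<noteq> 0"
  by (simp add: KZ_iff)

lemma KZ_mult: "\<kappa> \<in> KZ D \<Longrightarrow> \<kappa>' \<in> KZ D \<Longrightarrow> \<kappa> ** \<kappa>' \<in> KZ D"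
  by (simp add: KZ_iff F.Delta_unimodular_mult det_mult2)

lemma KZ_inv: "\<kappa> \<in> KZ D \<Longrightarrow> matrix_inv \<kappa> \<in> KZ D"
  by (simp add: KZ_iff F.Delta_matrix_inv det_matrix_inv)

lemma KZ_mult_left_iff:
  assumes "\<kappa> \<in> KZ D"
  shows "\<kappa> ** g \<in> KZ D \<longleftrightarrow> g \<in> KZ D"
  using assms by (auto simp: KZ_iff F.Delta_unimodular_mult det_mult2)

lemma KZ_mult_right_iff:
  assumes "\<kappa> \<in> KZ D"
  shows "g ** \<kappa> \<in> KZ D \<longleftrightarrow> g \<in> KZ D"
  using assms by (auto simp: KZ_iff F.Delta_unimodular_mult det_mult2)

lemma KZ_Delta_mult:
  assumes "\<kappa> \<in> KZ D" "det g \<noteq> 0"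
  shows "F.Delta (\<kappa> ** g) = F.Delta g" "F.Delta (g ** \<kappa>) = F.Delta g"
  using assms by (auto simp: KZ_iff F.Delta_unimodular_mult)

lemma KZ_mat: "c \<noteq> 0 \<Longrightarrow> mat c \<in> KZ D"
  unfolding KZ_def center_GL2_iff
  by (rule CollectI, rule exI[of _ "mat 1"], rule exI[of _ "mat c"])
    (auto simp: GL2_OF_iff F.mnorm_def mat_scalar_nth det_2)

lemma KZ_unitriangular: "ab x \<le> 1 \<Longrightarrow> mat2 1 x 0 1 \<in> KZ D"
  by (simp add: KZ_iff F.Delta_def F.mnorm_def det_2 max_def)

lemma KZ_swap: "mat2 0 1 1 0 \<in> KZ D"
  by (simp add: KZ_iff F.Delta_def F.mnorm_def det_2)

lemma Delta_eq_of_mem: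
  assumes "h ** g \<in> KZ D"
  shows "F.Delta h = F.Delta g" "det h \<noteq> 0" "det g \<noteq> 0"
proof -
  show nz: "det h \<noteq> 0" "det g \<noteq> 0" using KZ_det[OF assms] by (auto simp: det_mult2)
  have "F.Delta g = F.Delta (matrix_inv h ** (h ** g))" using nz by (simp add: matrix_mul_assoc matrix_inv_mult)
  also have "\<dots> = F.Delta h"
    using nz by (simp add: KZ_Delta_mult[OF assms] det_matrix_inv F.Delta_matrix_inv)
  finally show "F.Delta h = F.Delta g" by simp
qed

section \<open>Standard representatives of the vertices\<close>

lemma det_g0: "det (g0 D n \<mu>) = \<pi> ^ n" and det_g1: "det (g1 D n \<mu>) = \<pi> ^ (n + 1)"
  by (simp_all add: g0_def g1_def det_2)

lemma det_g_nonzero: "det (g0 D n \<mu>) \<noteq> 0" "det (g1 D n \<mu>) \<noteq> 0"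
  using unif_nonzero by (simp_all add: det_g0 det_g1)

lemma Delta_g0: "ab \<mu> \<le> 1 \<Longrightarrow> F.Delta (g0 D n \<mu>) = ab \<pi> ^ n"
  and Delta_g1: "ab \<mu> \<le> 1 \<Longrightarrow> F.Delta (g1 D n \<mu>) = ab \<pi> ^ (n + 1)"
proof -
  have le: "ab \<pi> ^ m \<le> 1" for m using unif_power_mono[of 0 m] by simp
  assume "ab \<mu> \<le> 1"
  then have "ab (\<pi> * \<mu>) \<le> 1" using unif_less by (intro F.abs_mult_le1') auto
  then have "F.mnorm (g0 D n \<mu>) = 1" "F.mnorm (g1 D n \<mu>) = 1"
    using le[of n] le[of "n + 1"] \<open>ab \<mu> \<le> 1\<close>
    unfolding F.mnorm_def g0_def g1_def mat2_nth F.abs_power by (auto simp: max_def)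
  then show "F.Delta (g0 D n \<mu>) = ab \<pi> ^ n" "F.Delta (g1 D n \<mu>) = ab \<pi> ^ (n + 1)"
    by (simp_all add: F.Delta_def det_g0 det_g1 F.abs_power F.abs_mult)
qed

lemma KZ_I:
  assumes "det g \<noteq> 0" "F.mnorm g \<le> B" "ab (det g) = B\<^sup>2"
  shows "g \<in> KZ D"
proof -
  have "(F.mnorm g)\<^sup>2 \<le> B\<^sup>2" using assms(2) F.mnorm_nonneg by (intro power_mono)
  then have "(F.mnorm g)\<^sup>2 = B\<^sup>2" using F.abs_det_le[of g] assms(3) by simp
  moreover have "B \<noteq> 0" using assms(1,3) by auto
  ultimately show ?thesis using assms by (simp add: KZ_iff F.Delta_def)
qed

lemma Delta_power:
  assumes "det h \<noteq> 0"
  shows "\<exists>n. F.Delta h = ab \<pi> ^ n"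
proof -
  obtain i j where "F.mnorm h = ab (h $ i $ j)" using F.mnorm_attained by blast
  then obtain z where z: "F.mnorm h = ab z" by blast
  have "z \<noteq> 0" using F.mnorm_pos[OF assms] z by auto
  have "F.Delta h = ab (det h / z\<^sup>2)" by (simp add: F.Delta_def z F.abs_divide F.abs_power)
  moreover have "ab (det h / z\<^sup>2) \<le> 1"
    using F.abs_det_le[of h] z \<open>z \<noteq> 0\<close> by (simp add: F.abs_divide F.abs_power)
  ultimately show ?thesis using abs_eq_unif_power[of "det h / z\<^sup>2"] assms \<open>z \<noteq> 0\<close> by simp
qed

text \<open>Column reduction. If the first column of h attains the norm B, adding \<mu> times it to
  the second column brings that one down to size |\<pi>| ^ n B, which is also the size of \<pi> ^ n
  times the first; the determinant then forces membership in KZ. Otherwise the second column attains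
  B and the roles are exchanged.\<close>

lemma tree_exists:
  assumes "det h \<noteq> 0" "F.Delta h = ab \<pi> ^ n"
  shows "(\<exists>\<mu>\<in>In D n. h ** g0 D n \<mu> \<in> KZ D) \<or> (n > 0 \<and> (\<exists>\<mu>\<in>In D (n - 1). h ** g1 D (n - 1) \<mu> \<in> KZ D))"
proof -
  define B where "B = F.mnorm h"
  have B: "0 < B" using F.mnorm_pos[OF assms(1)] by (simp add: B_def)
  have det: "ab (det h) = ab \<pi> ^ n * B\<^sup>2" using assms(2) B by (simp add: F.Delta_def B_def field_simps)
  obtain a b c d where abcd: "h = mat2 a b c d" by (metis mat2_eqI mat2_nth)
  have dh: "det h = a * d - b * c" by (simp add: abcd det_2)
  have le: "ab a \<le> B" "ab b \<le> B" "ab c \<le> B" "ab d \<le> B"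
    using F.mnorm_nth[of h 1 1] F.mnorm_nth[of h 1 2] F.mnorm_nth[of h 2 1] F.mnorm_nth[of h 2 2]
    by (simp_all add: B_def abcd)
  have pn: "ab \<pi> ^ n \<le> 1" using unif_power_mono[of 0 n] by simp
  show ?thesis
  proof (cases "ab a = B \<or> ab c = B")
    case True
    \<comment> \<open>The exact solution clears one entry of the second column and turns the other
      into the determinant over the pivot, up to sign. Rounding to \<open>In D n\<close> afterwards
      stays within the bound.\<close>
    have "\<exists>\<mu>. ab \<mu> \<le> 1 \<and> ab (a * \<mu> + b) \<le> ab \<pi> ^ n * B \<and> ab (c * \<mu> + d) \<le> ab \<pi> ^ n * B"
    proof (cases "ab a = B")
      case True
      then have "a \<noteq> 0" using B by auto
      have e: "c * (- b / a) + d = det h / a" using \<open>a \<noteq> 0\<close> by (simp add: dh field_simps)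
      have "ab (det h / a) = ab \<pi> ^ n * B"
        using det True B by (simp add: F.abs_divide power2_eq_square)
      moreover have "ab (- b / a) \<le> 1" using le B True by (simp add: F.abs_divide)
      ultimately show ?thesis
        using \<open>a \<noteq> 0\<close> B e by (intro exI[of _ "- b / a"]) auto
    next
      case False
      then have cB: "ab c = B" using True by simp
      then have "c \<noteq> 0" using B by auto
      have e: "a * (- d / c) + b = - det h / c" using \<open>c \<noteq> 0\<close> by (simp add: dh field_simps)
      have "ab (- det h / c) = ab \<pi> ^ n * B"
        using det cB B by (simp add: F.abs_divide power2_eq_square)
      moreover have "ab (- d / c) \<le> 1" using le B cB by (simp add: F.abs_divide)
      ultimately show ?thesis
        using \<open>c \<noteq> 0\<close> B e by (intro exI[of _ "- d / c"]) auto
    qed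
    then obtain \<mu>' where \<mu>': "ab \<mu>' \<le> 1" "ab (a * \<mu>' + b) \<le> ab \<pi> ^ n * B" "ab (c * \<mu>' + d) \<le> ab \<pi> ^ n * B"
      by blast
    obtain \<mu> where \<mu>: "\<mu> \<in> In D n" "ab (\<mu>' - \<mu>) \<le> ab \<pi> ^ n" using In_approx[OF \<mu>'(1)] by blast
    have move: "ab (x * \<mu> + y) \<le> ab \<pi> ^ n * B" if "ab x \<le> B" "ab (x * \<mu>' + y) \<le> ab \<pi> ^ n * B" for x y
    proof -
      have "ab ((\<mu>' - \<mu>) * x) \<le> ab \<pi> ^ n * B" using \<mu>(2) that(1) by (rule F.abs_mult_le)
      then have "ab ((x * \<mu>' + y) - (\<mu>' - \<mu>) * x) \<le> ab \<pi> ^ n * B" by (rule F.abs_diff_le[OF that(2)])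
      then show ?thesis by (simp add: algebra_simps)
    qed
    have "h ** g0 D n \<mu> \<in> KZ D"
    proof (rule KZ_I)
      show "det (h ** g0 D n \<mu>) \<noteq> 0" using assms(1) det_g_nonzero by (simp add: det_mult2)
      have "ab (x * \<pi> ^ n) \<le> ab \<pi> ^ n * B" if "ab x \<le> B" for x
        using F.abs_mult_le[OF that, of "\<pi> ^ n" "ab \<pi> ^ n"] by (simp add: F.abs_power mult.commute)
      then show "F.mnorm (h ** g0 D n \<mu>) \<le> ab \<pi> ^ n * B"
        unfolding F.mnorm_le_iff abcd g0_def mat2_mult_nth mat2_nth
        using move[of a b] move[of c d] le \<mu>' by simp
      show "ab (det (h ** g0 D n \<mu>)) = (ab \<pi> ^ n * B)\<^sup>2"
        by (simp add: det_mult2 F.abs_mult det det_g0 F.abs_power power2_eq_square)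
    qed
    then show ?thesis using \<mu>(1) by blast
  next
    case False
    then have lt: "ab a < B" "ab c < B" using le by auto
    \<comment> \<open>For n = 0 the determinant has absolute value B ^ 2, impossible when the first
      column is strictly below B.\<close>
    have npos: "n > 0"
    proof (rule ccontr)
      assume "\<not> n > 0"
      then have "ab (det h) = B * B" using det by (simp add: power2_eq_square)
      moreover have "ab (a * d) < B * B" "ab (b * c) < B * B"
      proof -
        have "ab (x * y) < B * B" if "ab x < B" "ab y \<le> B" for x y
        proof -
          have "ab (x * y) \<le> ab x * B" unfolding F.abs_mult using that by (intro mult_left_mono) auto
          also have "\<dots> < B * B" using that B by (intro mult_strict_right_mono)
          finally show ?thesis .
        qed
        from this[of a d] this[of c b] show "ab (a * d) < B * B" "ab (b * c) < B * B"
          using lt le by (auto simp: mult.commute)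
      qed
      ultimately show False using F.abs_diff_less[of "a * d" "B * B" "b * c"] by (simp add: dh)
    qed
    then obtain m where m: "n = Suc m" by (cases n) auto
    have B': "ab b = B \<or> ab d = B"
      using lt unfolding B_def F.mnorm_def abcd mat2_nth by (auto simp: max_def split: if_splits)
    \<comment> \<open>The multiplier in \<open>g1\<close> is \<pi> * \<mu>. Its factor \<pi> comes
      from discreteness, the first column being strictly below B; it also explains why one digit
      less, m = n - 1, is enough.\<close>
    have small: "ab (x / (\<pi> * y)) \<le> 1" if "ab x < B" "ab y = B" for x y
    proof -
      have "ab (x / y) < 1" using that B by (simp add: F.abs_divide)
      then have "ab (x / y) \<le> ab \<pi>" by (rule less_1_le_unif)
      then show ?thesis using unif_pos that B by (simp add: F.abs_divide F.abs_mult field_simps)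
    qed
    have "\<exists>\<mu>. ab \<mu> \<le> 1 \<and> ab (a + b * (\<pi> * \<mu>)) \<le> ab \<pi> ^ n * B \<and> ab (c + d * (\<pi> * \<mu>)) \<le> ab \<pi> ^ n * B"
    proof (cases "ab b = B")
      case True
      then have "b \<noteq> 0" using B by auto
      have e: "c + d * (\<pi> * (- a / (\<pi> * b))) = - det h / b" using \<open>b \<noteq> 0\<close> unif_nonzero by (simp add: dh field_simps)
      have "ab (- det h / b) = ab \<pi> ^ n * B"
        using det True B by (simp add: F.abs_divide power2_eq_square)
      moreover have "ab (- a / (\<pi> * b)) \<le> 1" using small[of "- a" b] lt True by simp
      ultimately show ?thesis
        using \<open>b \<noteq> 0\<close> B e unif_nonzero by (intro exI[of _ "- a / (\<pi> * b)"]) auto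
    next
      case False
      then have dB: "ab d = B" using B' by simp
      then have "d \<noteq> 0" using B by auto
      have e: "a + b * (\<pi> * (- c / (\<pi> * d))) = det h / d" using \<open>d \<noteq> 0\<close> unif_nonzero by (simp add: dh field_simps)
      have "ab (det h / d) = ab \<pi> ^ n * B"
        using det dB B by (simp add: F.abs_divide power2_eq_square)
      moreover have "ab (- c / (\<pi> * d)) \<le> 1" using small[of "- c" d] lt dB by simp
      ultimately show ?thesis
        using \<open>d \<noteq> 0\<close> B e unif_nonzero by (intro exI[of _ "- c / (\<pi> * d)"]) auto
    qed
    then obtain \<mu>' where \<mu>': "ab \<mu>' \<le> 1" "ab (a + b * (\<pi> * \<mu>')) \<le> ab \<pi> ^ n * B" "ab (c + d * (\<pi> * \<mu>')) \<le> ab \<pi> ^ n * B"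
      by blast
    obtain \<mu> where \<mu>: "\<mu> \<in> In D m" "ab (\<mu>' - \<mu>) \<le> ab \<pi> ^ m" using In_approx[OF \<mu>'(1)] by blast
    have move: "ab (x + y * (\<pi> * \<mu>)) \<le> ab \<pi> ^ n * B" if "ab y \<le> B" "ab (x + y * (\<pi> * \<mu>')) \<le> ab \<pi> ^ n * B" for x y
    proof -
      have "ab (\<pi> * (\<mu>' - \<mu>) * y) \<le> ab \<pi> * ab \<pi> ^ m * B"
        using \<mu>(2) that(1) by (intro F.abs_mult_le) auto
      then have "ab ((x + y * (\<pi> * \<mu>')) - \<pi> * (\<mu>' - \<mu>) * y) \<le> ab \<pi> ^ n * B"
        by (intro F.abs_diff_le[OF that(2)]) (simp add: m)
      then show ?thesis by (simp add: algebra_simps)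
    qed
    have "h ** g1 D m \<mu> \<in> KZ D"
    proof (rule KZ_I)
      show "det (h ** g1 D m \<mu>) \<noteq> 0" using assms(1) det_g_nonzero by (simp add: det_mult2)
      have "ab (x * \<pi> ^ n) \<le> ab \<pi> ^ n * B" if "ab x \<le> B" for x
        using F.abs_mult_le[OF that, of "\<pi> ^ n" "ab \<pi> ^ n"] by (simp add: F.abs_power mult.commute)
      then show "F.mnorm (h ** g1 D m \<mu>) \<le> ab \<pi> ^ n * B"
        unfolding F.mnorm_le_iff abcd g1_def mat2_mult_nth mat2_nth
        using move[of b a] move[of d c] le \<mu>' m by simp
      show "ab (det (h ** g1 D m \<mu>)) = (ab \<pi> ^ n * B)\<^sup>2"
        using m by (simp add: det_mult2 F.abs_mult det det_g1 F.abs_power power2_eq_square)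
    qed
    then show ?thesis using \<mu>(1) npos m by auto
  qed
qed

lemma quotient_mem:
  fixes g g' h :: "'f^2^2"
  assumes "h ** g \<in> KZ D" "h ** g' \<in> KZ D"
  shows "matrix_inv g ** g' \<in> KZ D"
proof -
  have "matrix_inv g ** g' = matrix_inv (h ** g) ** (h ** g')"
    using Delta_eq_of_mem[OF assms(1)] by (simp add: matrix_inv_prod matrix_mul_assoc matrix_inv_mult)
  then show ?thesis using KZ_mult[OF KZ_inv[OF assms(1)] assms(2)] by simp
qed

text \<open>Two representatives of one vertex differ by an element of KZ whose determinant is a
  unit, hence by an integral matrix. An off-diagonal entry (\<mu>' - \<mu>) / \<pi> ^ n then forces
  equality; across the two families an entry would be a unit divided by \<pi> ^ n with n >
  0.\<close>

lemma tree_unique: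
  fixes g g' h :: "'f^2^2"
  assumes "h ** g \<in> KZ D" "h ** g' \<in> KZ D"
  shows "g = g0 D n \<mu> \<Longrightarrow> g' = g0 D m \<mu>' \<Longrightarrow> \<mu> \<in> In D n \<Longrightarrow> \<mu>' \<in> In D m \<Longrightarrow> n = m \<and> \<mu> = \<mu>'"
    and "g = g1 D n \<mu> \<Longrightarrow> g' = g1 D m \<mu>' \<Longrightarrow> \<mu> \<in> In D n \<Longrightarrow> \<mu>' \<in> In D m \<Longrightarrow> n = m \<and> \<mu> = \<mu>'"
    and "g = g0 D n \<mu> \<Longrightarrow> g' = g1 D m \<mu>' \<Longrightarrow> \<mu> \<in> In D n \<Longrightarrow> \<mu>' \<in> In D m \<Longrightarrow> False"
proof -
  have q: "matrix_inv g ** g' \<in> KZ D" by (rule quotient_mem[OF assms])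
  have nz: "det g \<noteq> 0" "det g' \<noteq> 0" using Delta_eq_of_mem assms by blast+
  have D: "F.Delta g = F.Delta g'" using Delta_eq_of_mem(1) assms by metis
  have entry: "ab ((matrix_inv g ** g') $ i $ j) \<le> 1" if "ab (det g) = ab (det g')" for i j
  proof -
    have "ab (det (matrix_inv g ** g')) = 1"
      using that nz by (simp add: det_mult2 det_matrix_inv F.abs_mult F.abs_inverse)
    then have "(F.mnorm (matrix_inv g ** g'))\<^sup>2 = 1"
      using q F.mnorm_pos[of "matrix_inv g ** g'"] by (simp add: KZ_iff F.Delta_def field_simps)
    then have "F.mnorm (matrix_inv g ** g') = 1"
      using F.mnorm_nonneg[of "matrix_inv g ** g'"] by (auto simp: power2_eq_1_iff)
    then show ?thesis using F.mnorm_nth by metis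
  qed
  show "n = m \<and> \<mu> = \<mu>'" if g: "g = g0 D n \<mu>" "g' = g0 D m \<mu>'" and \<mu>: "\<mu> \<in> In D n" "\<mu>' \<in> In D m"
  proof -
    have "n = m" using D g \<mu> by (simp add: Delta_g0 In_abs unif_power_inject)
    have "(matrix_inv g ** g') $ 1 $ 2 = (\<mu>' - \<mu>) / \<pi> ^ n"
      unfolding matrix_inv_eq[OF nz(1)] mat2_mult_nth mat2_nth
      unfolding g det_g0 by (simp add: g0_def diff_divide_distrib)
    moreover have "ab (det g) = ab (det g')" using g \<open>n = m\<close> by (simp add: det_g0)
    ultimately have "ab ((\<mu>' - \<mu>) / \<pi> ^ n) \<le> 1" using entry by metis
    then have "ab (\<mu>' - \<mu>) \<le> ab \<pi> ^ n" using unif_pos by (simp add: F.abs_divide F.abs_power)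
    then show ?thesis using In_eqI[of \<mu>' n \<mu>] \<mu> \<open>n = m\<close> by simp
  qed
  show "n = m \<and> \<mu> = \<mu>'" if g: "g = g1 D n \<mu>" "g' = g1 D m \<mu>'" and \<mu>: "\<mu> \<in> In D n" "\<mu>' \<in> In D m"
  proof -
    have "n = m" using D g \<mu> unif_power_inject[of "n + 1" "m + 1"] by (simp add: Delta_g1 In_abs)
    have "(matrix_inv g ** g') $ 2 $ 1 = \<pi> * (\<mu>' - \<mu>) / \<pi> ^ (n + 1)"
      unfolding matrix_inv_eq[OF nz(1)] mat2_mult_nth mat2_nth
      unfolding g det_g1 using unif_nonzero by (simp add: g1_def field_simps)
    moreover have "ab (det g) = ab (det g')" using g \<open>n = m\<close> by (simp add: det_g1)
    ultimately have "ab (\<pi> * (\<mu>' - \<mu>) / \<pi> ^ (n + 1)) \<le> 1" using entry by metis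
    then have "ab (\<mu>' - \<mu>) \<le> ab \<pi> ^ n" using unif_pos by (simp add: F.abs_divide F.abs_power F.abs_mult)
    then show ?thesis using In_eqI[of \<mu>' n \<mu>] \<mu> \<open>n = m\<close> by simp
  qed
  show False if g: "g = g0 D n \<mu>" "g' = g1 D m \<mu>'" and \<mu>: "\<mu> \<in> In D n" "\<mu>' \<in> In D m"
  proof -
    have n: "n = m + 1" using D g \<mu> unif_power_inject[of n "m + 1"] by (simp add: Delta_g0 Delta_g1 In_abs)
    have "(matrix_inv g ** g') $ 1 $ 1 = (1 - \<mu> * (\<pi> * \<mu>')) / \<pi> ^ n"
      unfolding matrix_inv_eq[OF nz(1)] mat2_mult_nth mat2_nth
      unfolding g det_g0 by (simp add: g0_def g1_def diff_divide_distrib)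
    moreover have "ab (det g) = ab (det g')" using g n by (simp add: det_g0 det_g1)
    ultimately have "ab ((1 - \<mu> * (\<pi> * \<mu>')) / \<pi> ^ n) \<le> 1" using entry by metis
    then have "ab (1 - \<mu> * (\<pi> * \<mu>')) \<le> ab \<pi> ^ n" using unif_pos by (simp add: F.abs_divide F.abs_power)
    also have "\<dots> \<le> ab \<pi> ^ 1" using n by (intro unif_power_mono) simp
    finally have 1: "ab (1 - \<mu> * (\<pi> * \<mu>')) < 1" using unif_less by simp
    have "ab (\<mu> * (\<pi> * \<mu>')) \<le> ab \<pi>"
      using \<mu> by (intro F.abs_mult_le1' F.abs_mult_le1) (auto simp: In_abs)
    then have "ab ((1 - \<mu> * (\<pi> * \<mu>')) + \<mu> * (\<pi> * \<mu>')) < 1"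
      using 1 unif_less by (intro F.abs_add_less) auto
    then show False by simp
  qed
qed

end

section \<open>Evaluation of polynomials in several variables\<close>

abbreviation "lookup \<equiv> Poly_Mapping.lookup"
abbreviation "keys \<equiv> Poly_Mapping.keys"
abbreviation "single \<equiv> Poly_Mapping.single"

lemma poly_mapping_expansion: "P = (\<Sum>m\<in>keys P. single m (lookup P m))"
  by (rule poly_mapping_eqI)
    (simp add: Poly_Mapping.lookup_sum lookup_single when_def sum.delta in_keys_iff)

lemma poly_mapping_mult_expansion:
  "P * Q = (\<Sum>m\<in>keys P. \<Sum>n\<in>keys Q. single (m + n) (lookup P m * lookup Q n))"
  by (subst poly_mapping_expansion[of P], subst poly_mapping_expansion[of Q])
    (simp add: sum_product mult_single)

definition mon_eval :: "('v \<Rightarrow> 'a::comm_semiring_1) \<Rightarrow> ('v \<Rightarrow>\<^sub>0 nat) \<Rightarrow> 'a" where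
  "mon_eval \<theta> m = (\<Prod>v\<in>keys m. \<theta> v ^ lookup m v)"

definition poly_eval :: "('v \<Rightarrow> 'a::comm_semiring_1) \<Rightarrow> (('v \<Rightarrow>\<^sub>0 nat) \<Rightarrow>\<^sub>0 'a) \<Rightarrow> 'a" where
  "poly_eval \<theta> P = (\<Sum>m\<in>keys P. lookup P m * mon_eval \<theta> m)"

lemma mon_eval_superset:
  "finite S \<Longrightarrow> keys m \<subseteq> S \<Longrightarrow> mon_eval \<theta> m = (\<Prod>v\<in>S. \<theta> v ^ lookup m v)"
  unfolding mon_eval_def by (rule prod.mono_neutral_left) (auto simp: in_keys_iff)

lemma mon_eval_add: "mon_eval \<theta> (m + n) = mon_eval \<theta> m * mon_eval \<theta> n"
proof -
  let ?S = "keys m \<union> keys n"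
  have "mon_eval \<theta> (m + n) = (\<Prod>v\<in>?S. \<theta> v ^ lookup (m + n) v)"
    using Poly_Mapping.keys_add[of m n] by (intro mon_eval_superset) auto
  moreover have "mon_eval \<theta> m = (\<Prod>v\<in>?S. \<theta> v ^ lookup m v)"
    by (intro mon_eval_superset) auto
  moreover have "mon_eval \<theta> n = (\<Prod>v\<in>?S. \<theta> v ^ lookup n v)"
    by (intro mon_eval_superset) auto
  ultimately show ?thesis by (simp add: lookup_add power_add prod.distrib)
qed

lemma poly_eval_superset:
  "finite S \<Longrightarrow> keys P \<subseteq> S \<Longrightarrow> poly_eval \<theta> P = (\<Sum>m\<in>S. lookup P m * mon_eval \<theta> m)"
  unfolding poly_eval_def by (rule sum.mono_neutral_left) (auto simp: in_keys_iff)

lemma poly_eval_0: "poly_eval \<theta> 0 = 0"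
  by (simp add: poly_eval_def)

lemma poly_eval_add: "poly_eval \<theta> (P + Q) = poly_eval \<theta> P + poly_eval \<theta> Q"
proof -
  let ?S = "keys P \<union> keys Q"
  have "poly_eval \<theta> (P + Q) = (\<Sum>m\<in>?S. lookup (P + Q) m * mon_eval \<theta> m)"
    using Poly_Mapping.keys_add[of P Q] by (intro poly_eval_superset) auto
  moreover have "poly_eval \<theta> P = (\<Sum>m\<in>?S. lookup P m * mon_eval \<theta> m)"
    by (intro poly_eval_superset) auto
  moreover have "poly_eval \<theta> Q = (\<Sum>m\<in>?S. lookup Q m * mon_eval \<theta> m)"
    by (intro poly_eval_superset) auto
  ultimately show ?thesis by (simp add: lookup_add distrib_right sum.distrib)
qed

lemma poly_eval_sum: "poly_eval \<theta> (sum g A) = (\<Sum>x\<in>A. poly_eval \<theta> (g x))"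
  by (induction A rule: infinite_finite_induct) (simp_all add: poly_eval_add poly_eval_0)

lemma poly_eval_single: "poly_eval \<theta> (single m a) = a * mon_eval \<theta> m"
  by (simp add: poly_eval_def)

lemma poly_eval_mult: "poly_eval \<theta> (P * Q) = poly_eval \<theta> P * poly_eval \<theta> Q"
proof -
  have "poly_eval \<theta> (P * Q) = (\<Sum>m\<in>keys P. \<Sum>n\<in>keys Q.
      (lookup P m * mon_eval \<theta> m) * (lookup Q n * mon_eval \<theta> n))"
    unfolding poly_mapping_mult_expansion[of P Q]
    by (simp add: poly_eval_sum poly_eval_single mon_eval_add mult_ac)
  then show ?thesis by (simp add: poly_eval_def sum_product)
qed

lemma poly_eval_const: "poly_eval \<theta> (const_poly c) = c"
  by (simp add: const_poly_def poly_eval_single mon_eval_def)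

lemma poly_eval_var: "poly_eval \<theta> (var_poly v) = \<theta> v"
  by (simp add: var_poly_def poly_eval_single mon_eval_def)

lemma poly_eval_power: "poly_eval \<theta> (P ^ n) = poly_eval \<theta> P ^ n"
  by (induction n) (simp_all add: poly_eval_mult poly_eval_single mon_eval_def flip: single_one)

lemma poly_eval_prod: "poly_eval \<theta> (prod g A) = (\<Prod>x\<in>A. poly_eval \<theta> (g x))"
  by (induction A rule: infinite_finite_induct)
    (simp_all add: poly_eval_mult poly_eval_single mon_eval_def flip: single_one)

lemma poly_eval_subst:
  "poly_eval \<theta> (subst_poly \<eta> P) = poly_eval (\<lambda>v. poly_eval \<theta> (\<eta> v)) P"
  by (simp add: subst_poly_def poly_eval_sum poly_eval_mult poly_eval_const poly_eval_prod poly_eval_power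
      poly_eval_def[of _ P] mon_eval_def)

lemma lookup_const_mult: "lookup (const_poly c * P) m = c * lookup P m"
proof -
  have "const_poly c * P = (\<Sum>n\<in>keys P. single n (c * lookup P n))"
    by (subst poly_mapping_expansion[of P]) (simp add: const_poly_def sum_distrib_left mult_single)
  then show ?thesis
    by (simp add: Poly_Mapping.lookup_sum lookup_single when_def sum.delta in_keys_iff)
qed

lemma const_poly_mult: "const_poly a * const_poly b = const_poly (a * b)"
  by (simp add: const_poly_def mult_single)

lemma const_poly_1: "const_poly 1 = 1"
  by (simp add: const_poly_def)

context nonarch_field
begin

definition coeffs_le :: "real \<Rightarrow> ('v \<Rightarrow>\<^sub>0 'a) \<Rightarrow> bool" where
  "coeffs_le B P \<longleftrightarrow> (\<forall>m. \<nu> (lookup P m) \<le> B)"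

lemma coeffs_le_add: "coeffs_le B P \<Longrightarrow> coeffs_le B Q \<Longrightarrow> coeffs_le B (P + Q)"
  by (simp add: coeffs_le_def lookup_add abs_add_le)

lemma coeffs_le_sum: "(\<And>x. x \<in> A \<Longrightarrow> coeffs_le B (g x)) \<Longrightarrow> 0 \<le> B \<Longrightarrow> coeffs_le B (sum g A)"
  by (auto simp: coeffs_le_def Poly_Mapping.lookup_sum intro: abs_sum_le)

lemma coeffs_le_single: "\<nu> a \<le> B \<Longrightarrow> coeffs_le B (single m a)"
  by (auto simp: coeffs_le_def lookup_single when_def intro: order_trans[OF abs_nonneg])

lemma coeffs_le_nonneg: "coeffs_le B P \<Longrightarrow> 0 \<le> B"
  unfolding coeffs_le_def using abs_nonneg order_trans by blast

lemma coeffs_le_mult: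
  fixes P Q :: "'v::comm_monoid_add \<Rightarrow>\<^sub>0 'a"
  assumes "coeffs_le A P" "coeffs_le B Q"
  shows "coeffs_le (A * B) (P * Q)"
  unfolding poly_mapping_mult_expansion[of P Q]
  using assms coeffs_le_nonneg[OF assms(1)] coeffs_le_nonneg[OF assms(2)]
  by (intro coeffs_le_sum coeffs_le_single abs_mult_le) (auto simp: coeffs_le_def)

lemma coeffs_le_power:
  fixes P :: "'v::comm_monoid_add \<Rightarrow>\<^sub>0 'a"
  assumes "coeffs_le A P"
  shows "coeffs_le (A ^ n) (P ^ n)"
proof (induction n)
  case 0
  show ?case by (simp add: coeffs_le_single flip: single_one)
qed (simp add: assms coeffs_le_mult)

lemma coeffs_le_const_mult: "coeffs_le B P \<Longrightarrow> coeffs_le (\<nu> c * B) (const_poly c * P)"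
  by (intro coeffs_le_mult) (simp_all add: const_poly_def coeffs_le_single)

end

section \<open>The representation\<close>

text \<open>With a single nonzero weight all other tensor factors consist of constants, and
  \<open>Vk\<close> becomes the space of binary forms of degree k in the variables of
  \<sigma>.\<close>

locale weight_rep = padic_residue D
  for D :: "('q::field_char_0, 'f::field_char_0, 'c::field_char_0) padic_data" +
  fixes \<sigma> :: "'f \<Rightarrow> 'c" and kk :: "('f \<Rightarrow> 'c) \<Rightarrow> nat" and k :: nat
  assumes \<sigma>: "\<sigma> \<in> embeddings D" and kk_\<sigma>: "kk \<sigma> = k"
    and kk_other: "\<And>\<sigma>'. \<sigma>' \<in> embeddings D \<Longrightarrow> \<sigma>' \<noteq> \<sigma> \<Longrightarrow> kk \<sigma>' = 0"
begin

lemmas \<sigma>_hom = field_homD[OF embedding_hom[OF \<sigma>]]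
lemmas \<sigma>_abs = abs_embedding[OF \<sigma>]

abbreviation "s \<equiv> sqrt_unif D \<sigma>"

lemma s_square: "s\<^sup>2 = \<sigma> \<pi>"
  using sqrt_unif \<sigma> by blast

lemma s_nonzero: "s \<noteq> 0"
  using s_square unif_nonzero by (auto simp: \<sigma>_hom)

text \<open>Sums and products over an infinite set are trivial by default. The number of embeddings
  is the degree, nonzero because a basis of F is finite and nonempty, and a nonzero
  \<open>card\<close> implies finiteness.\<close>

lemma finite_embeddings: "finite (embeddings D)"
proof -
  interpret valued_extension "absQ D" "absF D" "embF D" by (rule F_extension)
  have "extension_degree (embF D) \<noteq> 0"
  proof
    assume "extension_degree (embF D) = 0"
    moreover obtain B where B: "B \<subseteq> UNIV" "independent B" "UNIV \<subseteq> span B" "card B = dim UNIV"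
      using basis_exists[of UNIV] by blast
    moreover have "finite B"
    proof -
      obtain B' where "finite B'" "span B' = UNIV" using F_finite by (auto simp: finite_extension_def)
      then show ?thesis using independent_span_bound[of B' B] B by auto
    qed
    ultimately have "B = {}" by (simp add: extension_degree_def)
    with B have "(UNIV :: 'f set) \<subseteq> {0}" by simp
    then show False by (metis UNIV_I singletonD subsetD zero_neq_one)
  qed
  then show ?thesis using card_embeddings by (metis card.infinite)
qed

section \<open>Binary forms and dehomogenisation\<close>

definition Hom :: "nat \<Rightarrow> ('f, 'c) tpoly set" where
  "Hom n = {P. \<forall>m\<in>keys P. keys m \<subseteq> {VX \<sigma>, VY \<sigma>} \<and>
      lookup m (VX \<sigma>) + lookup m (VY \<sigma>) = n}"

definition mon :: "nat \<Rightarrow> (('f \<Rightarrow> 'c) var \<Rightarrow>\<^sub>0 nat)" where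
  "mon i = single (VX \<sigma>) (k - i) + single (VY \<sigma>) i"

lemma lookup_mon: "lookup (mon i) (VX \<sigma>) = k - i" "lookup (mon i) (VY \<sigma>) = i"
  by (simp_all add: mon_def lookup_add lookup_single)

lemma keys_mon: "keys (mon i) \<subseteq> {VX \<sigma>, VY \<sigma>}"
  unfolding mon_def using Poly_Mapping.keys_add by (fastforce split: if_splits)

lemma mon_inject: "mon i = mon j \<longleftrightarrow> i = j"
  using lookup_mon(2) by metis

lemma eq_mon:
  assumes "keys m \<subseteq> {VX \<sigma>, VY \<sigma>}"
    "lookup m (VX \<sigma>) + lookup m (VY \<sigma>) = k"
  shows "m = mon (lookup m (VY \<sigma>))" "lookup m (VY \<sigma>) \<le> k"
proof -
  show "m = mon (lookup m (VY \<sigma>))"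
  proof (rule poly_mapping_eqI)
    fix v
    show "lookup m v = lookup (mon (lookup m (VY \<sigma>))) v"
    proof (cases "v \<in> {VX \<sigma>, VY \<sigma>}")
      case True
      moreover have "k - lookup m (VY \<sigma>) = lookup m (VX \<sigma>)" using assms(2) by simp
      ultimately show ?thesis by (auto simp: lookup_mon)
    next
      case False
      then show ?thesis using assms(1) keys_mon by (metis in_keys_iff subsetD)
    qed
  qed
qed (use assms(2) in simp)

lemma monomials_eq: "monomials D kk = mon ` {..k}"
proof -
  have "(\<Sum>\<sigma>'\<in>embeddings D. single (VX \<sigma>') (kk \<sigma>' - i \<sigma>') + single (VY \<sigma>') (i \<sigma>'))
      = mon (i \<sigma>)" if "\<forall>\<sigma>'\<in>embeddings D. i \<sigma>' \<le> kk \<sigma>'" for i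
  proof -
    have "(\<Sum>\<sigma>'\<in>embeddings D - {\<sigma>}. single (VX \<sigma>') (kk \<sigma>' - i \<sigma>') + single (VY \<sigma>') (i \<sigma>')) = 0"
    proof (intro sum.neutral ballI)
      fix \<sigma>' assume "\<sigma>' \<in> embeddings D - {\<sigma>}"
      then have "kk \<sigma>' = 0" "i \<sigma>' \<le> kk \<sigma>'" using that kk_other by auto
      then show "single (VX \<sigma>') (kk \<sigma>' - i \<sigma>') + single (VY \<sigma>') (i \<sigma>') = 0" by simp
    qed
    then show ?thesis
      using sum.remove[OF finite_embeddings \<sigma>, of "\<lambda>\<sigma>'. single (VX \<sigma>') (kk \<sigma>' - i \<sigma>') + single (VY \<sigma>') (i \<sigma>')"]
      by (simp add: mon_def kk_\<sigma>)
  qed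
  note eq = this
  show ?thesis
  proof (intro equalityI subsetI)
    fix m assume "m \<in> monomials D kk"
    then obtain i where "\<forall>\<sigma>'\<in>embeddings D. i \<sigma>' \<le> kk \<sigma>'" "m = mon (i \<sigma>)"
      unfolding monomials_def using eq by auto
    then show "m \<in> mon ` {..k}" using \<sigma> kk_\<sigma> by auto
  next
    fix m assume "m \<in> mon ` {..k}"
    then obtain j where j: "j \<le> k" "m = mon j" by auto
    let ?i = "\<lambda>\<sigma>'. if \<sigma>' = \<sigma> then j else 0"
    have "\<forall>\<sigma>'\<in>embeddings D. ?i \<sigma>' \<le> kk \<sigma>'" using j kk_\<sigma> by auto
    then show "m \<in> monomials D kk"
      unfolding monomials_def using eq[of ?i] j by (intro CollectI exI[of _ ?i]) simp
  qed
qed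

lemma Vk_eq: "Vk D kk = Hom k"
proof -
  have "m \<in> mon ` {..k} \<longleftrightarrow> keys m \<subseteq> {VX \<sigma>, VY \<sigma>} \<and>
      lookup m (VX \<sigma>) + lookup m (VY \<sigma>) = k" for m
    using eq_mon[of m] keys_mon by (auto simp: lookup_mon)
  then show ?thesis unfolding Vk_def Hom_def monomials_eq by blast
qed

lemma Hom_0_mem [simp]: "0 \<in> Hom n"
  by (simp add: Hom_def)

lemma Hom_single:
  "keys m \<subseteq> {VX \<sigma>, VY \<sigma>} \<Longrightarrow> lookup m (VX \<sigma>) + lookup m (VY \<sigma>) = n \<Longrightarrow>
    single m a \<in> Hom n"
  by (simp add: Hom_def)

lemma Hom_add: "P \<in> Hom n \<Longrightarrow> Q \<in> Hom n \<Longrightarrow> P + Q \<in> Hom n"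
  using Poly_Mapping.keys_add[of P Q] by (auto simp: Hom_def)

lemma Hom_sum: "(\<And>x. x \<in> A \<Longrightarrow> g x \<in> Hom n) \<Longrightarrow> sum g A \<in> Hom n"
  by (induction A rule: infinite_finite_induct) (auto intro: Hom_add)

lemma Hom_mult:
  assumes "P \<in> Hom a" "Q \<in> Hom b"
  shows "P * Q \<in> Hom (a + b)"
  unfolding Hom_def
proof (intro CollectI ballI)
  fix m assume "m \<in> keys (P * Q)"
  then obtain u v where uv: "m = u + v" "u \<in> keys P" "v \<in> keys Q"
    using keys_mult[of P Q] by blast
  then show "keys m \<subseteq> {VX \<sigma>, VY \<sigma>} \<and> lookup m (VX \<sigma>) + lookup m (VY \<sigma>) = a + b"
    using assms Poly_Mapping.keys_add[of u v] unfolding Hom_def by (fastforce simp: lookup_add)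
qed

lemma Hom_const: "const_poly c \<in> Hom 0"
  unfolding const_poly_def by (rule Hom_single) auto

lemma Hom_const_mult: "P \<in> Hom n \<Longrightarrow> const_poly c * P \<in> Hom n"
  using Hom_mult[OF Hom_const] by fastforce

lemma Hom_power: "P \<in> Hom a \<Longrightarrow> P ^ n \<in> Hom (a * n)"
proof (induction n)
  case 0
  then show ?case using Hom_const[of 1] by (simp add: const_poly_1)
next
  case (Suc n)
  then show ?case using Hom_mult[of P a "P ^ n" "a * n"] by simp
qed

definition lin :: "'c \<Rightarrow> 'c \<Rightarrow> ('f, 'c) tpoly" where
  "lin a b = const_poly a * var_poly (VX \<sigma>) + const_poly b * var_poly (VY \<sigma>)"

lemma Hom_lin: "lin a b \<in> Hom 1"
  unfolding lin_def var_poly_def by (intro Hom_add Hom_const_mult Hom_single) (auto simp: lookup_single)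

lemma lin_coeffs: "absC D a \<le> B \<Longrightarrow> absC D b \<le> B \<Longrightarrow> C.coeffs_le B (lin a b)"
  unfolding lin_def const_poly_def var_poly_def mult_single by (intro C.coeffs_le_add C.coeffs_le_single) auto

definition ev :: "('f, 'c) tpoly \<Rightarrow> 'c \<Rightarrow> 'c \<Rightarrow> 'c" where
  "ev P x y = poly_eval (\<lambda>v. case v of VX _ \<Rightarrow> x | VY _ \<Rightarrow> y) P"

lemma mon_eval_Hom:
  assumes "keys m \<subseteq> {VX \<sigma>, VY \<sigma>}"
  shows "mon_eval \<theta> m = \<theta> (VX \<sigma>) ^ lookup m (VX \<sigma>) * \<theta> (VY \<sigma>) ^ lookup m (VY \<sigma>)"
  using mon_eval_superset[OF _ assms] by simp

lemma poly_eval_Hom: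
  assumes "P \<in> Hom k"
  shows "poly_eval \<theta> P = (\<Sum>i\<le>k. lookup P (mon i) * \<theta> (VX \<sigma>) ^ (k - i) * \<theta> (VY \<sigma>) ^ i)"
proof -
  have "keys P \<subseteq> mon ` {..k}" using assms Vk_eq by (auto simp: Vk_def monomials_eq)
  then have "poly_eval \<theta> P = (\<Sum>m\<in>mon ` {..k}. lookup P m * mon_eval \<theta> m)"
    by (intro poly_eval_superset) auto
  also have "\<dots> = (\<Sum>i\<le>k. lookup P (mon i) * mon_eval \<theta> (mon i))"
    by (subst sum.reindex) (auto simp: inj_on_def mon_inject)
  finally show ?thesis by (simp add: mon_eval_Hom[OF keys_mon] lookup_mon mult.assoc)
qed

lemma ev_Hom: "P \<in> Hom k \<Longrightarrow> ev P x y = (\<Sum>i\<le>k. lookup P (mon i) * x ^ (k - i) * y ^ i)"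
  by (simp add: ev_def poly_eval_Hom)

lemma ev_scale:
  assumes "P \<in> Hom k"
  shows "ev P (c * x) (c * y) = c ^ k * ev P x y"
  unfolding ev_Hom[OF assms] sum_distrib_left
proof (intro sum.cong refl)
  fix i assume "i \<in> {..k}"
  then have "c ^ k = c ^ (k - i) * c ^ i" by (simp add: power_add[symmetric])
  then show "lookup P (mon i) * (c * x) ^ (k - i) * (c * y) ^ i =
      c ^ k * (lookup P (mon i) * x ^ (k - i) * y ^ i)"
    by (simp add: power_mult_distrib)
qed

text \<open>The affine coordinate is z = y / x, so the index of a coefficient is the exponent of
  \<open>VY \<sigma>\<close>.\<close>

definition dehom :: "('f, 'c) tpoly \<Rightarrow> 'c poly" where
  "dehom P = (\<Sum>i\<le>k. monom (lookup P (mon i)) i)"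

lemma coeff_dehom: "coeff (dehom P) i = (if i \<le> k then lookup P (mon i) else 0)"
  by (simp add: dehom_def coeff_sum sum.delta)

lemma degree_dehom: "degree (dehom P) \<le> k"
  by (rule degree_le) (simp add: coeff_dehom)

lemma dehom_add: "dehom (P + Q) = dehom P + dehom Q"
  and dehom_diff: "dehom (P - Q) = dehom P - dehom Q"
  and dehom_const_mult: "dehom (const_poly c * P) = smult c (dehom P)"
  and dehom_0: "dehom 0 = 0"
  by (simp_all add: poly_eq_iff coeff_dehom lookup_add lookup_minus lookup_const_mult)

lemma dehom_sum: "dehom (sum g A) = (\<Sum>x\<in>A. dehom (g x))"
  by (induction A rule: infinite_finite_induct) (simp_all add: dehom_add dehom_0)

lemma poly_dehom: "P \<in> Hom k \<Longrightarrow> poly (dehom P) z = ev P 1 z"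
  by (simp add: dehom_def poly_sum poly_monom ev_Hom)

lemma lookup_Hom_eq_0:
  assumes "P \<in> Hom k" "m \<notin> mon ` {..k}"
  shows "lookup P m = 0"
  using assms Vk_eq by (metis (no_types, lifting) CollectD Vk_def in_keys_iff monomials_eq subsetD)

text \<open>A form of known degree is recovered from its restriction to x = 1, and a polynomial over
  an infinite field from its values. Identities for \<open>rho\<close> and \<open>Uk\<close> thus
  reduce to computations with values.\<close>

lemma Hom_eqI:
  assumes "P \<in> Hom k" "Q \<in> Hom k" "\<And>z. ev P 1 z = ev Q 1 z"
  shows "P = Q"
proof -
  have "dehom P = dehom Q"
    using assms by (intro iffD1[OF poly_eq_poly_eq_iff] ext) (simp add: poly_dehom)
  then have eq: "lookup P (mon i) = lookup Q (mon i)" if "i \<le> k" for i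
    using that by (metis coeff_dehom)
  show ?thesis
  proof (rule poly_mapping_eqI)
    fix m
    show "lookup P m = lookup Q m"
    proof (cases "m \<in> mon ` {..k}")
      case True
      then show ?thesis using eq by auto
    next
      case False
      then show ?thesis using lookup_Hom_eq_0 assms(1,2) by simp
    qed
  qed
qed

lemma coeffs_le_iff:
  assumes "P \<in> Hom k" "0 \<le> B"
  shows "C.coeffs_le B P \<longleftrightarrow> (\<forall>i. absC D (coeff (dehom P) i) \<le> B)"
proof
  show "\<forall>i. absC D (coeff (dehom P) i) \<le> B" if "C.coeffs_le B P"
    using that assms(2) by (simp add: C.coeffs_le_def coeff_dehom)
  assume *: "\<forall>i. absC D (coeff (dehom P) i) \<le> B"
  show "C.coeffs_le B P"
    unfolding C.coeffs_le_def
  proof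
    fix m
    show "absC D (lookup P m) \<le> B"
    proof (cases "m \<in> mon ` {..k}")
      case True
      then show ?thesis using * by (metis atMost_iff coeff_dehom imageE)
    next
      case False
      then show ?thesis using lookup_Hom_eq_0[OF assms(1)] assms(2) by simp
    qed
  qed
qed

lemma Vk0_iff: "P \<in> Vk0 D kk \<longleftrightarrow> P \<in> Hom k \<and> C.coeffs_le 1 P"
  by (auto simp: Vk0_def Vk_eq C.coeffs_le_def OC_def ring_of_integers_def)

section \<open>The normalising scalar and integrality under KZ\<close>

definition vdet :: "'f^2^2 \<Rightarrow> int" where
  "vdet g = \<lfloor>real_of_ereal (valF D (det g))\<rfloor>"



lemma vdet_eqI:
  assumes "det g \<noteq> 0" "ab (det g) = ab \<pi> powi n"
  shows "vdet g = n"
proof -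
  have "ln (ab \<pi>) \<noteq> 0" using unif_pos unif_less by simp
  moreover have "ln (ab (det g)) = real_of_int n * ln (ab \<pi>)"
    using assms(2) unif_pos by (simp add: ln_powr flip: powr_real_of_int')
  ultimately show ?thesis using assms(1) by (simp add: vdet_def valF_def)
qed

lemma abs_det_vdet: "det g \<noteq> 0 \<Longrightarrow> ab (det g) = ab \<pi> powi vdet g"
  using abs_eq_unif_powi[of "det g"] vdet_eqI[of g] by auto

lemma vdet_mult: "det g \<noteq> 0 \<Longrightarrow> det h \<noteq> 0 \<Longrightarrow> vdet (g ** h) = vdet g + vdet h"
  using abs_det_vdet[of g] abs_det_vdet[of h] unif_pos
  by (intro vdet_eqI) (auto simp: det_mult2 F.abs_mult power_int_add)

definition crho :: "'f^2^2 \<Rightarrow> 'c" where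
  "crho g = s powi (- vdet g * int k)"

lemma crho_mult: "det g \<noteq> 0 \<Longrightarrow> det h \<noteq> 0 \<Longrightarrow> crho (g ** h) = crho g * crho h"
  using s_nonzero by (simp add: crho_def vdet_mult power_int_add[symmetric] algebra_simps)

lemma prod_sqrt_unif:
  "(\<Prod>\<sigma>'\<in>embeddings D. sqrt_unif D \<sigma>' powi (- \<lfloor>real_of_ereal (valF D (det g))\<rfloor> * int (kk \<sigma>'))) = crho g"
proof -
  have "(\<Prod>\<sigma>'\<in>embeddings D - {\<sigma>}. sqrt_unif D \<sigma>' powi (- \<lfloor>real_of_ereal (valF D (det g))\<rfloor> * int (kk \<sigma>'))) = 1"
    using kk_other by (intro prod.neutral) auto
  then show ?thesis
    using prod.remove[OF finite_embeddings \<sigma>, of "\<lambda>\<sigma>'. sqrt_unif D \<sigma>' powi (- \<lfloor>real_of_ereal (valF D (det g))\<rfloor> * int (kk \<sigma>'))"]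
    by (simp add: crho_def vdet_def kk_\<sigma>)
qed

lemma rho_eq:
  assumes "P \<in> Hom k"
  shows "rho D kk g P = const_poly (crho g) * (\<Sum>m\<in>keys P. const_poly (lookup P m) *
      (lin (\<sigma> (g $ 1 $ 1)) (\<sigma> (g $ 2 $ 1)) ^ lookup m (VX \<sigma>) *
       lin (\<sigma> (g $ 1 $ 2)) (\<sigma> (g $ 2 $ 2)) ^ lookup m (VY \<sigma>)))"
  unfolding rho_def prod_sqrt_unif subst_poly_def mon_eval_def[symmetric]
  using assms by (intro arg_cong2[of _ _ _ _ "(*)"] sum.cong refl) (auto simp: mon_eval_Hom Hom_def lin_def)

lemma rho_Hom:
  assumes "P \<in> Hom k"
  shows "rho D kk g P \<in> Hom k"
  unfolding rho_eq[OF assms]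
proof (intro Hom_const_mult Hom_sum)
  fix m assume "m \<in> keys P"
  then have "lookup m (VX \<sigma>) + lookup m (VY \<sigma>) = k" using assms by (auto simp: Hom_def)
  then show "lin a b ^ lookup m (VX \<sigma>) * lin c d ^ lookup m (VY \<sigma>) \<in> Hom k" for a b c d
    using Hom_mult[OF Hom_power[OF Hom_lin] Hom_power[OF Hom_lin]] by (metis mult_1)
qed

lemma ev_rho:
  assumes "P \<in> Hom k"
  shows "ev (rho D kk g P) x y =
    crho g * ev P (\<sigma> (g $ 1 $ 1) * x + \<sigma> (g $ 2 $ 1) * y) (\<sigma> (g $ 1 $ 2) * x + \<sigma> (g $ 2 $ 2) * y)"
  unfolding ev_def rho_def prod_sqrt_unif
  by (simp add: poly_eval_mult poly_eval_const poly_eval_subst poly_eval_Hom[OF assms] poly_eval_add poly_eval_var)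

lemma rho_mult:
  assumes "P \<in> Hom k" "det g \<noteq> 0" "det h \<noteq> 0"
  shows "rho D kk (g ** h) P = rho D kk g (rho D kk h P)"
  using assms
  by (intro Hom_eqI rho_Hom)
    (simp_all add: ev_rho rho_Hom crho_mult mat2_mult_nth \<sigma>_hom algebra_simps)

lemma ev_const_mult: "ev (const_poly c * P) x y = c * ev P x y"
  by (simp add: ev_def poly_eval_mult poly_eval_const)

lemma rho_const_mult:
  assumes "P \<in> Hom k"
  shows "rho D kk g (const_poly c * P) = const_poly c * rho D kk g P"
  using assms by (intro Hom_eqI rho_Hom Hom_const_mult) (simp_all add: ev_rho ev_const_mult Hom_const_mult)

lemma rho_0: "rho D kk g 0 = 0"
  by (simp add: rho_eq)

lemma rho_1:
  assumes "P \<in> Hom k"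
  shows "rho D kk (mat 1) P = P"
proof -
  have "vdet (mat 1) = 0" by (rule vdet_eqI) auto
  then show ?thesis
    using assms by (intro Hom_eqI rho_Hom) (simp_all add: ev_rho crho_def mat_scalar_nth \<sigma>_hom)
qed

lemma rho_inverse:
  assumes "P \<in> Hom k" "det g \<noteq> 0"
  shows "rho D kk g (rho D kk (matrix_inv g) P) = P" "rho D kk (matrix_inv g) (rho D kk g P) = P"
  using assms rho_1 by (simp_all add: rho_mult[symmetric] matrix_inv_mult det_matrix_inv)

lemma abs_s_square: "(absC D s)\<^sup>2 = ab \<pi>"
  using \<sigma>_abs[of \<pi>] by (simp add: s_square[symmetric] C.abs_power)

text \<open>On KZ the determinant has the size of the square of the norm, so its power of exponent -
  k / 2 offsets degree k in the entries. Squaring first removes the square root of the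
  uniformizer.\<close>

lemma abs_crho_KZ:
  assumes "\<kappa> \<in> KZ D"
  shows "absC D (crho \<kappa>) * F.mnorm \<kappa> ^ k = 1"
proof -
  have pos: "0 < F.mnorm \<kappa>" and N: "ab (det \<kappa>) = (F.mnorm \<kappa>)\<^sup>2"
    using assms F.mnorm_pos by (auto simp: KZ_iff F.Delta_def)
  let ?e = "- vdet \<kappa> * int k"
  have "(absC D (crho \<kappa>))\<^sup>2 = (absC D s)\<^sup>2 powi ?e"
    unfolding crho_def C.abs_powi by (simp only: power_int_power power_int_power' mult.commute)
  also have "\<dots> = ab \<pi> powi ?e" by (simp only: abs_s_square)
  finally have 1: "(absC D (crho \<kappa>))\<^sup>2 = ab \<pi> powi ?e" .
  have "((F.mnorm \<kappa>) ^ k)\<^sup>2 = ((F.mnorm \<kappa>)\<^sup>2) ^ k" by (simp only: power_mult[symmetric] mult.commute)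
  also have "\<dots> = (ab \<pi> powi vdet \<kappa>) ^ k" by (simp only: N[symmetric] abs_det_vdet[OF KZ_det[OF assms]])
  also have "\<dots> = ab \<pi> powi (vdet \<kappa> * int k)" by (rule power_int_power')
  finally have "(absC D (crho \<kappa>) * F.mnorm \<kappa> ^ k)\<^sup>2 = ab \<pi> powi ?e * ab \<pi> powi (vdet \<kappa> * int k)"
    by (simp only: power_mult_distrib 1)
  also have "\<dots> = ab \<pi> powi (?e + vdet \<kappa> * int k)" using unif_pos by (intro power_int_add[symmetric]) simp
  also have "\<dots> = 1" by simp
  finally have "(absC D (crho \<kappa>) * F.mnorm \<kappa> ^ k)\<^sup>2 = 1" .
  moreover have "0 \<le> absC D (crho \<kappa>) * F.mnorm \<kappa> ^ k" using pos by simp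
  ultimately show ?thesis by (metis one_power2 power2_eq_iff_nonneg zero_le_one)
qed

text \<open>The substitution enlarges coefficients by at most \<open>F.mnorm \<kappa> ^ k\<close>,
  which the scalar compensates; so KZ preserves the lattice \<open>Vk0\<close> and its
  multiples.\<close>

lemma rho_KZ_coeffs_le:
  assumes "\<kappa> \<in> KZ D" "P \<in> Hom k" "C.coeffs_le B P"
  shows "C.coeffs_le B (rho D kk \<kappa> P)"
proof -
  let ?N = "F.mnorm \<kappa>"
  have nn: "0 \<le> ?N ^ k * B" using F.mnorm_nonneg C.coeffs_le_nonneg[OF assms(3)] by simp
  have "C.coeffs_le (absC D (crho \<kappa>) * (?N ^ k * B)) (rho D kk \<kappa> P)"
    unfolding rho_eq[OF assms(2)]
  proof (intro C.coeffs_le_const_mult C.coeffs_le_sum nn)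
    fix m assume "m \<in> keys P"
    then have sum: "lookup m (VX \<sigma>) + lookup m (VY \<sigma>) = k" using assms by (auto simp: Hom_def)
    have "C.coeffs_le (B * (?N ^ lookup m (VX \<sigma>) * ?N ^ lookup m (VY \<sigma>)))
      (const_poly (lookup P m) *
        (lin (\<sigma> (\<kappa> $ 1 $ 1)) (\<sigma> (\<kappa> $ 2 $ 1)) ^ lookup m (VX \<sigma>) *
         lin (\<sigma> (\<kappa> $ 1 $ 2)) (\<sigma> (\<kappa> $ 2 $ 2)) ^ lookup m (VY \<sigma>)))"
      using assms(3) F.mnorm_nth[of \<kappa>]
      by (intro C.coeffs_le_mult C.coeffs_le_power lin_coeffs)
        (auto simp: \<sigma>_abs const_poly_def C.coeffs_le_def[of B P] intro: C.coeffs_le_single)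
    then show "C.coeffs_le (?N ^ k * B)
      (const_poly (lookup P m) *
        (lin (\<sigma> (\<kappa> $ 1 $ 1)) (\<sigma> (\<kappa> $ 2 $ 1)) ^ lookup m (VX \<sigma>) *
         lin (\<sigma> (\<kappa> $ 1 $ 2)) (\<sigma> (\<kappa> $ 2 $ 2)) ^ lookup m (VY \<sigma>)))"
      by (simp add: power_add[symmetric] sum mult.commute)
  qed
  then show ?thesis using abs_crho_KZ[OF assms(1)] by (simp add: mult.assoc[symmetric])
qed

section \<open>The operator Uk and the double coset of alpha\<close>

lemma alpha_eq: "alpha D = g1 D 0 0"
  by (simp add: alpha_def g1_def)

lemma alpha_inv: "matrix_inv (alpha D) = mat2 1 0 0 (inverse \<pi>)"
  using unif_nonzero by (intro matrix_inv_eqI mat2_eqI) (simp_all add: alpha_def mat2_mult_nth mat_scalar_nth)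

lemma det_alpha: "det (alpha D) \<noteq> 0" "det (matrix_inv (alpha D)) \<noteq> 0"
  using det_g_nonzero(2)[of 0 0] by (simp_all add: alpha_eq det_matrix_inv)

text \<open>\<open>Uk\<close> replaces x by \<sigma> \<pi> x. By homogeneity this is (\<sigma>
  \<pi>) ^ k times replacing y by y / \<sigma> \<pi>, and (\<sigma> \<pi>) ^ k is the explicit s ^ k
  times the s ^ k contained in \<open>rho\<close>.\<close>

lemma Uk_eq:
  assumes "P \<in> Hom k"
  shows "Uk D P = const_poly (s ^ k) * rho D kk (matrix_inv (alpha D)) P"
proof (rule Hom_eqI)
  have prod: "(\<Prod>\<sigma>'\<in>embeddings D. \<sigma>' \<pi> ^ lookup m (VX \<sigma>')) = \<sigma> \<pi> ^ lookup m (VX \<sigma>)"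
    if "m \<in> keys P" for m
  proof -
    have "keys m \<subseteq> {VX \<sigma>, VY \<sigma>}" using assms that by (auto simp: Hom_def)
    then have "lookup m (VX \<sigma>') = 0" if "\<sigma>' \<noteq> \<sigma>" for \<sigma>'
      using that by (auto simp flip: not_in_keys_iff_lookup_eq_zero)
    then have "(\<Prod>\<sigma>'\<in>embeddings D - {\<sigma>}. \<sigma>' \<pi> ^ lookup m (VX \<sigma>')) = 1"
      by (intro prod.neutral) auto
    then show ?thesis using prod.remove[OF finite_embeddings \<sigma>, of "\<lambda>\<sigma>'. \<sigma>' \<pi> ^ lookup m (VX \<sigma>')"] by simp
  qed
  show "Uk D P \<in> Hom k"
    unfolding Uk_def using assms by (intro Hom_sum Hom_single) (auto simp: Hom_def)
  show "const_poly (s ^ k) * rho D kk (matrix_inv (alpha D)) P \<in> Hom k"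
    by (intro Hom_const_mult rho_Hom assms)
  fix z
  have "ev (Uk D P) 1 z = (\<Sum>m\<in>keys P. lookup P m * \<sigma> \<pi> ^ lookup m (VX \<sigma>) *
      mon_eval (\<lambda>v. case v of VX _ \<Rightarrow> 1 | VY _ \<Rightarrow> z) m)"
    unfolding ev_def Uk_def by (simp add: poly_eval_sum poly_eval_single prod)
  also have "\<dots> = ev P (\<sigma> \<pi>) z"
    unfolding ev_def poly_eval_def using assms
    by (intro sum.cong) (auto simp: mon_eval_Hom Hom_def)
  finally have 1: "ev (Uk D P) 1 z = ev P (\<sigma> \<pi>) z" .
  have "vdet (matrix_inv (alpha D)) = - 1"
    using det_alpha by (intro vdet_eqI) (simp_all add: alpha_inv det_2 F.abs_inverse power_int_minus)
  then have "crho (matrix_inv (alpha D)) = s ^ k" by (simp add: crho_def)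
  then have "ev (const_poly (s ^ k) * rho D kk (matrix_inv (alpha D)) P) 1 z = (s * s) ^ k * ev P 1 (inverse (\<sigma> \<pi>) * z)"
    by (simp add: ev_const_mult ev_rho[OF assms] alpha_inv \<sigma>_hom power_mult_distrib mult.assoc)
  also have "s * s = \<sigma> \<pi>" using s_square by (simp add: power2_eq_square)
  also have "\<sigma> \<pi> ^ k * ev P 1 (inverse (\<sigma> \<pi>) * z) = ev P (\<sigma> \<pi>) z"
    using ev_scale[OF assms, of "\<sigma> \<pi>" 1 "inverse (\<sigma> \<pi>) * z"] unif_nonzero
    by (simp add: \<sigma>_hom(10) mult.assoc[symmetric])
  finally show "ev (Uk D P) 1 z = ev (const_poly (s ^ k) * rho D kk (matrix_inv (alpha D)) P) 1 z" using 1 by simp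
qed

lemma Delta_alpha: "F.Delta (matrix_inv (alpha D)) = ab \<pi>"
  using Delta_g1[of 0 0] by (simp add: F.Delta_matrix_inv det_alpha alpha_eq det_g_nonzero)

text \<open>The Cartan decomposition at distance one: by \<open>tree_exists\<close> only the
  representatives of distance 1 have to be factored, the central matrix \<pi> clearing the
  denominator in the inverse of alpha.\<close>

lemma double_coset_iff:
  "(\<exists>\<kappa>1\<in>KZ D. \<exists>\<kappa>2\<in>KZ D. x = \<kappa>1 ** matrix_inv (alpha D) ** \<kappa>2) \<longleftrightarrow> det x \<noteq> 0 \<and> F.Delta x = ab \<pi>"
proof
  assume "\<exists>\<kappa>1\<in>KZ D. \<exists>\<kappa>2\<in>KZ D. x = \<kappa>1 ** matrix_inv (alpha D) ** \<kappa>2"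
  then obtain \<kappa>1 \<kappa>2 where "\<kappa>1 \<in> KZ D" "\<kappa>2 \<in> KZ D" "x = \<kappa>1 ** matrix_inv (alpha D) ** \<kappa>2" by blast
  then show "det x \<noteq> 0 \<and> F.Delta x = ab \<pi>"
    by (simp add: det_mult2 KZ_det det_alpha KZ_Delta_mult Delta_alpha)
next
  assume x: "det x \<noteq> 0 \<and> F.Delta x = ab \<pi>"
  then have "det (matrix_inv x) \<noteq> 0" "F.Delta (matrix_inv x) = ab \<pi> ^ 1"
    by (simp_all add: det_matrix_inv F.Delta_matrix_inv)
  from tree_exists[OF this] obtain g where g: "matrix_inv x ** g \<in> KZ D"
    and cases: "(\<exists>\<mu>\<in>In D 1. g = g0 D 1 \<mu>) \<or> g = g1 D 0 0" by (auto simp: In_0)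
  have nz: "det g \<noteq> 0" by (rule Delta_eq_of_mem(3)[OF g])
  have "x = g ** matrix_inv (matrix_inv x ** g)"
    using x nz by (simp add: matrix_inv_prod det_matrix_inv matrix_inv_matrix_inv matrix_mul_assoc matrix_inv_mult)
  moreover have "\<exists>\<kappa>1\<in>KZ D. \<exists>\<kappa>2\<in>KZ D. g = \<kappa>1 ** matrix_inv (alpha D) ** \<kappa>2"
    using cases
  proof
    assume "\<exists>\<mu>\<in>In D 1. g = g0 D 1 \<mu>"
    then obtain \<mu> where \<mu>: "\<mu> \<in> In D 1" "g = g0 D 1 \<mu>" by blast
    have "g = (mat2 1 \<mu> 0 1 ** mat \<pi>) ** matrix_inv (alpha D) ** mat 1"
      unfolding \<mu> alpha_inv using unif_nonzero by (intro mat2_eqI) (simp_all add: g0_def mat2_mult_nth mat_scalar_nth)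
    then show ?thesis using KZ_mult[OF KZ_unitriangular[OF In_abs[OF \<mu>(1)]] KZ_mat[OF unif_nonzero]] KZ_mat[OF one_neq_zero]
      by blast
  next
    assume g: "g = g1 D 0 0"
    have "g = (mat2 0 1 1 0 ** mat \<pi>) ** matrix_inv (alpha D) ** mat2 0 1 1 0"
      unfolding g alpha_inv using unif_nonzero by (intro mat2_eqI) (simp_all add: g1_def mat2_mult_nth mat_scalar_nth)
    then show ?thesis using KZ_mult[OF KZ_swap KZ_mat[OF unif_nonzero]] KZ_swap by blast
  qed
  ultimately show "\<exists>\<kappa>1\<in>KZ D. \<exists>\<kappa>2\<in>KZ D. x = \<kappa>1 ** matrix_inv (alpha D) ** \<kappa>2"
    using KZ_inv[OF g] KZ_mult by (metis matrix_mul_assoc)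
qed

text \<open>
  Up to the factor \<open>s ^ k\<close>, the operator \<open>Uk\<close> is the action of \<open>alpha\<close> inverse, so \<open>psi\<close> is a
  multiple of the representation itself and in particular well defined.
\<close>
lemma psi_eq:
  assumes "P \<in> Hom k"
  shows "psi D kk x P = (if det x \<noteq> 0 \<and> F.Delta x = ab \<pi> then const_poly (s ^ k) * rho D kk x P else 0)"
proof -
  have val: "rho D kk \<kappa>1 (Uk D (rho D kk \<kappa>2 P)) = const_poly (s ^ k) * rho D kk x P"
    if "\<kappa>1 \<in> KZ D" "\<kappa>2 \<in> KZ D" "x = \<kappa>1 ** matrix_inv (alpha D) ** \<kappa>2" for \<kappa>1 \<kappa>2
    using that assms
    by (simp add: Uk_eq rho_Hom rho_const_mult rho_mult det_mult2 KZ_det det_alpha)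
  show ?thesis
  proof (cases "\<exists>\<kappa>1\<in>KZ D. \<exists>\<kappa>2\<in>KZ D. x = \<kappa>1 ** matrix_inv (alpha D) ** \<kappa>2")
    case True
    have "(THE w. \<forall>\<kappa>1\<in>KZ D. \<forall>\<kappa>2\<in>KZ D. x = \<kappa>1 ** matrix_inv (alpha D) ** \<kappa>2 \<longrightarrow>
        w = rho D kk \<kappa>1 (Uk D (rho D kk \<kappa>2 P))) = const_poly (s ^ k) * rho D kk x P"
      using True val by (intro the_equality) auto
    then show ?thesis using True double_coset_iff[of x] by (simp add: psi_def)
  next
    case False
    then show ?thesis unfolding psi_def by (subst if_not_P) (auto simp: double_coset_iff)
  qed
qed

end

section \<open>The Hecke operator\<close>

context padic_residue
begin

section \<open>Cosets and the neighbours of the root\<close>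

definition lcoset :: "'f^2^2 \<Rightarrow> ('f^2^2) set" where
  "lcoset g = (\<lambda>\<kappa>. g ** \<kappa>) ` KZ D"

definition rcoset :: "'f^2^2 \<Rightarrow> ('f^2^2) set" where
  "rcoset g = (\<lambda>\<kappa>. \<kappa> ** g) ` KZ D"

lemma left_cosets_eq: "left_cosets D = lcoset ` {g. det g \<noteq> 0}"
  unfolding left_cosets_def lcoset_def by (auto simp: GL2_UNIV_iff)

lemma mem_lcoset_iff:
  assumes "det g \<noteq> 0"
  shows "x \<in> lcoset g \<longleftrightarrow> matrix_inv g ** x \<in> KZ D"
proof
  assume "x \<in> lcoset g"
  then show "matrix_inv g ** x \<in> KZ D"
    using assms by (auto simp: lcoset_def matrix_mul_assoc matrix_inv_mult)
next
  assume "matrix_inv g ** x \<in> KZ D"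
  moreover have "x = g ** (matrix_inv g ** x)" using assms by (simp add: matrix_mul_assoc matrix_inv_mult)
  ultimately show "x \<in> lcoset g" unfolding lcoset_def by blast
qed

lemma lcoset_eq_iff:
  assumes "det g \<noteq> 0" "det h \<noteq> 0"
  shows "lcoset g = lcoset h \<longleftrightarrow> matrix_inv g ** h \<in> KZ D"
proof
  assume "lcoset g = lcoset h"
  moreover have "h \<in> lcoset h" using assms KZ_mat[OF one_neq_zero] by (simp add: mem_lcoset_iff matrix_inv_mult)
  ultimately have "h \<in> lcoset g" by simp
  then show "matrix_inv g ** h \<in> KZ D" using mem_lcoset_iff[OF assms(1)] by blast
next
  assume gh: "matrix_inv g ** h \<in> KZ D"
  have "x \<in> lcoset g \<longleftrightarrow> x \<in> lcoset h" for x
  proof -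
    have "matrix_inv g ** x = (matrix_inv g ** h) ** (matrix_inv h ** x)"
      using assms by (simp add: matrix_mul_assoc matrix_inv_mult)
    then show ?thesis using assms by (simp add: mem_lcoset_iff KZ_mult_left_iff[OF gh])
  qed
  then show "lcoset g = lcoset h" by blast
qed

lemma coset_rep_lcoset:
  assumes "det g \<noteq> 0"
  shows "\<exists>\<kappa>\<in>KZ D. coset_rep (lcoset g) = g ** \<kappa>"
proof -
  have "g ** mat 1 \<in> lcoset g" unfolding lcoset_def using KZ_mat[OF one_neq_zero] by blast
  then have "coset_rep (lcoset g) \<in> lcoset g" unfolding coset_rep_def by (rule someI)
  then show ?thesis by (auto simp: lcoset_def)
qed

lemma coset_rep_props:
  assumes "c \<in> left_cosets D"
  shows "det (coset_rep c) \<noteq> 0" "lcoset (coset_rep c) = c"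
proof -
  obtain g where g: "c = lcoset g" "det g \<noteq> 0" using assms by (auto simp: left_cosets_eq)
  obtain \<kappa> where \<kappa>: "\<kappa> \<in> KZ D" "coset_rep c = g ** \<kappa>" using coset_rep_lcoset[OF g(2)] g(1) by auto
  show nz: "det (coset_rep c) \<noteq> 0" using \<kappa> g by (simp add: det_mult2 KZ_det)
  have "matrix_inv g ** (g ** \<kappa>) \<in> KZ D" using \<kappa> g by (simp add: matrix_mul_assoc matrix_inv_mult)
  then show "lcoset (coset_rep c) = c" using lcoset_eq_iff[OF g(2) nz] \<kappa> g by simp
qed

lemma rcoset_eqD:
  assumes "rcoset g = rcoset h"
  shows "\<exists>\<kappa>\<in>KZ D. g = \<kappa> ** h"
proof -
  have "mat 1 ** g \<in> rcoset g" unfolding rcoset_def using KZ_mat[OF one_neq_zero] by blast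
  then show ?thesis using assms by (auto simp: rcoset_def)
qed

text \<open>Representatives of the q + 1 vertices adjacent to the root. Translated to another vertex
  \<open>g0 D n \<mu>\<close> with n > 0, those from \<open>teich\<close> give its children and the
  remaining one its parent.\<close>

definition nbrs :: "('f^2^2) set" where
  "nbrs = insert (g1 D 0 0) (g0 D 1 ` teich)"

lemma finite_nbrs: "finite nbrs"
  by (simp add: nbrs_def teich_finite)

lemma nbrs_props: "g \<in> nbrs \<Longrightarrow> det g \<noteq> 0" "g \<in> nbrs \<Longrightarrow> F.Delta g = ab \<pi>"
  using det_g_nonzero Delta_g0[of _ 1] Delta_g1[of 0 0] teich_abs by (auto simp: nbrs_def)

lemma nbrs_exists:
  assumes "det x \<noteq> 0" "F.Delta x = ab \<pi>"
  shows "\<exists>g\<in>nbrs. matrix_inv g ** x \<in> KZ D"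
proof -
  have "det (matrix_inv x) \<noteq> 0" "F.Delta (matrix_inv x) = ab \<pi> ^ 1"
    using assms by (simp_all add: det_matrix_inv F.Delta_matrix_inv)
  from tree_exists[OF this] obtain g where g: "matrix_inv x ** g \<in> KZ D" "g \<in> nbrs"
    by (auto simp: In_0 In_1 nbrs_def simp del: One_nat_def)
  have "matrix_inv (matrix_inv x ** g) = matrix_inv g ** x"
    using assms nbrs_props(1)[OF g(2)] by (simp add: matrix_inv_prod det_matrix_inv matrix_inv_matrix_inv)
  then show ?thesis using KZ_inv[OF g(1)] g(2) by auto
qed

lemma nbrs_unique:
  assumes "g \<in> nbrs" "g' \<in> nbrs" "matrix_inv g ** g' \<in> KZ D"
  shows "g = g'"
proof -
  have 1: "matrix_inv g ** g \<in> KZ D" using assms KZ_mat[OF one_neq_zero] by (simp add: matrix_inv_mult nbrs_props)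
  have T: "In D 1 = teich" "0 \<in> In D 0" by (simp_all only: In_1 In_0 singletonI)
  have False if "g = g0 D 1 \<mu>" "\<mu> \<in> teich" "g' = g1 D 0 0" for \<mu>
    using tree_unique(3)[OF 1 assms(3) that(1,3)] that T by auto
  moreover have False if "g' = g0 D 1 \<mu>" "\<mu> \<in> teich" "g = g1 D 0 0" for \<mu>
    using tree_unique(3)[OF assms(3) 1 that(1,3)] that T by auto
  moreover have "\<mu> = \<mu>'" if "g = g0 D 1 \<mu>" "g' = g0 D 1 \<mu>'" "\<mu> \<in> teich" "\<mu>' \<in> teich" for \<mu> \<mu>'
    using tree_unique(1)[OF 1 assms(3) that(1,2)] that T by auto
  ultimately show ?thesis using assms(1,2) by (auto simp: nbrs_def simp del: One_nat_def)
qed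

end

context weight_rep
begin

text \<open>For fixed h only the coset of \<open>matrix_inv (h ** g)\<close> contributes, and there
  the two actions of its representative cancel, so the choice made by \<open>coset_rep\<close>
  disappears.\<close>

lemma hecke_bracket_eq:
  assumes "P \<in> Hom k" "det g \<noteq> 0" "det h \<noteq> 0"
  shows "hecke_bracket D kk g P h =
    (if F.Delta (h ** g) = ab \<pi> then const_poly (s ^ k) * rho D kk (h ** g) P else 0)"
proof -
  define A where "A = {c \<in> left_cosets D. F.Delta (coset_rep c) = ab \<pi>}"
  define c0 where "c0 = lcoset (matrix_inv (h ** g))"
  have hg: "det (h ** g) \<noteq> 0" using assms by (simp add: det_mult2)
  have c0_LC: "c0 \<in> left_cosets D" unfolding c0_def left_cosets_eq using hg by (simp add: det_matrix_inv)
  have "A \<subseteq> lcoset ` nbrs"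
  proof
    fix c assume "c \<in> A"
    then have c: "c \<in> left_cosets D" "F.Delta (coset_rep c) = ab \<pi>" by (auto simp: A_def)
    obtain x where x: "x \<in> nbrs" "matrix_inv x ** coset_rep c \<in> KZ D"
      using nbrs_exists[OF coset_rep_props(1)[OF c(1)] c(2)] by blast
    then have "lcoset x = c"
      using lcoset_eq_iff[OF nbrs_props(1) coset_rep_props(1)[OF c(1)]] coset_rep_props(2)[OF c(1)] by simp
    then show "c \<in> lcoset ` nbrs" using x by blast
  qed
  \<comment> \<open>Over an infinite index set the defining sum would be 0 by default.\<close>
  then have finA: "finite A" using finite_nbrs finite_surj by blast
  have psi: "psi D kk (matrix_inv (coset_rep c)) P =
      (if c \<in> A then const_poly (s ^ k) * rho D kk (matrix_inv (coset_rep c)) P else 0)"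
    if "c \<in> left_cosets D" for c
    using that assms coset_rep_props(1)[OF that]
    by (simp add: psi_eq A_def det_matrix_inv F.Delta_matrix_inv)
  have summand: "bracket D kk (g ** coset_rep c) (psi D kk (matrix_inv (coset_rep c)) P) h =
      (if c = c0 then const_poly (s ^ k) * rho D kk (h ** g) P else 0)" if "c \<in> A" for c
  proof -
    have c: "c \<in> left_cosets D" using that by (simp add: A_def)
    note r = coset_rep_props[OF c]
    have "h ** (g ** coset_rep c) \<in> KZ D \<longleftrightarrow> c = c0"
      using lcoset_eq_iff[of "matrix_inv (h ** g)" "coset_rep c"] hg r
      by (auto simp: c0_def det_matrix_inv matrix_inv_matrix_inv matrix_mul_assoc)
    moreover have "rho D kk (h ** (g ** coset_rep c)) (const_poly (s ^ k) * rho D kk (matrix_inv (coset_rep c)) P)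
        = const_poly (s ^ k) * rho D kk (h ** g) P"
    proof -
      have "rho D kk (h ** (g ** coset_rep c)) (rho D kk (matrix_inv (coset_rep c)) P)
          = rho D kk ((h ** g) ** coset_rep c ** matrix_inv (coset_rep c)) P"
        using assms hg r by (subst rho_mult[symmetric]) (auto simp: det_mult2 det_matrix_inv matrix_mul_assoc)
      then show ?thesis using assms r by (simp add: rho_const_mult rho_Hom matrix_inv_mult)
    qed
    ultimately show ?thesis unfolding bracket_def psi[OF c] using that by (cases "c = c0") auto
  qed
  have "hecke_bracket D kk g P h = (\<Sum>c\<in>A. bracket D kk (g ** coset_rep c) (psi D kk (matrix_inv (coset_rep c)) P) h)"
    unfolding hecke_bracket_def
  proof (rule sum.mono_neutral_left[OF finA])
    show "{c. c \<in> left_cosets D \<and> psi D kk (matrix_inv (coset_rep c)) P \<noteq> 0} \<subseteq> A"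
      using psi by (auto split: if_splits)
    show "\<forall>c\<in>A - {c. c \<in> left_cosets D \<and> psi D kk (matrix_inv (coset_rep c)) P \<noteq> 0}.
        bracket D kk (g ** coset_rep c) (psi D kk (matrix_inv (coset_rep c)) P) h = 0"
      by (auto simp: A_def bracket_def rho_0)
  qed
  also have "\<dots> = (if c0 \<in> A then const_poly (s ^ k) * rho D kk (h ** g) P else 0)"
    using summand finA by (simp add: sum.delta)
  also have "c0 \<in> A \<longleftrightarrow> F.Delta (h ** g) = ab \<pi>"
  proof -
    obtain \<kappa> where "\<kappa> \<in> KZ D" "coset_rep c0 = matrix_inv (h ** g) ** \<kappa>"
      using coset_rep_lcoset[of "matrix_inv (h ** g)"] hg by (auto simp: c0_def det_matrix_inv)
    then have "F.Delta (coset_rep c0) = F.Delta (h ** g)"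
      using hg by (simp add: KZ_Delta_mult det_matrix_inv F.Delta_matrix_inv)
    then show ?thesis using c0_LC by (simp add: A_def)
  qed
  finally show ?thesis .
qed

lemma cind_Hom: "f \<in> cind D kk (Vk D kk) \<Longrightarrow> f g \<in> Hom k"
  by (cases "g \<in> GL2 UNIV") (auto simp: cind_def Vk_eq)

lemma cind_equivariant:
  "f \<in> cind D kk W \<Longrightarrow> \<kappa> \<in> KZ D \<Longrightarrow> det g \<noteq> 0 \<Longrightarrow> f (\<kappa> ** g) = rho D kk \<kappa> (f g)"
  by (simp add: cind_def GL2_UNIV_iff)

lemma cind_finite: "f \<in> cind D kk W \<Longrightarrow> finite (rcoset ` {g. det g \<noteq> 0 \<and> f g \<noteq> 0})"
  by (simp add: cind_def GL2_UNIV_iff rcoset_def)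

text \<open>A bracket acts at distance one only, so evaluation at h sees just the cosets of
  \<open>matrix_inv h ** x\<close> with x in \<open>nbrs\<close>; equivariance of f removes their
  chosen representatives.\<close>

lemma hecke_eq:
  assumes f: "f \<in> cind D kk (Vk D kk)" and h: "det h \<noteq> 0"
  shows "hecke D kk f h = (\<Sum>x\<in>nbrs. const_poly (s ^ k) * rho D kk x (f (matrix_inv x ** h)))"
proof -
  define A where "A = {c. c \<in> left_cosets D \<and> f (matrix_inv (coset_rep c)) \<noteq> 0}"
  define t where "t c = (if F.Delta (h ** coset_rep c) = ab \<pi>
    then const_poly (s ^ k) * rho D kk (h ** coset_rep c) (f (matrix_inv (coset_rep c))) else 0)" for c
  define B where "B = (\<lambda>x. lcoset (matrix_inv h ** x)) ` nbrs"
  \<comment> \<open>Inversion turns left cosets of KZ into right cosets, on which the support of f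
    is finite.\<close>
  have finA: "finite A"
  proof (rule inj_on_finite[OF _ _ cind_finite[OF f]])
    show "inj_on (\<lambda>c. rcoset (matrix_inv (coset_rep c))) A"
    proof (rule inj_onI)
      fix c c' assume c: "c \<in> A" "c' \<in> A"
        and eq: "rcoset (matrix_inv (coset_rep c)) = rcoset (matrix_inv (coset_rep c'))"
      have LC: "c \<in> left_cosets D" "c' \<in> left_cosets D" using c by (auto simp: A_def)
      note r = coset_rep_props[OF LC(1)] coset_rep_props[OF LC(2)]
      obtain \<kappa> where \<kappa>: "\<kappa> \<in> KZ D" "matrix_inv (coset_rep c) = \<kappa> ** matrix_inv (coset_rep c')"
        using rcoset_eqD[OF eq] by blast
      have "matrix_inv (coset_rep c) ** coset_rep c' = \<kappa>"
        unfolding \<kappa>(2) by (rule matrix_inv_mult(4)[OF r(3)])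
      then show "c = c'"
        using lcoset_eq_iff[OF r(1,3)] r(2,4) \<kappa>(1) by simp
    qed
    show "(\<lambda>c. rcoset (matrix_inv (coset_rep c))) ` A \<subseteq> rcoset ` {g. det g \<noteq> 0 \<and> f g \<noteq> 0}"
      using coset_rep_props(1) by (auto simp: A_def det_matrix_inv)
  qed
  have finB: "finite B" by (simp add: B_def finite_nbrs)
  have "hecke D kk f h = sum t A"
    unfolding hecke_def A_def[symmetric] t_def
    using coset_rep_props(1) cind_Hom[OF f] h by (intro sum.cong refl hecke_bracket_eq) (auto simp: A_def)
  \<comment> \<open>\<open>A\<close> collects the cosets where f is nonzero and \<open>B\<close>
    those adjacent to h. Outside either set the summand vanishes, so the union serves as a bridge
    from \<open>A\<close> to \<open>B\<close>.\<close>
  also have "\<dots> = sum t (A \<union> B)"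
  proof (rule sum.mono_neutral_left)
    show "\<forall>c\<in>A \<union> B - A. t c = 0"
    proof
      fix c assume c: "c \<in> A \<union> B - A"
      then have "c \<in> left_cosets D"
        using h by (auto simp: B_def left_cosets_eq det_mult2 det_matrix_inv nbrs_props)
      then have "f (matrix_inv (coset_rep c)) = 0" using c by (auto simp: A_def)
      then show "t c = 0" by (simp add: t_def rho_0)
    qed
  qed (use finA finB in auto)
  also have "\<dots> = sum t B"
  proof (rule sum.mono_neutral_right)
    show "\<forall>c\<in>A \<union> B - B. t c = 0"
    proof
      fix c assume c: "c \<in> A \<union> B - B"
      then have LC: "c \<in> left_cosets D" by (auto simp: A_def)
      note r = coset_rep_props[OF LC]
      have "F.Delta (h ** coset_rep c) \<noteq> ab \<pi>"
      proof
        assume "F.Delta (h ** coset_rep c) = ab \<pi>"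
        then obtain x where x: "x \<in> nbrs" "matrix_inv x ** (h ** coset_rep c) \<in> KZ D"
          using nbrs_exists[of "h ** coset_rep c"] h r by (auto simp: det_mult2)
        have "matrix_inv (matrix_inv h ** x) ** coset_rep c = matrix_inv x ** (h ** coset_rep c)"
          using h nbrs_props(1)[OF x(1)] by (simp add: matrix_inv_prod det_matrix_inv matrix_inv_matrix_inv matrix_mul_assoc)
        then have "lcoset (matrix_inv h ** x) = lcoset (coset_rep c)"
          using x h r nbrs_props(1)[OF x(1)] by (subst lcoset_eq_iff) (auto simp: det_mult2 det_matrix_inv)
        then have "c \<in> B" using r x by (auto simp: B_def)
        then show False using c by simp
      qed
      then show "t c = 0" by (simp add: t_def)
    qed
  qed (use finA finB in auto)
  also have "\<dots> = (\<Sum>x\<in>nbrs. t (lcoset (matrix_inv h ** x)))"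
    unfolding B_def
  proof (rule sum.reindex_cong[OF _ refl refl])
    show "inj_on (\<lambda>x. lcoset (matrix_inv h ** x)) nbrs"
    proof (rule inj_onI)
      fix x y assume xy: "x \<in> nbrs" "y \<in> nbrs" "lcoset (matrix_inv h ** x) = lcoset (matrix_inv h ** y)"
      have "matrix_inv (matrix_inv h ** x) ** (matrix_inv h ** y) = matrix_inv x ** y"
        using h nbrs_props(1)[OF xy(1)] by (simp add: matrix_inv_prod det_matrix_inv matrix_inv_matrix_inv matrix_mul_assoc matrix_inv_mult)
      moreover have "matrix_inv (matrix_inv h ** x) ** (matrix_inv h ** y) \<in> KZ D"
        using xy h nbrs_props(1) by (subst lcoset_eq_iff[symmetric]) (auto simp: det_mult2 det_matrix_inv)
      ultimately show "x = y" using nbrs_unique xy by simp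
    qed
  qed
  also have "\<dots> = (\<Sum>x\<in>nbrs. const_poly (s ^ k) * rho D kk x (f (matrix_inv x ** h)))"
  proof (rule sum.cong[OF refl])
    fix x assume x: "x \<in> nbrs"
    note nz = nbrs_props(1)[OF x]
    have hx: "det (matrix_inv h ** x) \<noteq> 0" using h nz by (simp add: det_mult2 det_matrix_inv)
    obtain \<kappa> where \<kappa>: "\<kappa> \<in> KZ D" "coset_rep (lcoset (matrix_inv h ** x)) = matrix_inv h ** x ** \<kappa>"
      using coset_rep_lcoset[OF hx] by blast
    have 1: "h ** (matrix_inv h ** x ** \<kappa>) = x ** \<kappa>" using h by (simp add: matrix_mul_assoc matrix_inv_mult)
    have 2: "matrix_inv (matrix_inv h ** x ** \<kappa>) = matrix_inv \<kappa> ** (matrix_inv x ** h)"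
      using h nz KZ_det[OF \<kappa>(1)] hx by (simp add: matrix_inv_prod det_matrix_inv matrix_inv_matrix_inv matrix_mul_assoc)
    have "f (matrix_inv \<kappa> ** (matrix_inv x ** h)) = rho D kk (matrix_inv \<kappa>) (f (matrix_inv x ** h))"
      using h nz by (intro cind_equivariant[OF f KZ_inv[OF \<kappa>(1)]]) (simp add: det_mult2 det_matrix_inv)
    then have "rho D kk (x ** \<kappa>) (f (matrix_inv \<kappa> ** (matrix_inv x ** h))) = rho D kk x (f (matrix_inv x ** h))"
      using KZ_det[OF \<kappa>(1)] nz by (simp add: rho_mult rho_Hom cind_Hom[OF f] rho_inverse)
    moreover have "F.Delta (x ** \<kappa>) = ab \<pi>" using KZ_Delta_mult[OF \<kappa>(1) nz] nbrs_props(2)[OF x] by simp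
    ultimately show "t (lcoset (matrix_inv h ** x)) = const_poly (s ^ k) * rho D kk x (f (matrix_inv x ** h))"
      unfolding t_def \<kappa>(2) 1 2 by simp
  qed
  finally show ?thesis .
qed

text \<open>\<open>F.Delta (g ** \<gamma>)\<close> is constant on the coset KZ g, so it takes
  finitely many values on the support, while it equals |\<pi>| ^ m at the matrices in
  question.\<close>

lemma finite_support:
  assumes f: "f \<in> cind D kk W" and \<gamma>: "det \<gamma> \<noteq> 0"
  shows "\<exists>M. \<forall>m\<ge>M. \<forall>x\<in>In D m. f (matrix_inv (\<gamma> ** g0 D m x)) = 0"
proof -
  define S where "S = {g. det g \<noteq> 0 \<and> f g \<noteq> 0}"
  have "finite ((\<lambda>g. F.Delta (g ** \<gamma>)) ` S)"
  proof -
    have "F.Delta ((SOME x. x \<in> rcoset g) ** \<gamma>) = F.Delta (g ** \<gamma>)" if "g \<in> S" for g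
    proof -
      have "mat 1 ** g \<in> rcoset g" unfolding rcoset_def using KZ_mat[OF one_neq_zero] by blast
      then have "(SOME x. x \<in> rcoset g) \<in> rcoset g" by (rule someI)
      then obtain \<kappa> where "\<kappa> \<in> KZ D" "(SOME x. x \<in> rcoset g) = \<kappa> ** g" by (auto simp: rcoset_def)
      then show ?thesis
        using KZ_Delta_mult(1)[of \<kappa> "g ** \<gamma>"] that \<gamma> by (simp add: S_def det_mult2 matrix_mul_assoc)
    qed
    then have "(\<lambda>g. F.Delta (g ** \<gamma>)) ` S = (\<lambda>c. F.Delta ((SOME x. x \<in> c) ** \<gamma>)) ` rcoset ` S"
      by (simp add: image_image)
    then show ?thesis using cind_finite[OF f] by (simp add: S_def)
  qed
  then have "finite ((\<lambda>m. ab \<pi> ^ m) -` ((\<lambda>g. F.Delta (g ** \<gamma>)) ` S))"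
    by (rule finite_vimageI) (simp add: inj_on_def unif_power_inject)
  then obtain M where M: "\<And>m. ab \<pi> ^ m \<in> (\<lambda>g. F.Delta (g ** \<gamma>)) ` S \<Longrightarrow> m < M"
    unfolding finite_nat_set_iff_bounded by auto
  have "f (matrix_inv (\<gamma> ** g0 D m x)) = 0" if "m \<ge> M" "x \<in> In D m" for m x
  proof (rule ccontr)
    assume "f (matrix_inv (\<gamma> ** g0 D m x)) \<noteq> 0"
    then have "matrix_inv (\<gamma> ** g0 D m x) \<in> S"
      using \<gamma> det_g_nonzero by (simp add: S_def det_matrix_inv det_mult2)
    moreover have "matrix_inv (\<gamma> ** g0 D m x) ** \<gamma> = matrix_inv (g0 D m x)"
      using \<gamma> det_g_nonzero by (simp add: matrix_inv_prod matrix_inv_mult)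
    then have "F.Delta (matrix_inv (\<gamma> ** g0 D m x) ** \<gamma>) = ab \<pi> ^ m"
      using that det_g_nonzero by (simp add: F.Delta_matrix_inv Delta_g0 In_abs)
    ultimately have "m < M" using M by (metis imageI)
    then show False using that by simp
  qed
  then show ?thesis by blast
qed

section \<open>Membership in the filtration\<close>

lemma bracket_eq_0:
  assumes "\<not> (det h \<noteq> 0 \<and> F.Delta h = F.Delta g)"
  shows "bracket D kk g P h = 0"
  using Delta_eq_of_mem[of h g] assms by (auto simp: bracket_def)

text \<open>\<open>BN\<close> is supported on the ball of radius N: \<open>g0 D n \<mu>\<close> has
  distance n and \<open>g1 D n \<mu>\<close> distance n + 1, which explains the ranges n \<le> N and
  n < N. Outside the ball only the lattice part is seen.\<close>

lemma BN_plus_coeffs_le: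
  assumes "\<tau> \<in> embeddings D" "u \<in> BN_plus D kk \<tau> N n" "det h \<noteq> 0" "F.Delta h < ab \<pi> ^ N"
  shows "C.coeffs_le (ab \<pi> powi n) (u h)"
proof -
  obtain b w where u: "u = (\<lambda>h. b h + const_poly (\<tau> \<pi> powi n) * w h)" and b: "b \<in> BN D kk N"
    and w: "w \<in> cind D kk (Vk0 D kk)" using assms(2) by (auto simp: BN_plus_def)
  obtain v0 v1 where b_eq: "b = (\<lambda>h. (\<Sum>n\<le>N. \<Sum>\<mu>\<in>In D n. bracket D kk (g0 D n \<mu>) (v0 n \<mu>) h) +
           (\<Sum>n<N. \<Sum>\<mu>\<in>In D n. bracket D kk (g1 D n \<mu>) (v1 n \<mu>) h))" using b by (auto simp: BN_def)
  have "bracket D kk (g0 D m \<mu>) v h = 0" if "m \<le> N" "\<mu> \<in> In D m" for m \<mu> v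
    using that assms(4) unif_power_mono[OF that(1)] by (intro bracket_eq_0) (auto simp: Delta_g0 In_abs)
  moreover have "bracket D kk (g1 D m \<mu>) v h = 0" if "m < N" "\<mu> \<in> In D m" for m \<mu> v
    using that assms(4) unif_power_mono[of "m + 1" N] by (intro bracket_eq_0) (auto simp: Delta_g1 In_abs)
  ultimately have "b h = 0" by (simp add: b_eq)
  moreover have "C.coeffs_le 1 (w h)" using w assms(3) by (auto simp: cind_def GL2_UNIV_iff Vk0_iff)
  then have "C.coeffs_le (absC D (\<tau> \<pi> powi n) * 1) (const_poly (\<tau> \<pi> powi n) * w h)"
    by (rule C.coeffs_le_const_mult)
  ultimately show ?thesis using abs_embedding[OF assms(1)] by (simp add: u C.abs_powi)
qed

lemma bracket_at_rep:
  assumes f: "f \<in> cind D kk W" and "h ** g \<in> KZ D"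
  shows "bracket D kk g (f (matrix_inv g)) h = f h"
proof -
  note nz = Delta_eq_of_mem(2,3)[OF assms(2)]
  have "f ((h ** g) ** matrix_inv g) = rho D kk (h ** g) (f (matrix_inv g))"
    using nz by (intro cind_equivariant[OF f assms(2)]) (simp add: det_matrix_inv)
  then show ?thesis using nz assms(2) by (simp add: bracket_def matrix_inv_mult)
qed

text \<open>Since \<open>Delta\<close> is KZ-invariant, f can be cut at the ball: the outer part
  divided by the scalar is still equivariant, and the inner part expands in the standard
  representatives.\<close>

lemma BN_plusI:
  assumes "\<tau> \<in> embeddings D" and f: "f \<in> cind D kk (Vk D kk)"
    and small: "\<And>h. det h \<noteq> 0 \<Longrightarrow> F.Delta h < ab \<pi> ^ N \<Longrightarrow> C.coeffs_le (ab \<pi> powi n) (f h)"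
  shows "f \<in> BN_plus D kk \<tau> N n"
proof -
  define c where "c = \<tau> \<pi> powi n"
  have c: "c \<noteq> 0" "absC D c = ab \<pi> powi n"
    using unif_nonzero field_homD(10)[OF embedding_hom[OF assms(1)]] abs_embedding[OF assms(1)]
    by (auto simp: c_def C.abs_powi)
  define w where "w h = (if det h \<noteq> 0 \<and> F.Delta h < ab \<pi> ^ N then const_poly (inverse c) * f h else 0)" for h
  define b where "b h = (\<Sum>n\<le>N. \<Sum>\<mu>\<in>In D n. bracket D kk (g0 D n \<mu>) (f (matrix_inv (g0 D n \<mu>))) h) +
           (\<Sum>n<N. \<Sum>\<mu>\<in>In D n. bracket D kk (g1 D n \<mu>) (f (matrix_inv (g1 D n \<mu>))) h)" for h
  have "b \<in> BN D kk N"
    unfolding BN_def b_def[abs_def] using cind_Hom[OF f]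
    by (intro CollectI exI[of _ "\<lambda>n \<mu>. f (matrix_inv (g0 D n \<mu>))"] exI[of _ "\<lambda>n \<mu>. f (matrix_inv (g1 D n \<mu>))"])
      (auto simp: Vk_eq)
  moreover have "w \<in> cind D kk (Vk0 D kk)"
    unfolding cind_def
  proof (intro CollectI conjI ballI allI impI)
    show "w g \<in> Vk0 D kk" for g
    proof (cases "det g \<noteq> 0 \<and> F.Delta g < ab \<pi> ^ N")
      case True
      then have "C.coeffs_le (absC D (inverse c) * ab \<pi> powi n) (const_poly (inverse c) * f g)"
        by (intro C.coeffs_le_const_mult small) auto
      moreover have "absC D (inverse c) * ab \<pi> powi n = 1" using c by (simp add: C.abs_inverse flip: c(2))
      ultimately show ?thesis using True cind_Hom[OF f] by (simp add: w_def Vk0_iff Hom_const_mult)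
    next
      case False
      then have "w g = 0" by (auto simp: w_def)
      then show ?thesis by (simp add: Vk0_iff C.coeffs_le_def)
    qed
    show "w g = 0" if "g \<notin> GL2 UNIV" for g using that by (simp add: w_def GL2_UNIV_iff)
    show "w (\<kappa> ** g) = rho D kk \<kappa> (w g)" if "\<kappa> \<in> KZ D" "g \<in> GL2 UNIV" for \<kappa> g
      using that cind_equivariant[OF f, of \<kappa> g] cind_Hom[OF f]
      by (simp add: w_def GL2_UNIV_iff KZ_Delta_mult det_mult2 KZ_det rho_const_mult rho_0)
    have "{g \<in> GL2 UNIV. w g \<noteq> 0} \<subseteq> {g. det g \<noteq> 0 \<and> f g \<noteq> 0}"
      by (auto simp: w_def GL2_UNIV_iff split: if_splits)
    then show "finite ((\<lambda>g. (\<lambda>\<kappa>. \<kappa> ** g) ` KZ D) ` {g \<in> GL2 UNIV. w g \<noteq> 0})"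
      unfolding rcoset_def[symmetric] using cind_finite[OF f] by (meson finite_subset image_mono)
  qed
  moreover have "f h = b h + const_poly c * w h" for h
  proof (cases "det h = 0")
    case True
    then have "f h = 0" "w h = 0" using f by (auto simp: cind_def GL2_UNIV_iff w_def)
    moreover have "b h = 0" unfolding b_def using True by (simp add: bracket_eq_0)
    ultimately show ?thesis by simp
  next
    case False
    obtain m where m: "F.Delta h = ab \<pi> ^ m" using Delta_power[OF False] by blast
    show ?thesis
    proof (cases "N < m")
      case True
      then have lt: "F.Delta h < ab \<pi> ^ N" using m unif_pos unif_less by (simp add: power_strict_decreasing)
      have "bracket D kk (g0 D n \<mu>) v h = 0" if "n \<le> N" "\<mu> \<in> In D n" for n \<mu> v
        using that True m by (intro bracket_eq_0) (auto simp: Delta_g0 In_abs unif_power_inject)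
      moreover have "bracket D kk (g1 D n \<mu>) v h = 0" if "n < N" "\<mu> \<in> In D n" for n \<mu> v
        using that True m unif_power_inject[of m "n + 1"] by (intro bracket_eq_0) (auto simp: Delta_g1 In_abs)
      ultimately have "b h = 0" by (simp add: b_def)
      then show ?thesis
        using lt False c(1) by (simp add: w_def mult.assoc[symmetric] const_poly_mult const_poly_1)
    next
      case Nm: False
      then have "\<not> F.Delta h < ab \<pi> ^ N" using m unif_power_mono[of m N] by simp
      then have "w h = 0" by (simp add: w_def)
      \<comment> \<open>By \<open>tree_unique\<close> exactly one bracket is nonzero at h, and its
        value there is f h by equivariance.\<close>
      moreover have "b h = f h"
        using tree_exists[OF False m]
      proof
        assume "\<exists>\<mu>\<in>In D m. h ** g0 D m \<mu> \<in> KZ D"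
        then obtain \<mu> where \<mu>: "\<mu> \<in> In D m" "h ** g0 D m \<mu> \<in> KZ D" by blast
        have "bracket D kk (g0 D n \<mu>') (f (matrix_inv (g0 D n \<mu>'))) h = (if n = m then if \<mu>' = \<mu> then f h else 0 else 0)"
          if "\<mu>' \<in> In D n" for n \<mu>'
        proof (cases "h ** g0 D n \<mu>' \<in> KZ D")
          case True
          then show ?thesis
            using tree_unique(1)[OF \<mu>(2) True refl refl \<mu>(1) that] bracket_at_rep[OF f True] by simp
        next
          case False
          then have "\<not> (n = m \<and> \<mu>' = \<mu>)" using \<mu>(2) by blast
          then show ?thesis using False by (simp add: bracket_def)
        qed
        moreover have "bracket D kk (g1 D n \<mu>') (f (matrix_inv (g1 D n \<mu>'))) h = 0"
          if "\<mu>' \<in> In D n" for n \<mu>'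
          using tree_unique(3)[OF \<mu>(2) _ refl refl \<mu>(1) that] unfolding bracket_def by (metis (full_types))
        moreover have "(\<Sum>n\<le>N. \<Sum>\<mu>'\<in>In D n. if n = m then if \<mu>' = \<mu> then f h else 0 else 0)
            = (\<Sum>n\<le>N. if n = m then f h else 0)"
          using finite_In \<mu>(1) by (intro sum.cong refl) (auto simp: sum.delta)
        ultimately show "b h = f h" using Nm by (simp add: b_def)
      next
        assume "m > 0 \<and> (\<exists>\<mu>\<in>In D (m - 1). h ** g1 D (m - 1) \<mu> \<in> KZ D)"
        then obtain \<mu> where m0: "m > 0" and \<mu>: "\<mu> \<in> In D (m - 1)" "h ** g1 D (m - 1) \<mu> \<in> KZ D" by blast
        have "bracket D kk (g1 D n \<mu>') (f (matrix_inv (g1 D n \<mu>'))) h = (if n = m - 1 then if \<mu>' = \<mu> then f h else 0 else 0)"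
          if "\<mu>' \<in> In D n" for n \<mu>'
        proof (cases "h ** g1 D n \<mu>' \<in> KZ D")
          case True
          then show ?thesis
            using tree_unique(2)[OF \<mu>(2) True refl refl \<mu>(1) that] bracket_at_rep[OF f True] by simp
        next
          case False
          then have "\<not> (n = m - 1 \<and> \<mu>' = \<mu>)" using \<mu>(2) by blast
          then show ?thesis using False by (simp add: bracket_def)
        qed
        moreover have "bracket D kk (g0 D n \<mu>') (f (matrix_inv (g0 D n \<mu>'))) h = 0"
          if "\<mu>' \<in> In D n" for n \<mu>'
          using tree_unique(3)[OF _ \<mu>(2) refl refl that \<mu>(1)] unfolding bracket_def by (metis (full_types))
        moreover have "(\<Sum>n<N. \<Sum>\<mu>'\<in>In D n. if n = m - 1 then if \<mu>' = \<mu> then f h else 0 else 0)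
            = (\<Sum>n<N. if n = m - 1 then f h else 0)"
          using finite_In \<mu>(1) by (intro sum.cong refl) (auto simp: sum.delta)
        ultimately show "b h = f h" using Nm m0 by (simp add: b_def)
      qed
      ultimately show ?thesis by simp
    qed
  qed
  ultimately show ?thesis
    unfolding BN_plus_def c_def by (intro CollectI exI[of _ b] exI[of _ w]) auto
qed

end

section \<open>Descent along the tree\<close>

locale hecke_weight = weight_rep D \<sigma> kk k
  for D :: "('q::field_char_0, 'f::field_char_0, 'c::field_char_0) padic_data"
    and \<sigma> :: "'f \<Rightarrow> 'c" and kk :: "('f \<Rightarrow> 'c) \<Rightarrow> nat" and k :: nat +
  fixes d r :: nat
  assumes k_eq: "k = d * resq D + r" "r < resq D" "d \<le> Suc r" "2 * d \<le> resq D" "d < prm D"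
begin

lemma \<sigma>_inject: "\<sigma> x = \<sigma> y \<longleftrightarrow> x = y"
  using \<sigma>_hom(10)[of "x - y"] by (simp add: \<sigma>_hom)

sublocale W: weight_setup "absC D" "\<sigma> \<pi>" "\<sigma> ` teich" "prm D" "resq D" k d r
proof
  show "\<sigma> \<pi> \<noteq> 0" "absC D (\<sigma> \<pi>) < 1" using unif_nonzero unif_less by (simp_all add: \<sigma>_hom(10) \<sigma>_abs)
  show "finite (\<sigma> ` teich)" by (simp add: teich_finite)
  have "inj_on \<sigma> teich" by (simp add: inj_on_def \<sigma>_inject)
  then show "card (\<sigma> ` teich) = resq D" by (simp add: card_image teich_card)
  show "absC D t \<le> 1" "t ^ resq D = t" if "t \<in> \<sigma> ` teich" for t
    using that teich_abs teich_power by (auto simp: \<sigma>_abs \<sigma>_hom(7)[symmetric])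
  show "absC D (t - t') = 1" if "t \<in> \<sigma> ` teich" "t' \<in> \<sigma> ` teich" "t \<noteq> t'" for t t'
    using that by (auto simp: \<sigma>_abs \<sigma>_hom(6)[symmetric] intro!: teich_sep)
  have "\<sigma> (of_nat n) = of_nat n" for n by (induction n) (simp_all add: \<sigma>_hom)
  then show "absC D (of_nat (prm D)) \<le> absC D (\<sigma> \<pi>)"
    using less_1_le_unif[OF abs_prime_less] \<sigma>_abs by metis
qed (use prime prime_dvd_choose_resq k_eq in auto)

text \<open>The determinant has valuation 1, so the explicit s ^ k cancels the normalisation of
  \<open>rho\<close>, leaving P(\<sigma> \<pi>, z + \<sigma> u).\<close>

lemma dehom_contraction:
  assumes "P \<in> Hom k"
  shows "dehom (const_poly (s ^ k) * rho D kk (g0 D 1 u) P) = W.contraction (dehom P) (\<sigma> u)"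
proof -
  have "vdet (g0 D 1 u) = 1" using unif_nonzero by (intro vdet_eqI) (simp_all add: det_g0)
  then have c: "s ^ k * crho (g0 D 1 u) = 1" using s_nonzero by (simp add: crho_def power_int_minus)
  have "poly (dehom (const_poly (s ^ k) * rho D kk (g0 D 1 u) P)) z = poly (W.contraction (dehom P) (\<sigma> u)) z" for z
  proof -
    have "poly (dehom (const_poly (s ^ k) * rho D kk (g0 D 1 u) P)) z
        = (s ^ k * crho (g0 D 1 u)) * ev P (\<sigma> \<pi>) (\<sigma> u + z)"
      using assms
      by (simp add: poly_dehom Hom_const_mult rho_Hom ev_const_mult ev_rho mult.assoc g0_def \<sigma>_hom)
    also have "\<dots> = (\<Sum>i\<le>k. lookup P (mon i) * \<sigma> \<pi> ^ (k - i) * (\<sigma> u + z) ^ i)"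
      by (simp only: c ev_Hom[OF assms] mult_1_left)
    also have "\<dots> = poly (W.contraction (dehom P) (\<sigma> u)) z"
      by (simp add: W.contraction_def poly_sum poly_power coeff_dehom)
    finally show ?thesis .
  qed
  then show ?thesis by (intro iffD1[OF poly_eq_poly_eq_iff] ext)
qed

text \<open>The step to the parent reaches its standard representative only up to an element of KZ,
  the matrix inverted here. This time two scalars s ^ k meet, and homogeneity absorbs their product
  (\<sigma> \<pi>) ^ k.\<close>

lemma dehom_expansion:
  assumes "P \<in> Hom k"
  shows "dehom (const_poly (s ^ k) * rho D kk (g1 D 0 0) (rho D kk (matrix_inv (mat2 1 t 0 1 ** mat \<pi>)) P))
    = pcompose (dehom P) [:- \<sigma> t, \<sigma> \<pi>:]"
proof -
  define \<kappa> where "\<kappa> = mat2 1 t 0 1 ** mat \<pi>"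
  define y where "y = mat2 (inverse \<pi>) (- t * inverse \<pi>) 0 1"
  have \<kappa>: "det \<kappa> \<noteq> 0" using unif_nonzero by (simp add: \<kappa>_def mat2_simps)
  have inv: "matrix_inv \<kappa> = mat2 (inverse \<pi>) (- t * inverse \<pi>) 0 (inverse \<pi>)"
    using unif_nonzero by (intro matrix_inv_eqI mat2_eqI) (simp_all add: \<kappa>_def mat2_mult_nth mat_scalar_nth)
  have y: "g1 D 0 0 ** matrix_inv \<kappa> = y"
    unfolding inv y_def using unif_nonzero by (intro mat2_eqI) (simp_all add: g1_def mat2_mult_nth)
  have "det y = inverse \<pi>" by (simp add: y_def det_2)
  then have "vdet y = - 1"
    using unif_nonzero by (intro vdet_eqI) (simp_all add: F.abs_inverse power_int_minus)
  then have cy: "crho y = s ^ k" by (simp add: crho_def)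
  have comp: "rho D kk (g1 D 0 0) (rho D kk (matrix_inv \<kappa>) P) = rho D kk y P"
    using assms \<kappa> det_g_nonzero by (simp add: rho_mult[symmetric] det_matrix_inv y)
  have y_nth: "y $ 1 $ 1 = inverse \<pi>" "y $ 1 $ 2 = - t * inverse \<pi>" "y $ 2 $ 1 = 0" "y $ 2 $ 2 = 1"
    by (simp_all add: y_def)
  have "poly (dehom (const_poly (s ^ k) * rho D kk y P)) z = poly (pcompose (dehom P) [:- \<sigma> t, \<sigma> \<pi>:]) z" for z
  proof -
    have "poly (dehom (const_poly (s ^ k) * rho D kk y P)) z
        = (s * s) ^ k * ev P (inverse (\<sigma> \<pi>)) (- \<sigma> t * inverse (\<sigma> \<pi>) + z)"
      using assms
      by (simp add: poly_dehom Hom_const_mult rho_Hom ev_const_mult ev_rho cy y_nth \<sigma>_hom power_mult_distrib mult.assoc)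
    also have "s * s = \<sigma> \<pi>" using s_square by (simp add: power2_eq_square)
    also have "\<sigma> \<pi> ^ k * ev P (inverse (\<sigma> \<pi>)) (- \<sigma> t * inverse (\<sigma> \<pi>) + z) =
        ev P (\<sigma> \<pi> * inverse (\<sigma> \<pi>)) (\<sigma> \<pi> * (- \<sigma> t * inverse (\<sigma> \<pi>) + z))"
      by (rule ev_scale[OF assms, symmetric])
    also have "\<dots> = ev P 1 (- \<sigma> t + \<sigma> \<pi> * z)"
    proof -
      have "\<sigma> \<pi> * inverse (\<sigma> \<pi>) = 1" "\<sigma> \<pi> * (- \<sigma> t * inverse (\<sigma> \<pi>) + z) = - \<sigma> t + \<sigma> \<pi> * z"
        using W.w(1) by (simp_all add: field_simps)
      then show ?thesis by simp
    qed
    also have "\<dots> = poly (pcompose (dehom P) [:- \<sigma> t, \<sigma> \<pi>:]) z"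
      using assms by (simp add: poly_pcompose poly_dehom mult.commute)
    finally show ?thesis .
  qed
  then show ?thesis unfolding \<kappa>_def[symmetric] comp by (intro iffD1[OF poly_eq_poly_eq_iff] ext)
qed

text \<open>The matrix \<gamma> selects the half of the tree: the identity for the \<open>g0\<close>
  vertices, a fixed translation for the \<open>g1\<close> vertices.\<close>

lemma hecke_dehom:
  fixes f \<gamma>
  defines "P \<equiv> \<lambda>m x. dehom (f (matrix_inv (\<gamma> ** g0 D m x)))"
  assumes f: "f \<in> cind D kk (Vk D kk)" and \<gamma>: "det \<gamma> \<noteq> 0" and t: "t \<in> teich"
  shows "dehom (hecke D kk f (matrix_inv (\<gamma> ** g0 D (Suc m) (x + \<pi> ^ m * t)))) =
    pcompose (P m x) [:- \<sigma> t, \<sigma> \<pi>:] +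
    (\<Sum>u\<in>teich. W.contraction (P (Suc (Suc m)) (x + \<pi> ^ m * t + \<pi> ^ Suc m * u)) (\<sigma> u))"
proof -
  define y where "y = x + \<pi> ^ m * t"
  define h where "h = matrix_inv (\<gamma> ** g0 D (Suc m) y)"
  have nz: "det (\<gamma> ** g0 D n z) \<noteq> 0" for n z using \<gamma> det_g_nonzero by (simp add: det_mult2)
  have h: "det h \<noteq> 0" using nz by (simp add: h_def det_matrix_inv)
  have shift: "matrix_inv z ** h = matrix_inv (\<gamma> ** (g0 D (Suc m) y ** z))" if "det z \<noteq> 0" for z
    unfolding h_def using that nz by (simp add: matrix_inv_prod[symmetric] matrix_mul_assoc)
  have up: "f (matrix_inv (g0 D 1 u) ** h) = f (matrix_inv (\<gamma> ** g0 D (Suc (Suc m)) (y + \<pi> ^ Suc m * u)))" for u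
  proof -
    have "g0 D (Suc m) y ** g0 D 1 u = g0 D (Suc (Suc m)) (y + \<pi> ^ Suc m * u)"
      by (rule mat2_eqI) (simp_all add: g0_def mat2_mult_nth)
    then show ?thesis using shift[OF det_g_nonzero(1)] by simp
  qed
  define \<kappa> where "\<kappa> = mat2 1 t 0 1 ** mat \<pi>"
  have \<kappa>: "\<kappa> \<in> KZ D"
    unfolding \<kappa>_def using t by (intro KZ_mult KZ_unitriangular KZ_mat unif_nonzero teich_abs)
  have down: "f (matrix_inv (g1 D 0 0) ** h) = rho D kk (matrix_inv \<kappa>) (f (matrix_inv (\<gamma> ** g0 D m x)))"
  proof -
    \<comment> \<open>The neighbour \<open>g1 D 0 0\<close> undoes the last digit t, up to a
      unipotent matrix times the central \<pi>.\<close>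
    have eq: "g0 D (Suc m) y ** g1 D 0 0 = g0 D m x ** \<kappa>"
      unfolding \<kappa>_def by (rule mat2_eqI) (simp_all add: g0_def g1_def mat2_mult_nth mat_scalar_nth y_def algebra_simps)
    have "matrix_inv (g1 D 0 0) ** h = matrix_inv (\<gamma> ** g0 D m x ** \<kappa>)"
      unfolding shift[OF det_g_nonzero(2)] eq by (simp only: matrix_mul_assoc)
    also have "\<dots> = matrix_inv \<kappa> ** matrix_inv (\<gamma> ** g0 D m x)"
      by (rule matrix_inv_prod[OF nz KZ_det[OF \<kappa>]])
    finally show ?thesis
      using cind_equivariant[OF f KZ_inv[OF \<kappa>]] nz by (simp add: det_matrix_inv)
  qed
  have notin: "g1 D 0 0 \<notin> g0 D 1 ` teich"
  proof
    assume "g1 D 0 0 \<in> g0 D 1 ` teich"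
    then obtain u where "g1 D 0 0 = g0 D 1 u" by blast
    from arg_cong[OF this, of "\<lambda>g. g $ 1 $ 1"] have "\<pi> = 1" by (simp add: g0_def g1_def)
    then show False using unif_less by simp
  qed
  have inj: "inj_on (g0 D 1) teich"
  proof (rule inj_onI)
    fix u v assume "g0 D 1 u = g0 D 1 v"
    from arg_cong[OF this, of "\<lambda>g. g $ 1 $ 2"] show "u = v" by (simp add: g0_def)
  qed
  have "dehom (hecke D kk f h) = (\<Sum>z\<in>nbrs. dehom (const_poly (s ^ k) * rho D kk z (f (matrix_inv z ** h))))"
    unfolding hecke_eq[OF f h] by (rule dehom_sum)
  also have "\<dots> = dehom (const_poly (s ^ k) * rho D kk (g1 D 0 0) (f (matrix_inv (g1 D 0 0) ** h))) +
      (\<Sum>u\<in>teich. dehom (const_poly (s ^ k) * rho D kk (g0 D 1 u) (f (matrix_inv (g0 D 1 u) ** h))))"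
    unfolding nbrs_def using notin inj teich_finite by (simp add: sum.reindex del: One_nat_def)
  also have "\<dots> = pcompose (P m x) [:- \<sigma> t, \<sigma> \<pi>:] +
      (\<Sum>u\<in>teich. W.contraction (P (Suc (Suc m)) (y + \<pi> ^ Suc m * u)) (\<sigma> u))"
    unfolding up down P_def \<kappa>_def using cind_Hom[OF f]
    by (simp only: dehom_contraction dehom_expansion)
  finally show ?thesis by (simp only: h_def y_def)
qed

text \<open>The smallness is required from level M0 + 1 on, because the relation for a vertex is
  read off at its children.\<close>

lemma hecke_descent:
  assumes f: "f \<in> cind D kk (Vk D kk)" and \<gamma>: "det \<gamma> \<noteq> 0" and "0 \<le> B"
    and a: "absC D a \<le> ab \<pi> ^ d"
    and small: "\<And>m x. M0 \<le> m \<Longrightarrow> x \<in> In D (Suc m) \<Longrightarrow>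
      C.coeffs_le (B * ab \<pi> ^ d) (hecke D kk f (matrix_inv (\<gamma> ** g0 D (Suc m) x)) -
         const_poly a * f (matrix_inv (\<gamma> ** g0 D (Suc m) x)))"
    and "M0 \<le> m" "x \<in> In D m"
  shows "C.coeffs_le B (f (matrix_inv (\<gamma> ** g0 D m x)))"
proof -
  define P where "P m x = dehom (f (matrix_inv (\<gamma> ** g0 D m x)))" for m x
  obtain M where M: "\<And>m x. M \<le> m \<Longrightarrow> x \<in> In D m \<Longrightarrow> f (matrix_inv (\<gamma> ** g0 D m x)) = 0"
    using finite_support[OF f \<gamma>] by blast
  have "absC D (coeff (P m x) i) \<le> B" for i
  proof (rule W.tree_descent[where \<theta> = \<sigma> and L = teich and I = "In D" and ch = "\<lambda>m x t. x + \<pi> ^ m * t"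
        and a = a and M = M and ?M0.0 = M0])
    show "bij_betw \<sigma> teich (\<sigma> ` teich)" by (simp add: bij_betw_def inj_on_def \<sigma>_inject)
    show "degree (P m x) \<le> k" for m x by (simp add: P_def degree_dehom)
    show "x + \<pi> ^ m * t \<in> In D (Suc m)" if "x \<in> In D m" "t \<in> teich" for m x t
      using that by (force simp: In_Suc)
    show "P m x = 0" if "M \<le> m" "x \<in> In D m" for m x using M[OF that] by (simp add: P_def dehom_0)
    show "absC D a \<le> absC D (\<sigma> \<pi>) ^ d" using a by (simp add: \<sigma>_abs)
    fix m x t j assume m: "M0 \<le> m" "x \<in> In D m" "t \<in> teich"
    let ?y = "x + \<pi> ^ m * t"
    let ?h = "matrix_inv (\<gamma> ** g0 D (Suc m) ?y)"
    have y: "?y \<in> In D (Suc m)" using m by (force simp: In_Suc)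
    have "absC D (coeff (dehom (hecke D kk f ?h - const_poly a * f ?h)) j) \<le> B * ab \<pi> ^ d"
      using small[OF m(1) y] \<open>0 \<le> B\<close> unif_pos by (simp add: C.coeffs_le_def coeff_dehom)
    also have "dehom (hecke D kk f ?h - const_poly a * f ?h) = pcompose (P m x) [:- \<sigma> t, \<sigma> \<pi>:] +
        (\<Sum>u\<in>teich. W.contraction (P (Suc (Suc m)) (?y + \<pi> ^ Suc m * u)) (\<sigma> u)) - smult a (P (Suc m) ?y)"
      unfolding dehom_diff dehom_const_mult hecke_dehom[OF f \<gamma> m(3)] by (simp only: P_def)
    finally show "absC D (coeff (pcompose (P m x) [:- \<sigma> t, \<sigma> \<pi>:] +
        (\<Sum>u\<in>teich. W.contraction (P (Suc (Suc m)) (?y + \<pi> ^ Suc m * u)) (\<sigma> u)) - smult a (P (Suc m) ?y)) j)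
        \<le> B * absC D (\<sigma> \<pi>) ^ d" by (simp only: \<sigma>_abs)
  qed (use assms in auto)
  then show ?thesis using coeffs_le_iff[OF cind_Hom[OF f] \<open>0 \<le> B\<close>] by (simp add: P_def)
qed

lemma filtration_descent:
  assumes "\<tau> \<in> embeddings D" "0 < N" and a: "absC D a \<le> ab \<pi> ^ d"
    and f: "f \<in> cind D kk (Vk D kk)"
    and mem: "(\<lambda>h. hecke D kk f h - const_poly a * f h) \<in> BN_plus D kk \<tau> N n"
  shows "f \<in> BN_plus D kk \<tau> (N - 1) (n - int d)"
proof (rule BN_plusI[OF assms(1) f])
  \<comment> \<open>Chosen so that \<open>B * ab \<pi> ^ d\<close> is the bound given by the
    hypothesis; n - d may be negative, hence the integer power.\<close>
  define B where "B = ab \<pi> powi (n - int d)"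
  have B: "0 \<le> B" "B * ab \<pi> ^ d = ab \<pi> powi n"
    using unif_pos by (simp_all add: B_def power_int_diff)
  have small: "C.coeffs_le (B * ab \<pi> ^ d) (hecke D kk f h - const_poly a * f h)"
    if "det h \<noteq> 0" "F.Delta h < ab \<pi> ^ N" for h
    using BN_plus_coeffs_le[OF assms(1) mem that] B by simp
  have lt: "ab \<pi> ^ j < ab \<pi> ^ N" if "N < j" for j
    using that unif_pos unif_less by (simp add: power_strict_decreasing)
  \<comment> \<open>Coefficient bounds are KZ-invariant, so it is enough to bound f at standard
    representatives.\<close>
  have transfer: "C.coeffs_le B (f h)" if "h ** g \<in> KZ D" "C.coeffs_le B (f (matrix_inv g))" for h g
  proof -
    note nz = Delta_eq_of_mem(2,3)[OF that(1)]
    have "f ((h ** g) ** matrix_inv g) = rho D kk (h ** g) (f (matrix_inv g))"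
      using nz by (intro cind_equivariant[OF f that(1)]) (simp add: det_matrix_inv)
    then show ?thesis using nz rho_KZ_coeffs_le[OF that(1) cind_Hom[OF f] that(2)] by (simp add: matrix_inv_mult)
  qed
  fix h assume h: "det h \<noteq> 0" "F.Delta h < ab \<pi> ^ (N - 1)"
  obtain m where m: "F.Delta h = ab \<pi> ^ m" using Delta_power[OF h(1)] by blast
  have Nm: "N \<le> m"
  proof (rule ccontr)
    assume "\<not> N \<le> m"
    then have "ab \<pi> ^ (N - 1) \<le> ab \<pi> ^ m" by (intro unif_power_mono) simp
    then show False using h m by simp
  qed
  have "C.coeffs_le B (f h)"
    using tree_exists[OF h(1) m]
  proof
    assume "\<exists>\<mu>\<in>In D m. h ** g0 D m \<mu> \<in> KZ D"
    then obtain \<mu> where \<mu>: "\<mu> \<in> In D m" "h ** g0 D m \<mu> \<in> KZ D" by blast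
    have "C.coeffs_le B (f (matrix_inv (mat 1 ** g0 D m \<mu>)))"
    \<comment> \<open>In this half the level is the distance from the root, so children of vertices
      of level at least N lie outside the ball of radius N.\<close>
    proof (rule hecke_descent[OF f _ B(1) a _ Nm \<mu>(1)])
      fix j x assume "N \<le> j" "x \<in> In D (Suc j)"
      then show "C.coeffs_le (B * ab \<pi> ^ d) (hecke D kk f (matrix_inv (mat 1 ** g0 D (Suc j) x)) -
          const_poly a * f (matrix_inv (mat 1 ** g0 D (Suc j) x)))"
        using lt[of "Suc j"] det_g_nonzero
        by (intro small) (simp_all add: det_matrix_inv F.Delta_matrix_inv Delta_g0 In_abs)
    qed simp
    then show ?thesis using transfer[OF \<mu>(2)] by simp
  next
    assume "m > 0 \<and> (\<exists>\<mu>\<in>In D (m - 1). h ** g1 D (m - 1) \<mu> \<in> KZ D)"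
    then obtain \<mu> where m0: "m > 0" and \<mu>: "\<mu> \<in> In D (m - 1)" "h ** g1 D (m - 1) \<mu> \<in> KZ D" by blast
    \<comment> \<open>\<beta> carries the \<open>g0\<close> half to the \<open>g1\<close> half, up
      to the swap in KZ. There level j has distance j + 1, so the relation is available already from
      level N - 1.\<close>
    define \<beta> where "\<beta> = mat2 0 1 \<pi> 0"
    have \<beta>: "det \<beta> \<noteq> 0" using unif_nonzero by (simp add: \<beta>_def det_2)
    have g1_eq: "g1 D j x = \<beta> ** g0 D j x ** mat2 0 1 1 0" for j x
      by (rule mat2_eqI) (simp_all add: \<beta>_def g0_def g1_def mat2_mult_nth)
    have "C.coeffs_le B (f (matrix_inv (\<beta> ** g0 D (m - 1) \<mu>)))"
    proof (rule hecke_descent[OF f \<beta> B(1) a _ _ \<mu>(1), where ?M0.0 = "N - 1"])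
      fix j x assume j: "N - 1 \<le> j" "x \<in> In D (Suc j)"
      have nz: "det (\<beta> ** g0 D (Suc j) x) \<noteq> 0" using \<beta> det_g_nonzero by (simp add: det_mult2)
      have "F.Delta (\<beta> ** g0 D (Suc j) x) = F.Delta (g1 D (Suc j) x)"
        unfolding g1_eq using KZ_Delta_mult(2)[OF KZ_swap nz] by simp
      also have "\<dots> = ab \<pi> ^ (Suc j + 1)" using j by (intro Delta_g1 In_abs)
      also have "\<dots> < ab \<pi> ^ N" using j \<open>0 < N\<close> by (intro lt) simp
      finally show "C.coeffs_le (B * ab \<pi> ^ d) (hecke D kk f (matrix_inv (\<beta> ** g0 D (Suc j) x)) -
          const_poly a * f (matrix_inv (\<beta> ** g0 D (Suc j) x)))"
        using nz by (intro small) (simp_all add: det_matrix_inv F.Delta_matrix_inv)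
    qed (use Nm in simp)
    moreover have "h ** (\<beta> ** g0 D (m - 1) \<mu>) \<in> KZ D"
      using \<mu>(2) KZ_mult_right_iff[OF KZ_swap] unfolding g1_eq matrix_mul_assoc by blast
    ultimately show ?thesis by (rule transfer[rotated])
  qed
  then show "C.coeffs_le (ab \<pi> powi (n - int d)) (f h)" by (simp only: B_def)
qed

end

theorem theorem4p18:
  fixes D :: "('q::field_char_0, 'f::field_char_0, 'c::field_char_0) padic_data"
    and \<tau> \<sigma> :: "'f \<Rightarrow> 'c"
    and kk :: "('f \<Rightarrow> 'c) \<Rightarrow> nat"
    and k d r N :: nat
    and a :: 'c
  assumes "padic_setup D"
    and "\<tau> \<in> embeddings D"
    and "\<sigma> \<in> embeddings D"
    and "kk \<sigma> = k"
    and "\<forall>\<sigma>'\<in>embeddings D. \<sigma>' \<noteq> \<sigma> \<longrightarrow> kk \<sigma>' = 0"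
    and "real k \<le> min (real (prm D) * real (resq D) - 1) ((real (resq D))\<^sup>2 / 2)"
    and "k = d * resq D + r"
    and "int d - 1 \<le> int r"
    and "r < resq D"
    and "a \<in> OC D"
    and "valC D a \<ge> ereal (real d)"
    and "N > 0"
  shows "\<exists>\<epsilon>::nat. \<forall>n::nat. \<forall>f\<in>cind D kk (Vk D kk).
           (\<lambda>h. hecke D kk f h - const_poly a * f h) \<in> BN_plus D kk \<tau> N (int n) \<longrightarrow>
           f \<in> BN_plus D kk \<tau> (N - 1) (int n - int \<epsilon>)"
proof -
  interpret padic_setup D by fact
  have q: "0 < resq D" using assms(9) by simp
  have "2 * d \<le> resq D"
  proof -
    have "2 * real k \<le> real (resq D) * real (resq D)" using assms(6) by (simp add: power2_eq_square)
    then have "2 * k \<le> resq D * resq D" by (metis of_nat_le_iff of_nat_mult of_nat_numeral)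
    moreover have "(2 * d) * resq D \<le> 2 * k" using assms(7) by simp
    ultimately have "(2 * d) * resq D \<le> resq D * resq D" by (rule le_trans[rotated])
    then show ?thesis using q by (simp only: mult_le_cancel2)
  qed
  moreover have "d < prm D"
  proof -
    have "real k < real (prm D) * real (resq D)" using assms(6) by simp
    then have "k < prm D * resq D" by (metis of_nat_less_iff of_nat_mult)
    then have "d * resq D < prm D * resq D" using assms(7) by linarith
    then show ?thesis by simp
  qed
  ultimately interpret hecke_weight D \<sigma> kk k d r
    using assms(3-5,7-9) q by unfold_locales auto
  have "absC D a \<le> ab \<pi> ^ d"
  proof (cases "a = 0")
    case False
    then have "real d \<le> ln (absC D a) / ln (ab \<pi>)" using assms(11) by (simp add: valC_def)
    moreover have "ln (ab \<pi>) < 0" using unif_pos unif_less by simp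
    ultimately have "ln (absC D a) \<le> real d * ln (ab \<pi>)" by (simp add: neg_le_divide_eq)
    also have "\<dots> = ln (ab \<pi> ^ d)" using unif_pos by (simp add: ln_realpow)
    finally show ?thesis using False unif_pos by simp
  qed simp
  then show ?thesis using filtration_descent[OF assms(2,12)] by blast
qed

end
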